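(* Let $d\ge 1$, let $\mathcal{P}\subset\mathbb{R}^n$ be a rational polytope of dimension $d$, and let $p_{d-1}$ be the $(d-1)$-index of $\mathcal{P}$. Write the Ehrhart quasi-polynomial of $\mathcal{P}$ as $L_{\mathcal{P}}(k) = c_d(k)\,k^d + c_{d-1}(k)\,k^{d-1} + \dots + c_0(k)$ with $c_0,\dots,c_d$ periodic. Then $c_{d-1}$ has minimum period $p_{d-1}$.
   Context: A quasi-polynomial is a function on $\mathbb{Z}$ of the form $q(k) = c_d(k)k^d + \dots + c_0(k)$ where $c_0,\dots,c_d$ are periodic functions of $k\in\mathbb{Z}$, called the coefficient functions of $q$ (they are uniquely determined by $q$, even by its values at positive integers). The minimum period of a periodic function $c:\mathbb{Z}\to\mathbb{C}$ is the smallest positive integer $p$ with $c(k+p)=c(k)$ for all $k\in\mathbb{Z}$. A rational polytope $\mathcal{P}\subset\mathbb{R}^n$ is the convex hull of finitely many points of $\mathbb{Q}^n$; its dimension $d$ is the dimension of its affine span (it need not be full-dimensional, i.e. $d\le n$). Ehrhart's theorem: the function $L_{\mathcal{P}}(k) := \#(k\mathcal{P}\cap\mathbb{Z}^n)$, $k\in\mathbb{Z}_{>0}$, agrees with a (unique) quasi-polynomial of degree $d$, called the Ehrhart quasi-polynomial of $\mathcal{P}$ and again denoted $L_{\mathcal{P}}$. For $0\le j\le d$, the $j$-index of a rational $d$-dimensional polytope $\mathcal{P}$ is the minimal positive integer $p_j$ such that the affine span of every $j$-dimensional face of $p_j\mathcal{P}$ contains a point of $\mathbb{Z}^n$. *)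

theory Defs
  imports "HOL-Analysis.Analysis"
begin

definition rational_polytope :: "(real ^ 'n) set \<Rightarrow> bool" where
  "rational_polytope P \<longleftrightarrow>
     (\<exists>V. finite V \<and> (\<forall>v\<in>V. \<forall>i. v $ i \<in> \<rat>) \<and> P = convex hull V)"

definition integer_points :: "(real ^ 'n) set" where
  "integer_points = {x. \<forall>i. x $ i \<in> \<int>}"

definition dilate :: "nat \<Rightarrow> (real ^ 'n) set \<Rightarrow> (real ^ 'n) set" where
  "dilate k P = (\<lambda>x. real k *\<^sub>R x) ` P"

definition periodic :: "(int \<Rightarrow> complex) \<Rightarrow> bool" where
  "periodic c \<longleftrightarrow> (\<exists>p>0. \<forall>k. c (k + p) = c k)"

definition has_minimum_period :: "(int \<Rightarrow> complex) \<Rightarrow> nat \<Rightarrow> bool" where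
  "has_minimum_period c p \<longleftrightarrow>
     p > 0 \<and> (\<forall>k. c (k + int p) = c k) \<and>
     (\<forall>q>0. (\<forall>k. c (k + int q) = c k) \<longrightarrow> p \<le> q)"

definition has_quasi_polynomial_form ::
    "(int \<Rightarrow> complex) \<Rightarrow> nat \<Rightarrow> (nat \<Rightarrow> int \<Rightarrow> complex) \<Rightarrow> bool" where
  "has_quasi_polynomial_form q d c \<longleftrightarrow>
     (\<forall>i\<le>d. periodic (c i)) \<and> (\<forall>k. q k = (\<Sum>i\<le>d. c i k * of_int k ^ i))"

definition quasi_polynomial :: "(int \<Rightarrow> complex) \<Rightarrow> bool" where
  "quasi_polynomial q \<longleftrightarrow> (\<exists>d c. has_quasi_polynomial_form q d c)"

(* A relation rather than a function: a quasi-polynomial is determined by its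
   values at the positive integers, so at most one q is related to P, and
   Ehrhart's theorem says that one exists for every nonempty rational polytope. *)
definition is_Ehrhart_quasi_polynomial ::
    "(real ^ 'n) set \<Rightarrow> (int \<Rightarrow> complex) \<Rightarrow> bool" where
  "is_Ehrhart_quasi_polynomial P q \<longleftrightarrow>
     quasi_polynomial q \<and>
     (\<forall>k::nat. k > 0 \<longrightarrow> q (int k) = of_nat (card (dilate k P \<inter> integer_points)))"

(* For a rational polytope a common denominator of the vertices satisfies the
   condition, so the LEAST is attained.  The empty face has aff_dim -1 and is
   therefore never among the faces considered. *)
definition face_index :: "nat \<Rightarrow> (real ^ 'n) set \<Rightarrow> nat" where
  "face_index j P =
     (LEAST p. p > 0 \<and>
        (\<forall>F. F face_of dilate p P \<and> aff_dim F = int j \<longrightarrow>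
             affine hull F \<inter> integer_points \<noteq> {}))"

end

theory Submission
  imports Defs
begin

text \<open>Let a facet \<open>F\<close> of \<open>P\<close> be cut out by \<open>a\<^sub>F \<bullet> x \<le> b\<^sub>F\<close>, with \<open>a\<^sub>F\<close> scaled so that it takes exactly the
  integer values on the lattice of integer directions of \<open>aff P\<close>.  If \<open>k aff P\<close> contains an integer
  point then the count for \<open>k P\<close> depends only on the integer parts of the right-hand sides, and raising
  one of them by 1 adds a slice with \<open>W\<^sub>F(k) + o(k^(d-1))\<close> points, where \<open>W\<^sub>F(k)\<close> counts the integer points
  of a translate of \<open>k F\<close>.  Hence \<open>L(k + q) - L(k)\<close> is, up to \<open>o(k^(d-1))\<close>, an integer combination
  of the \<open>W\<^sub>F(k)\<close>.  Comparing with the coefficients of \<open>L\<close>, the difference \<open>c(k + p) - c(k)\<close> of values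
  of \<open>c = c\<^sub>d\<^sub>-\<^sub>1\<close> does not depend on \<open>k\<close> when \<open>p\<close> is the index, so it vanishes by periodicity.
  Conversely a period \<open>q\<close> allows no loss in passing from the \<open>q b\<^sub>F\<close> to integer parts, because
  \<open>W\<^sub>F(k)\<close> is bounded below by a positive multiple of \<open>k^(d-1)\<close>; that \<open>q aff P\<close> contains an integer point
  at all follows from \<open>c(0) \<noteq> 0\<close>, which is obtained by comparing \<open>L(2k)\<close> with \<open>2^d L(k)\<close>.
  No volumes are needed.\<close>

section \<open>Integer points of rational subspaces\<close>

text \<open>With volumes avoided, no limit of \<open>W\<^sub>F(k) / k^(d-1)\<close> is at hand.
  Three weaker facts take its place: the quotient is bounded, it is bounded below by a positive
  constant, and it changes by \<open>o(1)\<close> when \<open>k\<close> is shifted by a fixed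
  amount. The third fact is the delicate one. It says that a bounded enlargement of a scaled facet
  gains few lattice points, and it is obtained by spreading copies of one thin shell over many
  disjoint shells. The leading coefficient is not known in advance to be constant either. The
  \<open>k\<close> for which \<open>k aff P\<close> meets the lattice are closed under sums and
  positive differences; \<open>c\<^sub>d\<close> is invariant under shifts by such \<open>k\<close>,
  and on the remaining residue classes the top two coefficients vanish. The familiar value of
  \<open>c(0)\<close>, half the sum of the relative facet volumes, is replaced by a sign: the
  lattice points of \<open>2 k P\<close> split into classes modulo 2, each class is a copy of
  \<open>k P\<close> with right-hand sides moved by half-integers, and rounding these down loses on
  average.\<close>

lemma integer_points_add: "x \<in> integer_points \<Longrightarrow> y \<in> integer_points \<Longrightarrow> x + y \<in> integer_points"
  and integer_points_diff: "x \<in> integer_points \<Longrightarrow> y \<in> integer_points \<Longrightarrow> x - y \<in> integer_points"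
  and integer_points_zero: "0 \<in> integer_points"
  and integer_points_minus: "x \<in> integer_points \<Longrightarrow> - x \<in> integer_points"
  and integer_points_scale: "r \<in> \<int> \<Longrightarrow> x \<in> integer_points \<Longrightarrow> r *\<^sub>R x \<in> integer_points"
  by (auto simp: integer_points_def)

lemma integer_points_sum:
  "(\<And>i. i \<in> S \<Longrightarrow> f i \<in> integer_points) \<Longrightarrow> sum f S \<in> integer_points"
  by (induction S rule: infinite_finite_induct) (auto simp: integer_points_zero integer_points_add)

lemma finite_integer_points_bounded:
  fixes S :: "(real ^ 'n) set"
  assumes "bounded S"
  shows "finite (integer_points \<inter> S)"
proof -
  obtain r where r: "\<And>x. x \<in> S \<Longrightarrow> norm x \<le> r"
    using assms by (auto simp: bounded_iff)
  define N where "N = \<lceil>r\<rceil>"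
  have "integer_points \<inter> S \<subseteq> (\<lambda>f. \<chi> i. of_int (f i)) ` (UNIV \<rightarrow>\<^sub>E {-N..N})"
  proof
    fix x assume x: "x \<in> integer_points \<inter> S"
    have 1: "of_int \<lfloor>x $ i\<rfloor> = x $ i" for i
      using x by (auto simp: integer_points_def elim!: Ints_cases)
    have 2: "\<lfloor>x $ i\<rfloor> \<in> {-N..N}" for i
    proof -
      have "\<bar>x $ i\<bar> \<le> r"
        using component_le_norm_cart[of x i] r[of x] x by auto
      then have "\<bar>real_of_int \<lfloor>x $ i\<rfloor>\<bar> \<le> real_of_int N"
        unfolding 1 N_def by linarith
      then show ?thesis by auto
    qed
    show "x \<in> (\<lambda>f. \<chi> i. of_int (f i)) ` (UNIV \<rightarrow>\<^sub>E {-N..N})"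
      using 2 by (intro image_eqI[of _ _ "\<lambda>i. \<lfloor>x $ i\<rfloor>"]) (auto simp: vec_eq_iff 1)
  qed
  then show ?thesis
    by (rule finite_subset) (intro finite_imageI finite_PiE; simp)
qed

lemma card_le_fibers:
  assumes "finite T" and "\<phi> ` S \<subseteq> T"
    and "\<And>t. t \<in> T \<Longrightarrow> finite {x \<in> S. \<phi> x = t} \<and> card {x \<in> S. \<phi> x = t} \<le> M"
  shows "card S \<le> M * card T"
proof -
  have "S = (\<Union>t\<in>T. {x \<in> S. \<phi> x = t})"
    using assms(2) by auto
  then have "card S \<le> (\<Sum>t\<in>T. card {x \<in> S. \<phi> x = t})"
    using card_UN_le[OF assms(1), of "\<lambda>t. {x \<in> S. \<phi> x = t}"] by simp
  also have "\<dots> \<le> of_nat (card T) * M"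
    using assms(3) by (intro sum_bounded_above) auto
  finally show ?thesis by (simp add: mult.commute)
qed

text \<open>The set \<open>B\<close> need not be a basis of the lattice
  \<open>integer_points \<inter> U\<close>, so lattice points may have fractional coordinates.
  Orders of growth are insensitive to this, which spares the construction of a lattice
  basis.\<close>

definition integral_subspace :: "(real ^ 'n) set \<Rightarrow> nat \<Rightarrow> bool" where
  "integral_subspace U m \<longleftrightarrow>
     (\<exists>B \<subseteq> integer_points. independent B \<and> span B = U \<and> card B = m)"

lemma integral_subspace_imp_subspace: "integral_subspace U m \<Longrightarrow> subspace U"
  by (auto simp: integral_subspace_def)

lemma rational_vector_integer_multiple:
  fixes v :: "real ^ 'n"
  assumes "\<And>i. v $ i \<in> \<rat>"
  shows "\<exists>N::nat. N > 0 \<and> real N *\<^sub>R v \<in> integer_points"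
proof -
  have "\<exists>m::nat. m > 0 \<and> real m * v $ i \<in> \<int>" for i
  proof -
    obtain p q where "q > 0" "v $ i = of_int p / of_int q"
      using assms[of i] by (auto elim: Rats_cases')
    then show ?thesis
      by (intro exI[of _ "nat q"]) auto
  qed
  then obtain m :: "'n \<Rightarrow> nat" where m: "\<And>i. m i > 0" "\<And>i. real (m i) * v $ i \<in> \<int>"
    by metis
  have "real (prod m UNIV) * v $ i \<in> \<int>" for i
  proof -
    have "prod m UNIV = m i * prod m (UNIV - {i})"
      by (simp add: prod.remove)
    then have "real (prod m UNIV) * v $ i = real (prod m (UNIV - {i})) * (real (m i) * v $ i)"
      by simp
    then show ?thesis using m(2) by (metis Ints_mult Ints_of_nat)
  qed
  then show ?thesis
    using m(1) by (intro exI[of _ "prod m UNIV"]) (auto simp: integer_points_def prod_pos)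
qed

lemma integral_subspace_span:
  fixes S :: "(real ^ 'n) set"
  assumes "\<And>v i. v \<in> S \<Longrightarrow> v $ i \<in> \<rat>"
  shows "integral_subspace (span S) (dim S)"
proof -
  obtain N :: "real ^ 'n \<Rightarrow> nat"
    where N: "\<And>v. v \<in> S \<Longrightarrow> N v > 0 \<and> real (N v) *\<^sub>R v \<in> integer_points"
    using rational_vector_integer_multiple assms by metis
  define S' where "S' = (\<lambda>v. real (N v) *\<^sub>R v) ` S"
  have "span S' = span S"
    unfolding span_eq
  proof
    show "S' \<subseteq> span S"
      by (auto simp: S'_def intro: span_scale span_base)
    show "S \<subseteq> span S'"
    proof
      fix v assume v: "v \<in> S"
      have "(1 / real (N v)) *\<^sub>R (real (N v) *\<^sub>R v) \<in> span S'"
        using v by (intro span_scale span_base) (auto simp: S'_def)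
      then show "v \<in> span S'" using N[OF v] by simp
    qed
  qed
  obtain B where B: "B \<subseteq> S'" "independent B" "S' \<subseteq> span B" "card B = dim S'"
    using basis_exists by blast
  have "span B = span S'"
    unfolding span_eq using B(1,3) span_superset by blast
  moreover have "dim S' = dim S"
    using \<open>span S' = span S\<close> by (metis dim_span)
  moreover have "B \<subseteq> integer_points"
    using B(1) N by (auto simp: S'_def)
  ultimately show ?thesis
    using B \<open>span S' = span S\<close> unfolding integral_subspace_def by metis
qed

text \<open>The functionals are extended from the span to the whole space, where linearity bounds
  them by a multiple of the norm.\<close>

lemma coordinate_functionals:
  fixes B :: "(real ^ 'n) set"
  assumes "independent B"
  obtains g :: "real ^ 'n \<Rightarrow> real ^ 'n \<Rightarrow> real"
  where "\<And>b. linear (g b)" "\<And>b b'. b \<in> B \<Longrightarrow> b' \<in> B \<Longrightarrow> g b b' = (if b = b' then 1 else 0)"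
    "\<And>v. v \<in> span B \<Longrightarrow> v = (\<Sum>b\<in>B. g b v *\<^sub>R b)"
proof -
  have fin: "finite B" using assms independent_imp_finite by blast
  have "\<exists>h. linear h \<and> (\<forall>b'\<in>B. h b' = (if b = b' then 1 else 0 :: real))" for b
    by (rule linear_independent_extend[OF assms])
  then obtain g where g: "\<And>b. linear (g b)"
    "\<And>b b'. b' \<in> B \<Longrightarrow> g b b' = (if b = b' then 1 else 0 :: real)"
    by metis
  have "v = (\<Sum>b\<in>B. g b v *\<^sub>R b)" if "v \<in> span B" for v
    using that
  proof (induction rule: span_induct)
    case base
    have "c *\<^sub>R x = (\<Sum>b\<in>B. g b (c *\<^sub>R x) *\<^sub>R b)" if x: "x = (\<Sum>b\<in>B. g b x *\<^sub>R b)" for c x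
    proof -
      have "c *\<^sub>R x = c *\<^sub>R (\<Sum>b\<in>B. g b x *\<^sub>R b)" using x by simp
      also have "\<dots> = (\<Sum>b\<in>B. g b (c *\<^sub>R x) *\<^sub>R b)"
        using g(1) by (simp add: linear_scale scaleR_sum_right)
      finally show ?thesis .
    qed
    then show ?case
      using g(1) by (auto simp: subspace_def linear_0 linear_add scaleR_left_distrib sum.distrib)
  next
    case (step x)
    have "(\<Sum>b\<in>B. g b x *\<^sub>R b) = (\<Sum>b\<in>B. if b = x then b else 0)"
      using g(2) step by (intro sum.cong) auto
    also have "\<dots> = x" using step fin by simp
    finally show ?case by (rule sym)
  qed
  then show thesis by (intro that[of g] g) auto
qed

text \<open>Rounding each coordinate down moves a vector by at most the sum of the norms of the
  basis. All later rounding to the lattice rests on this radius.\<close>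

lemma integral_subspace_covering:
  fixes U :: "(real ^ 'n) set"
  assumes "integral_subspace U m"
  obtains R where "R \<ge> 0" "\<And>v. v \<in> U \<Longrightarrow> \<exists>x \<in> U \<inter> integer_points. norm (v - x) \<le> R"
proof -
  obtain B where B: "B \<subseteq> integer_points" "independent B" "span B = U"
    using assms by (auto simp: integral_subspace_def)
  obtain g where g: "\<And>v. v \<in> U \<Longrightarrow> v = (\<Sum>b\<in>B. g b v *\<^sub>R b)"
    using coordinate_functionals[OF B(2)] B(3) by metis
  have "\<exists>x \<in> U \<inter> integer_points. norm (v - x) \<le> (\<Sum>b\<in>B. norm b)" if v: "v \<in> U" for v
  proof
    let ?x = "\<Sum>b\<in>B. of_int \<lfloor>g b v\<rfloor> *\<^sub>R b"
    show "?x \<in> U \<inter> integer_points"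
    proof
      show "?x \<in> U" unfolding B(3)[symmetric] by (intro span_sum span_scale span_base)
      show "?x \<in> integer_points"
        using B(1) by (intro integer_points_sum integer_points_scale) auto
    qed
    have "v - ?x = (\<Sum>b\<in>B. (g b v - of_int \<lfloor>g b v\<rfloor>) *\<^sub>R b)"
      using g[OF v] by (simp add: scaleR_left_diff_distrib sum_subtractf)
    also have "norm \<dots> \<le> (\<Sum>b\<in>B. norm b)"
    proof (rule sum_norm_le)
      fix b :: "real ^ 'n"
      have "\<bar>g b v - of_int \<lfloor>g b v\<rfloor>\<bar> \<le> 1" by linarith
      then show "norm ((g b v - of_int \<lfloor>g b v\<rfloor>) *\<^sub>R b) \<le> norm b"
        by (simp add: mult_left_le_one_le)
    qed
    finally show "norm (v - ?x) \<le> (\<Sum>b\<in>B. norm b)" .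
  qed
  moreover have "(\<Sum>b\<in>B. norm b) \<ge> 0" by (simp add: sum_nonneg)
  ultimately show thesis using that by blast
qed

text \<open>A lattice point is determined by the integer parts of its coordinates, of which there
  are \<open>O(s^m)\<close>, together with the remainder, an integer point of norm at most
  \<open>R\<close>. The remainder can be nonzero because \<open>B\<close> need not generate the
  lattice.\<close>

lemma integral_subspace_card_upper:
  fixes U :: "(real ^ 'n) set"
  assumes "integral_subspace U m"
  obtains C where "C > 0"
    "\<And>s. s \<ge> 1 \<Longrightarrow> real (card (integer_points \<inter> U \<inter> cball 0 s)) \<le> C * s ^ m"
proof -
  obtain B where B: "B \<subseteq> integer_points" "independent B" "span B = U" "card B = m"
    using assms by (auto simp: integral_subspace_def)
  have fin: "finite B" using B independent_imp_finite by blast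
  obtain g where g: "\<And>b. linear (g b)" "\<And>v. v \<in> U \<Longrightarrow> v = (\<Sum>b\<in>B. g b v *\<^sub>R b)"
    using coordinate_functionals[OF B(2)] B(3) by metis
  have "\<exists>c>0. \<forall>v. \<bar>g b v\<bar> \<le> c * norm v" for b
    using linear_bounded_pos[OF g(1)[of b]] by auto
  then obtain c where c: "\<And>b. c b > 0" "\<And>b v. \<bar>g b v\<bar> \<le> c b * norm v" by metis
  define D where "D = (\<Sum>b\<in>B. c b)"
  have D0: "D \<ge> 0" unfolding D_def using c(1) by (simp add: less_imp_le sum_nonneg)
  have D: "\<bar>g b v\<bar> \<le> D * norm v" if "b \<in> B" for b v
  proof -
    have "c b \<le> D" unfolding D_def using that fin c(1) by (intro member_le_sum) (auto intro: less_imp_le)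
    then show ?thesis using c(2)[of b v] by (meson mult_right_mono norm_ge_zero order_trans)
  qed
  define R where "R = (\<Sum>b\<in>B. norm b)"
  define Q where "Q = card (integer_points \<inter> cball (0::real^'n) R)"
  have "real (card (integer_points \<inter> U \<inter> cball 0 s)) \<le> (real Q + 1) * (2 * D + 7) ^ m * s ^ m"
    if s: "s \<ge> 1" for s
  proof -
    define N where "N = \<lceil>D * s\<rceil> + 1"
    have "D * s \<ge> 0" using D0 s by simp
    then have N0: "N \<ge> 0" unfolding N_def by linarith
    define F where "F = (\<lambda>v. (restrict (\<lambda>b. \<lfloor>g b v\<rfloor>) B, v - (\<Sum>b\<in>B. of_int \<lfloor>g b v\<rfloor> *\<^sub>R b)))"
    have inj: "inj_on F (integer_points \<inter> U \<inter> cball 0 s)"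
    proof (rule inj_onI)
      fix v w assume "F v = F w"
      then have 1: "restrict (\<lambda>b. \<lfloor>g b v\<rfloor>) B = restrict (\<lambda>b. \<lfloor>g b w\<rfloor>) B"
        and 2: "v - (\<Sum>b\<in>B. of_int \<lfloor>g b v\<rfloor> *\<^sub>R b) = w - (\<Sum>b\<in>B. of_int \<lfloor>g b w\<rfloor> *\<^sub>R b)"
        by (auto simp: F_def)
      have "\<lfloor>g b v\<rfloor> = \<lfloor>g b w\<rfloor>" if "b \<in> B" for b
        using fun_cong[OF 1, of b] that by simp
      then have "(\<Sum>b\<in>B. of_int \<lfloor>g b v\<rfloor> *\<^sub>R b) = (\<Sum>b\<in>B. of_int \<lfloor>g b w\<rfloor> *\<^sub>R b)"
        by (intro sum.cong) auto
      then show "v = w" using 2 by simp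
    qed
    have sub: "F ` (integer_points \<inter> U \<inter> cball 0 s)
        \<subseteq> (B \<rightarrow>\<^sub>E {-N..N}) \<times> (integer_points \<inter> cball 0 R)"
    proof
      fix y assume "y \<in> F ` (integer_points \<inter> U \<inter> cball 0 s)"
      then obtain v where v: "v \<in> integer_points" "v \<in> U" "norm v \<le> s" "y = F v" by auto
      have "\<lfloor>g b v\<rfloor> \<in> {-N..N}" if "b \<in> B" for b
      proof -
        have "\<bar>g b v\<bar> \<le> D * s" using D[OF that, of v] v(3) D0 by (meson mult_left_mono order_trans)
        then have "\<bar>g b v\<bar> \<le> of_int \<lceil>D * s\<rceil>" by linarith
        then have "g b v \<le> of_int \<lceil>D * s\<rceil>" "- of_int \<lceil>D * s\<rceil> \<le> g b v" by auto
        then show ?thesis unfolding N_def by (auto simp: le_floor_iff) linarith+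
      qed
      moreover have "v - (\<Sum>b\<in>B. of_int \<lfloor>g b v\<rfloor> *\<^sub>R b) \<in> integer_points"
        using B v by (auto intro!: integer_points_diff integer_points_sum integer_points_scale)
      moreover have "norm (v - (\<Sum>b\<in>B. of_int \<lfloor>g b v\<rfloor> *\<^sub>R b)) \<le> R"
      proof -
        have "v - (\<Sum>b\<in>B. of_int \<lfloor>g b v\<rfloor> *\<^sub>R b) = (\<Sum>b\<in>B. (g b v - of_int \<lfloor>g b v\<rfloor>) *\<^sub>R b)"
          using g(2)[OF v(2)] by (simp add: scaleR_left_diff_distrib sum_subtractf)
        also have "norm \<dots> \<le> R" unfolding R_def
        proof (rule sum_norm_le)
          fix b :: "real ^ 'n"
          have "\<bar>g b v - of_int \<lfloor>g b v\<rfloor>\<bar> \<le> 1" by linarith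
          then show "norm ((g b v - of_int \<lfloor>g b v\<rfloor>) *\<^sub>R b) \<le> norm b"
            by (simp add: mult_left_le_one_le)
        qed
        finally show ?thesis .
      qed
      ultimately show "y \<in> (B \<rightarrow>\<^sub>E {-N..N}) \<times> (integer_points \<inter> cball 0 R)"
        using v(4) by (auto simp: F_def)
    qed
    have "card (integer_points \<inter> U \<inter> cball 0 s)
        \<le> card ((B \<rightarrow>\<^sub>E {-N..N}) \<times> (integer_points \<inter> cball (0::real^'n) R))"
      using sub inj fin finite_integer_points_bounded[of "cball (0::real^'n) R"]
      by (intro card_inj_on_le[of F] finite_cartesian_product finite_PiE) auto
    also have "\<dots> = nat (2 * N + 1) ^ m * Q"
      using fin B(4) N0 by (simp add: card_cartesian_product card_PiE Q_def)
    finally have "real (card (integer_points \<inter> U \<inter> cball 0 s)) \<le> real (nat (2 * N + 1) ^ m * Q)"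
      by (simp only: of_nat_le_iff)
    also have "\<dots> = (2 * real_of_int N + 1) ^ m * Q"
      using N0 by simp
    \<comment> \<open>Here \<open>2 * N + 1\<close> is at most \<open>2 * D * s + 5\<close>, and
      \<open>s \<ge> 1\<close> absorbs the constant; \<open>Q + 1\<close> makes the final factor
      positive.\<close>
    also have "\<dots> \<le> ((2 * D + 7) * s) ^ m * (Q + 1)"
    proof (intro mult_mono power_mono)
      have "real_of_int N \<le> D * s + 2" unfolding N_def by linarith
      then show "2 * real_of_int N + 1 \<le> (2 * D + 7) * s"
        using s D0 by (simp add: algebra_simps)
    qed (use N0 D0 s in auto)
    finally show ?thesis by (simp add: power_mult_distrib mult_ac add_ac)
  qed
  moreover have "(real Q + 1) * (2 * D + 7) ^ m > 0" using D0 by simp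
  ultimately show thesis using that by blast
qed

text \<open>Combinations of \<open>B\<close> with coefficients in \<open>{0..k}\<close>, where
  \<open>k\<close> is about \<open>s / R\<close>, are distinct lattice points of the ball.\<close>

lemma integral_subspace_card_lower:
  fixes U :: "(real ^ 'n) set"
  assumes "integral_subspace U m"
  obtains c where "c > 0"
    "\<And>s. s \<ge> 0 \<Longrightarrow> c * s ^ m \<le> real (card (integer_points \<inter> U \<inter> cball 0 s))"
proof -
  obtain B where B: "B \<subseteq> integer_points" "independent B" "span B = U" "card B = m"
    using assms by (auto simp: integral_subspace_def)
  have fin: "finite B" using B independent_imp_finite by blast
  obtain g where g: "\<And>b. linear (g b)"
      "\<And>b b'. b \<in> B \<Longrightarrow> b' \<in> B \<Longrightarrow> g b b' = (if b = b' then 1 else 0 :: real)"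
    using coordinate_functionals[OF B(2)] by metis
  \<comment> \<open>The summand 1 keeps \<open>R\<close> positive when \<open>B\<close> is empty,
    the case \<open>m = 0\<close> that occurs for the end points of a segment.\<close>
  define R where "R = 1 + (\<Sum>b\<in>B. norm b)"
  have R: "R > 0" unfolding R_def by (simp add: add_pos_nonneg sum_nonneg)
  have "(1 / R) ^ m * s ^ m \<le> real (card (integer_points \<inter> U \<inter> cball 0 s))" if s: "s \<ge> 0" for s
  proof -
    define k where "k = \<lfloor>s / R\<rfloor>"
    have k: "k \<ge> 0" "of_int k \<le> s / R" "s / R \<le> of_int k + 1"
      using s R unfolding k_def by (auto intro: less_imp_le)
    define F where "F = (\<lambda>n. \<Sum>b\<in>B. real_of_int (n b) *\<^sub>R b)"
    have gF: "g b (F n) = n b" if "b \<in> B" for b n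
    proof -
      have "g b (F n) = (\<Sum>b'\<in>B. real_of_int (n b') * g b b')"
        unfolding F_def using g(1) by (simp add: linear_sum linear_scale)
      also have "\<dots> = (\<Sum>b'\<in>B. if b = b' then real_of_int (n b') else 0)"
        using g(2) that by (intro sum.cong) auto
      also have "\<dots> = n b" using that fin by simp
      finally show ?thesis .
    qed
    have inj: "inj_on F (B \<rightarrow>\<^sub>E {0..k})"
    proof (rule inj_onI)
      fix n n' assume n: "n \<in> B \<rightarrow>\<^sub>E {0..k}" "n' \<in> B \<rightarrow>\<^sub>E {0..k}" "F n = F n'"
      then have "n b = n' b" if "b \<in> B" for b using gF[OF that, of n] gF[OF that, of n'] by simp
      then show "n = n'" using n(1,2) by (intro PiE_ext) auto
    qed
    have sub: "F ` (B \<rightarrow>\<^sub>E {0..k}) \<subseteq> integer_points \<inter> U \<inter> cball 0 s"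
    proof
      fix y assume "y \<in> F ` (B \<rightarrow>\<^sub>E {0..k})"
      then obtain n where n: "n \<in> B \<rightarrow>\<^sub>E {0..k}" "y = F n" by auto
      have "y \<in> integer_points"
        unfolding n(2) F_def using B(1) by (intro integer_points_sum integer_points_scale) auto
      moreover have "y \<in> U"
        unfolding n(2) F_def B(3)[symmetric] by (intro span_sum span_scale span_base)
      moreover have "norm y \<le> s"
      proof -
        have "norm y \<le> (\<Sum>b\<in>B. (s / R) * norm b)"
          unfolding n(2) F_def
        proof (rule sum_norm_le)
          fix b assume "b \<in> B"
          then have "0 \<le> n b" "n b \<le> k" using n(1) by (auto simp: PiE_def Pi_def)
          then have "\<bar>real_of_int (n b)\<bar> \<le> s / R" using k(2) by linarith
          then show "norm (real_of_int (n b) *\<^sub>R b) \<le> s / R * norm b"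
            unfolding norm_scaleR by (rule mult_right_mono) simp
        qed
        also have "\<dots> = (s / R) * (\<Sum>b\<in>B. norm b)" by (simp add: sum_distrib_left)
        also have "\<dots> \<le> (s / R) * R"
          using s R by (intro mult_left_mono) (auto simp: R_def)
        finally show ?thesis using R by simp
      qed
      ultimately show "y \<in> integer_points \<inter> U \<inter> cball 0 s" by simp
    qed
    have "(1 / R) ^ m * s ^ m = (s / R) ^ m" by (simp add: power_divide)
    also have "\<dots> \<le> (of_int k + 1) ^ m" using k s R by (intro power_mono) auto
    also have "\<dots> = real (card (B \<rightarrow>\<^sub>E {0..k}))"
      using fin k B(4) by (simp add: card_PiE)
    also have "\<dots> \<le> real (card (integer_points \<inter> U \<inter> cball 0 s))"
      using card_inj_on_le[OF inj sub] finite_integer_points_bounded[of "U \<inter> cball 0 s"]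
      by (simp add: Int_assoc bounded_Int)
    finally show ?thesis .
  qed
  moreover have "(1 / R) ^ m > 0" using R by simp
  ultimately show thesis using that by blast
qed

text \<open>Modulo lattice points of the kernel, a lattice point with value in a bounded interval
  can be moved into a fixed ball. So the positive values have a least element, and division with
  remainder does the rest. Integrality of the kernel stands in for rationality of \<open>a\<close>;
  for a general real \<open>a\<close> the values could be dense.\<close>

lemma functional_values_cyclic:
  fixes U :: "(real ^ 'n) set"
  assumes U: "integral_subspace U m" and U0: "integral_subspace {x \<in> U. a \<bullet> x = 0} m'"
    and w: "w \<in> integer_points \<inter> U" "a \<bullet> w \<noteq> 0"
  shows "\<exists>g>0. (\<lambda>x. a \<bullet> x) ` (integer_points \<inter> U) = (\<lambda>z. g * z) ` \<int>"
proof -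
  define H where "H = (\<lambda>x. a \<bullet> x) ` (integer_points \<inter> U)"
  have subU: "subspace U" using U integral_subspace_imp_subspace by blast
  have Hd: "u - v \<in> H" if "u \<in> H" "v \<in> H" for u v
    using that subU unfolding H_def
    by (auto simp: inner_diff_right[symmetric] subspace_diff integer_points_diff intro!: imageI)
  have Hm: "z * v \<in> H" if "v \<in> H" "z \<in> \<int>" for z v
    using that subU unfolding H_def
    by (auto simp: inner_scaleR_right[symmetric] subspace_scale integer_points_scale
        simp del: inner_scaleR_right intro!: imageI)
  have "\<exists>w. w \<in> integer_points \<inter> U \<and> a \<bullet> w > 0"
  proof (cases "a \<bullet> w > 0")
    case False
    then show ?thesis
      using w subU by (intro exI[of _ "- w"]) (auto simp: integer_points_minus subspace_neg)
  qed (use w in auto)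
  then obtain w where w: "w \<in> integer_points \<inter> U" "a \<bullet> w > 0" by blast
  let ?S = "H \<inter> {0<..a \<bullet> w}"
  obtain R where R: "R \<ge> 0"
    "\<And>v. v \<in> {x \<in> U. a \<bullet> x = 0} \<Longrightarrow> \<exists>x \<in> {x \<in> U. a \<bullet> x = 0} \<inter> integer_points. norm (v - x) \<le> R"
    using integral_subspace_covering[OF U0] by blast
  have "?S \<subseteq> (\<lambda>x. a \<bullet> x) ` (integer_points \<inter> cball 0 (R + norm w))"
  proof
    fix v assume v: "v \<in> ?S"
    then obtain x where x: "x \<in> integer_points" "x \<in> U" "v = a \<bullet> x" by (auto simp: H_def)
    \<comment> \<open>Subtracting \<open>t *\<^sub>R w\<close> puts \<open>x\<close> into the
      kernel, where some lattice point \<open>y\<close> lies within \<open>R\<close>. Then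
      \<open>x - y\<close> keeps the value \<open>v\<close> and has norm at most
      \<open>R + norm w\<close>.\<close>
    define t where "t = v / (a \<bullet> w)"
    have t: "0 \<le> t" "t \<le> 1" using v by (auto simp: t_def)
    have "x - t *\<^sub>R w \<in> {x \<in> U. a \<bullet> x = 0}"
      using w x subU by (auto simp: subspace_diff subspace_scale inner_diff_right t_def)
    then obtain y where y: "y \<in> U" "a \<bullet> y = 0" "y \<in> integer_points" "norm (x - t *\<^sub>R w - y) \<le> R"
      using R(2) by blast
    have "norm (x - y) \<le> norm (x - t *\<^sub>R w - y) + norm (t *\<^sub>R w)"
      using norm_triangle_ineq[of "x - t *\<^sub>R w - y" "t *\<^sub>R w"] by (simp add: algebra_simps)
    also have "\<dots> \<le> R + norm w" using y(4) t by (intro add_mono) (auto simp: mult_left_le_one_le)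
    finally show "v \<in> (\<lambda>x. a \<bullet> x) ` (integer_points \<inter> cball 0 (R + norm w))"
      using x y by (intro image_eqI[of _ _ "x - y"]) (auto simp: inner_diff_right integer_points_diff)
  qed
  then have fin: "finite ?S"
    by (rule finite_subset) (intro finite_imageI finite_integer_points_bounded bounded_cball)
  have ne: "?S \<noteq> {}" using w by (auto simp: H_def)
  define g where "g = Min ?S"
  have gS: "g \<in> ?S" unfolding g_def using Min_in[OF fin ne] .
  have gmin: "g \<le> v" if "v \<in> H" "v > 0" for v
  proof (cases "v \<le> a \<bullet> w")
    case True
    then show ?thesis unfolding g_def using that fin by (intro Min_le) auto
  qed (use gS in auto)
  have "H = (\<lambda>z. g * z) ` \<int>"
  proof
    show "(\<lambda>z. g * z) ` \<int> \<subseteq> H" using Hm[of g] gS by (auto simp: mult.commute)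
    show "H \<subseteq> (\<lambda>z. g * z) ` \<int>"
    proof
      fix v assume v: "v \<in> H"
      define r where "r = v - of_int \<lfloor>v / g\<rfloor> * g"
      have "r \<in> H" unfolding r_def using v gS by (intro Hd Hm) auto
      moreover have "0 \<le> r" "r < g"
        using gS floor_divide_lower[of g v] floor_divide_upper[of g v]
        by (auto simp: r_def algebra_simps)
      ultimately have "r = 0" using gmin[of r] by linarith
      then show "v \<in> (\<lambda>z. g * z) ` \<int>"
        by (intro image_eqI[of _ _ "of_int \<lfloor>v / g\<rfloor>"]) (auto simp: r_def mult.commute)
    qed
  qed
  then show ?thesis using gS unfolding H_def by auto
qed

text \<open>The maps \<open>x \<mapsto> (1 + i T / s) x\<close>, followed by rounding to the lattice, carry the shell into
  about \<open>s / T\<close> disjoint shells with bounded multiplicity, so it has at most \<open>O(1 / s)\<close> of all points.\<close>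

lemma shell_count:
  fixes a :: "'i \<Rightarrow> real ^ 'n"
  assumes U: "integral_subspace U m" and J: "finite J" "\<And>g. g \<in> J \<Longrightarrow> h g > 0"
    and D: "\<And>s x. s \<ge> 0 \<Longrightarrow> x \<in> U \<Longrightarrow> (\<forall>g\<in>J. a g \<bullet> x \<le> s * h g) \<Longrightarrow> norm x \<le> D * s"
    and c: "c \<ge> 0"
    and N: "\<And>s. N s = real (card {x \<in> integer_points \<inter> U. \<forall>g\<in>J. a g \<bullet> x \<le> s * h g})"
  shows "\<exists>C\<ge>0. \<forall>s\<ge>1. s * (N (s + c) - N s) \<le> C * s ^ m"
proof -
  define K where "K = (\<lambda>s. {x \<in> integer_points \<inter> U. \<forall>g\<in>J. a g \<bullet> x \<le> s * h g})"
  have subU: "subspace U" using U integral_subspace_imp_subspace by blast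
  have Kmono: "K s \<subseteq> K t" if "s \<le> t" for s t
    unfolding K_def using J(2) that by (auto intro: order_trans mult_right_mono[OF _ less_imp_le])
  have Ksub: "K s \<subseteq> integer_points \<inter> U \<inter> cball 0 (D * s)" if "s \<ge> 0" for s
    unfolding K_def using D that by auto
  have Kfin: "finite (K s)" for s
  proof -
    have "K s \<subseteq> K (max s 0)" by (intro Kmono) auto
    also have "\<dots> \<subseteq> integer_points \<inter> (U \<inter> cball 0 (D * max s 0))" using Ksub[of "max s 0"] by auto
    finally show ?thesis
      by (rule finite_subset) (intro finite_integer_points_bounded bounded_Int disjI2 bounded_cball)
  qed
  have NK: "N s = real (card (K s))" for s by (simp add: N K_def)
  have Ndiff: "real (card (K t - K s)) = N t - N s" if "s \<le> t" for s t
    using Kmono[OF that] Kfin by (simp add: NK card_Diff_subset card_mono of_nat_diff)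
  obtain R where R: "R \<ge> 0" "\<And>v. v \<in> U \<Longrightarrow> \<exists>x \<in> U \<inter> integer_points. norm (v - x) \<le> R"
    using integral_subspace_covering[OF U] by blast
  obtain C0 where C0: "C0 > 0"
    "\<And>s. s \<ge> 1 \<Longrightarrow> real (card (integer_points \<inter> U \<inter> cball 0 s)) \<le> C0 * s ^ m"
    using integral_subspace_card_upper[OF U] by blast
  \<comment> \<open>Rounding by at most \<open>R\<close> changes \<open>a g \<bullet> x\<close> by
    no more than a change of \<open>s\<close> by \<open>R'\<close> changes the bound
    \<open>s * h g\<close>.\<close>
  define R' where "R' = (\<Sum>g\<in>J. norm (a g) * R / h g)"
  have R'0: "R' \<ge> 0" unfolding R'_def using R(1) J(2) by (intro sum_nonneg) (auto simp: less_imp_le)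
  have R': "\<bar>a g \<bullet> v\<bar> \<le> R' * h g" if "g \<in> J" "norm v \<le> R" for g v
  proof -
    have "norm (a g) * R / h g \<le> R'"
      unfolding R'_def using that(1) J R(1) by (intro member_le_sum) (auto simp: less_imp_le)
    then have "norm (a g) * R \<le> R' * h g" using J(2)[OF that(1)] by (simp add: field_simps)
    moreover have "\<bar>a g \<bullet> v\<bar> \<le> norm (a g) * R"
      using Cauchy_Schwarz_ineq2[of "a g" v] that(2) by (meson mult_left_mono norm_ge_zero order_trans)
    ultimately show ?thesis by linarith
  qed
  \<comment> \<open>Stretching by \<open>\<alpha> \<le> 2\<close> widens the shell to at most
    \<open>2 * c\<close>, and rounding blurs it by \<open>R'\<close> on either side. With step
    \<open>T\<close> the images for different \<open>i\<close> therefore fall into disjoint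
    shells.\<close>
  define T where "T = 2 * c + 2 * R' + 1"
  have T: "T \<ge> 1" using c R'0 by (simp add: T_def)
  \<comment> \<open>Bounds the fibres of the rounded dilation: since
    \<open>\<alpha> \<ge> 1\<close>, two points with the same image are at most \<open>2 * R\<close>
    apart.\<close>
  define M where "M = card (integer_points \<inter> cball (0::real^'n) (2 * R))"
  have shell: "N (s + c) - N s \<le> M * (N (s - R' + real (Suc i) * T) - N (s - R' + real i * T))"
    if s: "s \<ge> 1" and i: "real i * T \<le> s" for s i
  proof -
    define \<alpha> where "\<alpha> = 1 + real i * T / s"
    have \<alpha>1: "\<alpha> \<ge> 1" using s T by (simp add: \<alpha>_def)
    have \<alpha>s: "\<alpha> * s = s + real i * T" using s by (simp add: \<alpha>_def field_simps)
    have \<alpha>2: "\<alpha> \<le> 2" using s i by (simp add: \<alpha>_def)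
    have "\<exists>y. y \<in> U \<inter> integer_points \<and> norm (\<alpha> *\<^sub>R x - y) \<le> R" if "x \<in> U" for x
      using R(2)[of "\<alpha> *\<^sub>R x"] that subU by (auto simp: subspace_scale)
    then obtain \<phi> where \<phi>: "\<And>x. x \<in> U \<Longrightarrow> \<phi> x \<in> U \<inter> integer_points"
      "\<And>x. x \<in> U \<Longrightarrow> norm (\<alpha> *\<^sub>R x - \<phi> x) \<le> R"
      by metis
    define S where "S = K (s + c) - K s"
    define S' where "S' = K (s - R' + real (Suc i) * T) - K (s - R' + real i * T)"
    have "card S \<le> M * card S'"
    proof (rule card_le_fibers)
      show "finite S'" unfolding S'_def using Kfin by auto
      show "\<phi> ` S \<subseteq> S'"
      proof
        fix y assume "y \<in> \<phi> ` S"
        then obtain x where x: "x \<in> S" "y = \<phi> x" by blast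
        have xU: "x \<in> U" using x by (auto simp: S_def K_def)
        have split: "a g \<bullet> y = \<alpha> * (a g \<bullet> x) - a g \<bullet> (\<alpha> *\<^sub>R x - y)" for g
          by (simp add: inner_diff_right)
        have "a g \<bullet> y \<le> (s - R' + real (Suc i) * T) * h g" if g: "g \<in> J" for g
        proof -
          have "a g \<bullet> x \<le> (s + c) * h g" using x g by (auto simp: S_def K_def)
          then have "\<alpha> * (a g \<bullet> x) \<le> \<alpha> * ((s + c) * h g)" using \<alpha>1 by (intro mult_left_mono) auto
          also have "\<dots> = (\<alpha> * s + \<alpha> * c) * h g" by (simp add: algebra_simps)
          also have "\<dots> \<le> (s + real i * T + 2 * c) * h g"
            using J(2)[OF g] c \<alpha>2 unfolding \<alpha>s
            by (intro mult_right_mono add_mono order_refl) auto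
          finally have 1: "\<alpha> * (a g \<bullet> x) \<le> (s + real i * T + 2 * c) * h g" .
          have 2: "\<bar>a g \<bullet> (\<alpha> *\<^sub>R x - y)\<bar> \<le> R' * h g"
            using R'[OF g] \<phi>(2)[OF xU] x(2) by blast
          have "a g \<bullet> y \<le> (s + real i * T + 2 * c) * h g + R' * h g"
            unfolding split using 1 2 by linarith
          also have "\<dots> = (s + real i * T + 2 * c + R') * h g" by (simp add: algebra_simps)
          also have "\<dots> \<le> (s - R' + real (Suc i) * T) * h g"
            using J(2)[OF g] by (intro mult_right_mono) (auto simp: T_def algebra_simps)
          finally show ?thesis .
        qed
        moreover have "\<exists>g\<in>J. (s - R' + real i * T) * h g < a g \<bullet> y"
        proof -
          obtain g where g: "g \<in> J" "s * h g < a g \<bullet> x"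
            using x xU by (auto simp: S_def K_def not_le)
          have "\<alpha> * (s * h g) < \<alpha> * (a g \<bullet> x)" using g(2) \<alpha>1 by (intro mult_strict_left_mono) auto
          then have 1: "(s + real i * T) * h g < \<alpha> * (a g \<bullet> x)"
            by (simp only: mult.assoc[symmetric] \<alpha>s)
          have 2: "\<bar>a g \<bullet> (\<alpha> *\<^sub>R x - y)\<bar> \<le> R' * h g"
            using R'[OF g(1)] \<phi>(2)[OF xU] x(2) by blast
          have "(s + real i * T) * h g - R' * h g < a g \<bullet> y"
            unfolding split using 1 2 by linarith
          then show ?thesis using g(1) by (auto simp: algebra_simps)
        qed
        ultimately show "y \<in> S'"
          using \<phi>(1)[OF xU] x(2) by (auto simp: S'_def K_def not_le)
      qed
      fix t assume "t \<in> S'"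
      let ?X = "{x \<in> S. \<phi> x = t}"
      have XS: "?X \<subseteq> K (s + c)" by (auto simp: S_def)
      have finX: "finite ?X" using XS Kfin by (rule finite_subset)
      have "card ?X \<le> M"
      proof (cases "?X = {}")
        case False
        then obtain x0 where x0: "x0 \<in> S" "\<phi> x0 = t" by blast
        have "(\<lambda>x. x - x0) ` ?X \<subseteq> integer_points \<inter> cball 0 (2 * R)"
        proof
          fix y assume "y \<in> (\<lambda>x. x - x0) ` ?X"
          then obtain x where x: "x \<in> S" "\<phi> x = t" "y = x - x0" by blast
          have U2: "x \<in> U" "x0 \<in> U" using x x0 by (auto simp: S_def K_def)
          have "norm (x - x0) \<le> \<alpha> * norm (x - x0)" using \<alpha>1 by (simp add: mult_le_cancel_right1)
          also have "\<dots> = norm ((\<alpha> *\<^sub>R x - t) - (\<alpha> *\<^sub>R x0 - t))"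
            using \<alpha>1 by (simp flip: scaleR_diff_right)
          also have "\<dots> \<le> R + R"
            using \<phi>(2)[OF U2(1)] \<phi>(2)[OF U2(2)] x x0 by (intro order_trans[OF norm_triangle_ineq4]) auto
          finally show "y \<in> integer_points \<inter> cball 0 (2 * R)"
            using x x0 by (auto simp: S_def K_def integer_points_diff)
        qed
        then show ?thesis unfolding M_def
          by (intro card_inj_on_le[of "\<lambda>x. x - x0"] finite_integer_points_bounded) auto
      next
        case True
        then show ?thesis by (simp only: card.empty)
      qed
      then show "finite ?X \<and> card ?X \<le> M" using finX by blast
    qed
    then have "real (card S) \<le> real M * real (card S')"
      by (simp only: of_nat_mult[symmetric] of_nat_le_iff)
    moreover have "real (card S) = N (s + c) - N s"
      unfolding S_def using c by (intro Ndiff) auto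
    moreover have "real (card S') = N (s - R' + real (Suc i) * T) - N (s - R' + real i * T)"
      unfolding S'_def using T by (intro Ndiff) (auto simp: algebra_simps)
    ultimately show ?thesis by simp
  qed
  define E where "E = T * (M * (C0 * ((\<bar>D\<bar> + 1) * (2 + T)) ^ m))"
  have "s * (N (s + c) - N s) \<le> E * s ^ m" if s: "s \<ge> 1" for s
  proof -
    \<comment> \<open>Every \<open>i < I\<close> satisfies \<open>real i * T \<le> s\<close>, hence
      \<open>\<alpha> \<le> 2\<close>, and \<open>I\<close> is still at least
      \<open>s / T\<close>.\<close>
    define I where "I = nat \<lfloor>s / T\<rfloor> + 1"
    have I1: "s / T \<le> real I" unfolding I_def by linarith
    have I2: "real i * T \<le> s" if "i < I" for i
    proof -
      have "real i \<le> real (nat \<lfloor>s / T\<rfloor>)" using that unfolding I_def by simp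
      also have "\<dots> \<le> s / T" using s T by (intro of_nat_floor) simp
      finally have "real i \<le> s / T" .
      then show ?thesis using T by (simp add: field_simps)
    qed
    have I3: "real I * T \<le> s + T"
    proof -
      have "real I - 1 \<le> s / T" unfolding I_def using s T by simp
      then show ?thesis using T by (simp add: field_simps)
    qed
    have N0: "N t \<ge> 0" for t by (simp add: N)
    \<comment> \<open>The target shells are consecutive, so the sum telescopes; what remains is at
      most \<open>M\<close> times the count at \<open>(2 + T) * s\<close>, hence
      \<open>O(s^m)\<close>.\<close>
    have "real I * (N (s + c) - N s) = (\<Sum>i<I. N (s + c) - N s)" by simp
    also have "\<dots> \<le> (\<Sum>i<I. M * (N (s - R' + real (Suc i) * T) - N (s - R' + real i * T)))"
      using shell[OF s] I2 by (intro sum_mono) auto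
    also have "\<dots> = M * (N (s - R' + real I * T) - N (s - R' + real 0 * T))"
      using sum_lessThan_telescope[of "\<lambda>i. N (s - R' + real i * T)" I]
      by (simp only: sum_distrib_left[symmetric])
    also have "\<dots> \<le> M * N (s - R' + real I * T)"
      using N0 by (intro mult_left_mono) auto
    also have "\<dots> \<le> M * N ((2 + T) * s)"
    proof (intro mult_left_mono)
      have "T \<le> T * s" using s T by simp
      then have "s - R' + real I * T \<le> (2 + T) * s" using I3 R'0 s by (simp add: algebra_simps)
      then show "N (s - R' + real I * T) \<le> N ((2 + T) * s)"
        unfolding NK using Kmono Kfin by (simp add: card_mono)
    qed simp
    also have "\<dots> \<le> M * (C0 * (((\<bar>D\<bar> + 1) * (2 + T)) * s) ^ m)"
    proof (intro mult_left_mono)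
      let ?r = "((\<bar>D\<bar> + 1) * (2 + T)) * s"
      have "1 * 1 * 1 \<le> ?r" using s T by (intro mult_mono) auto
      then have r: "?r \<ge> 1" by simp
      have "K ((2 + T) * s) \<subseteq> integer_points \<inter> U \<inter> cball 0 (D * ((2 + T) * s))"
        using s T by (intro Ksub) auto
      also have "\<dots> \<subseteq> integer_points \<inter> U \<inter> cball 0 ?r"
      proof -
        have "D * ((2 + T) * s) \<le> (\<bar>D\<bar> + 1) * ((2 + T) * s)" using s T by (intro mult_right_mono) auto
        then show ?thesis by (auto simp: mult.assoc)
      qed
      finally have "card (K ((2 + T) * s)) \<le> card (integer_points \<inter> U \<inter> cball 0 ?r)"
        using finite_integer_points_bounded[of "U \<inter> cball 0 ?r"]
        by (intro card_mono) (auto simp: Int_assoc bounded_Int)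
      then show "N ((2 + T) * s) \<le> C0 * ?r ^ m"
        unfolding NK using C0(2)[OF r] by linarith
    qed simp
    finally have *: "real I * (N (s + c) - N s) \<le> M * (C0 * ((\<bar>D\<bar> + 1) * (2 + T)) ^ m * s ^ m)"
      by (simp add: power_mult_distrib mult_ac)
    have "s \<le> T * real I" using I1 T by (simp add: field_simps)
    moreover have "0 \<le> N (s + c) - N s" using c Ndiff[of s "s + c", symmetric] by simp
    ultimately have "s * (N (s + c) - N s) \<le> (T * real I) * (N (s + c) - N s)"
      by (rule mult_right_mono)
    also have "\<dots> \<le> T * (M * (C0 * ((\<bar>D\<bar> + 1) * (2 + T)) ^ m * s ^ m))"
      using * T unfolding mult.assoc[of T] by (intro mult_left_mono) auto
    finally show ?thesis unfolding E_def by (simp add: mult_ac)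
  qed
  moreover have "E \<ge> 0" unfolding E_def using T C0(1) by (simp add: less_imp_le)
  ultimately show ?thesis by blast
qed

section \<open>Counting under perturbation of the right-hand sides\<close>

text \<open>The point \<open>f0\<close> is relatively interior to the polytope and
  \<open>f i\<close> to its facet \<open>i\<close>; used as centres, they turn boundedness and
  containment of balls into estimates that scale. Rationality is carried by \<open>V\<close> and
  \<open>V_facet\<close>. The normalisation \<open>vals\<close> lets lattice points see only the
  integer part of a right-hand side.\<close>

locale lattice_facets =
  fixes V :: "(real ^ 'n) set" and I :: "'i set" and a :: "'i \<Rightarrow> real ^ 'n"
    and b :: "'i \<Rightarrow> real" and f0 :: "real ^ 'n" and f :: "'i \<Rightarrow> real ^ 'n" and d :: nat
  assumes finI: "finite I"
    and d_pos: "d \<ge> 1"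
    and V: "integral_subspace V d"
    and V_facet: "\<And>i. i \<in> I \<Longrightarrow> integral_subspace {v \<in> V. a i \<bullet> v = 0} (d - 1)"
    and bdd: "bounded {x. x - f0 \<in> V \<and> (\<forall>i\<in>I. a i \<bullet> x \<le> b i)}"
    and f0: "\<And>i. i \<in> I \<Longrightarrow> a i \<bullet> f0 < b i"
    and f_mem: "\<And>i. i \<in> I \<Longrightarrow> f i - f0 \<in> V"
    and f_eq: "\<And>i. i \<in> I \<Longrightarrow> a i \<bullet> f i = b i"
    and f_less: "\<And>i g. i \<in> I \<Longrightarrow> g \<in> I \<Longrightarrow> g \<noteq> i \<Longrightarrow> a g \<bullet> f i < b g"
    and vals: "\<And>i. i \<in> I \<Longrightarrow> (\<lambda>x. a i \<bullet> x) ` (integer_points \<inter> V) = \<int>"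
begin

definition body where "body = {x. x - f0 \<in> V \<and> (\<forall>i\<in>I. a i \<bullet> x \<le> b i)}"

text \<open>The right-hand sides are arbitrary and not only multiples of \<open>b\<close>, so that
  they can be rounded and then raised one at a time.\<close>

definition cnt :: "('i \<Rightarrow> real) \<Rightarrow> real" where
  "cnt n = real (card {y \<in> integer_points \<inter> V. \<forall>i\<in>I. a i \<bullet> y \<le> n i})"

text \<open>The points counted by \<open>W i s\<close> are those of \<open>s\<close> times facet \<open>i\<close>, translated by \<open>- s f i\<close>.\<close>

definition W :: "'i \<Rightarrow> real \<Rightarrow> real" where
  "W i s = real (card {y \<in> integer_points \<inter> {v \<in> V. a i \<bullet> v = 0}.
     \<forall>g\<in>I - {i}. a g \<bullet> y \<le> s * (b g - a g \<bullet> f i)})"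

text \<open>\<open>adm s x\<close> says that \<open>x\<close> lies in \<open>s\<close> times the affine hull of the polytope; \<open>\<theta> s x\<close> gives the
  right-hand sides of \<open>s\<close> times the polytope after translation by \<open>- x\<close>.\<close>

definition adm :: "real \<Rightarrow> real ^ 'n \<Rightarrow> bool" where
  "adm s x \<longleftrightarrow> s *\<^sub>R f0 - x \<in> V"

definition \<theta> :: "real \<Rightarrow> real ^ 'n \<Rightarrow> 'i \<Rightarrow> real" where
  "\<theta> s x i = s * b i - a i \<bullet> x"

section \<open>Size of scaled bodies and growth of the facet counts\<close>

lemma subV: "subspace V"
  using V integral_subspace_imp_subspace by blast

lemma vals_Ints: "i \<in> I \<Longrightarrow> y \<in> integer_points \<Longrightarrow> y \<in> V \<Longrightarrow> a i \<bullet> y \<in> \<int>"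
  using vals[of i] by blast

lemma unit_vector:
  assumes "i \<in> I"
  obtains u where "u \<in> integer_points" "u \<in> V" "a i \<bullet> u = 1"
proof -
  have "1 \<in> (\<lambda>x. a i \<bullet> x) ` (integer_points \<inter> V)" using vals[OF assms] by simp
  then obtain u where "1 = a i \<bullet> u" "u \<in> integer_points \<inter> V" by (rule imageE)
  then show thesis using that[of u] by simp
qed

text \<open>The point \<open>c + (1 / s) *\<^sub>R x\<close> lies in the bounded polytope. The
  centre \<open>c\<close> stays variable: it is \<open>f0\<close> for the whole polytope and
  \<open>f i\<close> for a facet.\<close>

lemma scaled_bound:
  "\<exists>D. D > 0 \<and> (\<forall>s x c. s > 0 \<longrightarrow> x \<in> V \<longrightarrow> c - f0 \<in> V \<longrightarrow>
       (\<forall>i\<in>I. a i \<bullet> x \<le> s * (b i - a i \<bullet> c)) \<longrightarrow> norm x \<le> (D + norm c) * s)"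
proof -
  obtain D where D: "D > 0" "\<And>x. x - f0 \<in> V \<Longrightarrow> (\<forall>i\<in>I. a i \<bullet> x \<le> b i) \<Longrightarrow> norm x \<le> D"
    using bdd unfolding bounded_pos by blast
  have "norm x \<le> (D + norm c) * s"
    if s: "s > 0" and x: "x \<in> V" "c - f0 \<in> V" "\<forall>i\<in>I. a i \<bullet> x \<le> s * (b i - a i \<bullet> c)" for s x c
  proof -
    let ?y = "c + (1 / s) *\<^sub>R x"
    have "(c - f0) + (1 / s) *\<^sub>R x \<in> V" using x subV by (simp add: subspace_add subspace_scale)
    then have "?y - f0 \<in> V" by (simp add: algebra_simps)
    moreover have "\<forall>i\<in>I. a i \<bullet> ?y \<le> b i"
      using x(3) s by (auto simp: inner_add_right field_simps)
    ultimately have "norm ?y \<le> D" using D(2) by blast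
    have "norm ((1 / s) *\<^sub>R x) \<le> norm ?y + norm c"
      using norm_triangle_ineq4[of ?y c] by simp
    then have "norm x / s \<le> D + norm c" using \<open>norm ?y \<le> D\<close> s by simp
    then show ?thesis using s by (simp add: field_simps)
  qed
  then show ?thesis using D(1) by (intro exI[of _ D]) auto
qed

lemma finite_cnt: "finite {y \<in> integer_points \<inter> V. \<forall>i\<in>I. a i \<bullet> y \<le> n i}"
proof -
  obtain D where D0: "D > 0 \<and> (\<forall>s x c. s > 0 \<longrightarrow> x \<in> V \<longrightarrow> c - f0 \<in> V \<longrightarrow>
       (\<forall>i\<in>I. a i \<bullet> x \<le> s * (b i - a i \<bullet> c)) \<longrightarrow> norm x \<le> (D + norm c) * s)"
    using scaled_bound ..
  note D = D0[THEN conjunct1] D0[THEN conjunct2, rule_format]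
  \<comment> \<open>Scaling about \<open>f0\<close> by this factor leaves room for all the
    prescribed right-hand sides; the summand 1 makes it positive.\<close>
  define s where "s = 1 + (\<Sum>i\<in>I. \<bar>n i\<bar> / (b i - a i \<bullet> f0))"
  have s: "s > 0" unfolding s_def using f0 by (intro add_pos_nonneg sum_nonneg) (auto simp: less_imp_le)
  have n: "n i \<le> s * (b i - a i \<bullet> f0)" if "i \<in> I" for i
  proof -
    have "\<bar>n i\<bar> / (b i - a i \<bullet> f0) \<le> (\<Sum>i\<in>I. \<bar>n i\<bar> / (b i - a i \<bullet> f0))"
      using that finI f0 by (intro member_le_sum) (auto simp: less_imp_le)
    then have "\<bar>n i\<bar> / (b i - a i \<bullet> f0) \<le> s" unfolding s_def by linarith
    then show ?thesis using f0[OF that] by (simp add: field_simps)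
  qed
  have "{y \<in> integer_points \<inter> V. \<forall>i\<in>I. a i \<bullet> y \<le> n i}
      \<subseteq> integer_points \<inter> cball 0 ((D + norm f0) * s)"
  proof
    fix y assume y: "y \<in> {y \<in> integer_points \<inter> V. \<forall>i\<in>I. a i \<bullet> y \<le> n i}"
    then have "a i \<bullet> y \<le> s * (b i - a i \<bullet> f0)" if "i \<in> I" for i
      using n[OF that] that by (auto intro: order_trans)
    then have "norm y \<le> (D + norm f0) * s"
      using y s subspace_0[OF subV] by (intro D(2)) auto
    then show "y \<in> integer_points \<inter> cball 0 ((D + norm f0) * s)" using y by simp
  qed
  then show ?thesis
    by (rule finite_subset) (intro finite_integer_points_bounded bounded_cball)
qed

lemma facet_bound:
  assumes i: "i \<in> I"
  shows "\<exists>D. \<forall>s x. s \<ge> 0 \<longrightarrow> x \<in> {v \<in> V. a i \<bullet> v = 0} \<longrightarrow>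
    (\<forall>g\<in>I - {i}. a g \<bullet> x \<le> s * (b g - a g \<bullet> f i)) \<longrightarrow> norm x \<le> D * s"
proof -
  obtain D where D0: "D > 0 \<and> (\<forall>s x c. s > 0 \<longrightarrow> x \<in> V \<longrightarrow> c - f0 \<in> V \<longrightarrow>
       (\<forall>i\<in>I. a i \<bullet> x \<le> s * (b i - a i \<bullet> c)) \<longrightarrow> norm x \<le> (D + norm c) * s)"
    using scaled_bound ..
  note D = D0[THEN conjunct1] D0[THEN conjunct2, rule_format]
  define D' where "D' = D + norm (f i)"
  have D': "D' > 0" using D(1) by (simp add: D'_def add_pos_nonneg)
  have "norm x \<le> D' * s"
    if s: "s \<ge> 0" and x: "x \<in> {v \<in> V. a i \<bullet> v = 0}" "\<forall>g\<in>I - {i}. a g \<bullet> x \<le> s * (b g - a g \<bullet> f i)" for s x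
  \<comment> \<open>The value \<open>s = 0\<close> is allowed here but not in
    \<open>scaled_bound\<close>, so \<open>s\<close> is enlarged to \<open>s + e / D'\<close> and
    \<open>e\<close> tends to 0.\<close>
  proof (rule field_le_epsilon)
    fix e :: real assume e: "e > 0"
    have "a g \<bullet> x \<le> (s + e / D') * (b g - a g \<bullet> f i)" if "g \<in> I" for g
    proof (cases "g = i")
      case False
      have "a g \<bullet> x \<le> s * (b g - a g \<bullet> f i)" using x that False by blast
      also have "\<dots> \<le> (s + e / D') * (b g - a g \<bullet> f i)"
        using f_less[OF i that False] e D' by (intro mult_right_mono) auto
      finally show ?thesis .
    qed (use x f_eq i in simp)
    then have "norm x \<le> D' * (s + e / D')"
      unfolding D'_def using x s e D' i by (intro D(2) f_mem) (auto simp: D'_def intro: add_nonneg_pos)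
    also have "\<dots> = D' * s + e" using D' by (simp add: field_simps)
    finally show "norm x \<le> D' * s + e" .
  qed
  then show ?thesis by blast
qed

lemma finite_W: "i \<in> I \<Longrightarrow> finite {y \<in> integer_points \<inter> {v \<in> V. a i \<bullet> v = 0}.
     \<forall>g\<in>I - {i}. a g \<bullet> y \<le> s * (b g - a g \<bullet> f i)}"
  by (rule finite_subset[OF _ finite_cnt[of "\<lambda>g. if g = i then 0 else s * (b g - a g \<bullet> f i)"]]) auto

lemma W_mono:
  assumes "i \<in> I" "s \<le> t"
  shows "W i s \<le> W i t"
proof -
  have "s * (b g - a g \<bullet> f i) \<le> t * (b g - a g \<bullet> f i)" if "g \<in> I - {i}" for g
    using f_less[of i g] assms that by (intro mult_right_mono) auto
  then show ?thesis
    unfolding W_def using finite_W[OF assms(1)] by (intro of_nat_mono card_mono) (auto intro: order_trans)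
qed

lemma W_nonneg: "W i s \<ge> 0"
  by (simp add: W_def)

text \<open>This is \<open>shell_count\<close> in the direction space of the facet. The factor
  \<open>s\<close> stands on the left because an exponent \<open>d - 2\<close> on the right would be
  truncated for \<open>d = 1\<close>.\<close>

lemma W_shell:
  assumes "i \<in> I" "c \<ge> 0"
  shows "\<exists>C\<ge>0. \<forall>s\<ge>1. s * (W i (s + c) - W i s) \<le> C * s ^ (d - 1)"
proof -
  obtain D where D0: "\<forall>s x. s \<ge> 0 \<longrightarrow> x \<in> {v \<in> V. a i \<bullet> v = 0} \<longrightarrow>
    (\<forall>g\<in>I - {i}. a g \<bullet> x \<le> s * (b g - a g \<bullet> f i)) \<longrightarrow> norm x \<le> D * s"
    using facet_bound[OF assms(1)] ..
  note D = D0[rule_format]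
  show ?thesis
    by (rule shell_count[OF V_facet[OF assms(1)], of "I - {i}" "\<lambda>g. b g - a g \<bullet> f i" a D])
      (use finI f_less assms D in \<open>auto simp: W_def\<close>)
qed

lemma W_upper:
  assumes "i \<in> I"
  shows "\<exists>C\<ge>0. \<forall>s\<ge>1. W i s \<le> C * s ^ (d - 1)"
proof -
  obtain D where D0: "\<forall>s x. s \<ge> 0 \<longrightarrow> x \<in> {v \<in> V. a i \<bullet> v = 0} \<longrightarrow>
    (\<forall>g\<in>I - {i}. a g \<bullet> x \<le> s * (b g - a g \<bullet> f i)) \<longrightarrow> norm x \<le> D * s"
    using facet_bound[OF assms(1)] ..
  note D = D0[rule_format]
  obtain C where C: "C > 0" "\<And>s. s \<ge> 1 \<Longrightarrow>
      real (card (integer_points \<inter> {v \<in> V. a i \<bullet> v = 0} \<inter> cball 0 s)) \<le> C * s ^ (d - 1)"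
    by (rule integral_subspace_card_upper[OF V_facet[OF assms(1)]]) blast
  have "W i s \<le> C * (\<bar>D\<bar> + 1) ^ (d - 1) * s ^ (d - 1)" if s: "s \<ge> 1" for s
  proof -
    let ?r = "(\<bar>D\<bar> + 1) * s"
    have "1 * 1 \<le> ?r" using s by (intro mult_mono) auto
    then have r: "?r \<ge> 1" by simp
    have le: "D * s \<le> ?r" using s by (intro mult_right_mono) auto
    have "W i s \<le> real (card (integer_points \<inter> {v \<in> V. a i \<bullet> v = 0} \<inter> cball 0 ?r))"
      unfolding W_def
    proof (intro of_nat_mono card_mono)
      show "finite (integer_points \<inter> {v \<in> V. a i \<bullet> v = 0} \<inter> cball 0 ?r)"
        unfolding Int_assoc by (intro finite_integer_points_bounded bounded_Int disjI2 bounded_cball)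
      show "{y \<in> integer_points \<inter> {v \<in> V. a i \<bullet> v = 0}.
          \<forall>g\<in>I - {i}. a g \<bullet> y \<le> s * (b g - a g \<bullet> f i)}
          \<subseteq> integer_points \<inter> {v \<in> V. a i \<bullet> v = 0} \<inter> cball 0 ?r"
      proof
        fix y assume y: "y \<in> {y \<in> integer_points \<inter> {v \<in> V. a i \<bullet> v = 0}.
          \<forall>g\<in>I - {i}. a g \<bullet> y \<le> s * (b g - a g \<bullet> f i)}"
        have "norm y \<le> D * s" using y s by (intro D) auto
        then have "norm y \<le> ?r" using le by linarith
        then show "y \<in> integer_points \<inter> {v \<in> V. a i \<bullet> v = 0} \<inter> cball 0 ?r" using y by simp
      qed
    qed
    also have "\<dots> \<le> C * ?r ^ (d - 1)" using C(2)[OF r] .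
    finally show ?thesis by (simp add: power_mult_distrib mult_ac)
  qed
  then show ?thesis using C(1) by (intro exI[of _ "C * (\<bar>D\<bar> + 1) ^ (d - 1)"]) auto
qed

text \<open>Seen from its centre \<open>f i\<close>, the scaled facet contains all directions of
  norm at most \<open>s / R\<close>, and these include enough lattice points.\<close>

lemma W_lower:
  assumes "i \<in> I"
  shows "\<exists>c>0. \<forall>s\<ge>0. c * s ^ (d - 1) \<le> W i s"
proof -
  obtain c where c: "c > 0" "\<And>s. s \<ge> 0 \<Longrightarrow> c * s ^ (d - 1)
      \<le> real (card (integer_points \<inter> {v \<in> V. a i \<bullet> v = 0} \<inter> cball 0 s))"
    by (rule integral_subspace_card_lower[OF V_facet[OF assms(1)]]) blast
  define h where "h = (\<lambda>g. b g - a g \<bullet> f i)"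
  have h: "h g > 0" if "g \<in> I - {i}" for g using f_less[of i g] assms that by (auto simp: h_def)
  define R where "R = 1 + (\<Sum>g\<in>I - {i}. norm (a g) / h g)"
  have R: "R > 0" unfolding R_def using h by (intro add_pos_nonneg sum_nonneg) (auto simp: less_imp_le)
  have aR: "norm (a g) \<le> R * h g" if g: "g \<in> I - {i}" for g
  proof -
    have "norm (a g) / h g \<le> (\<Sum>g\<in>I - {i}. norm (a g) / h g)"
      using g finI h by (intro member_le_sum) (auto simp: less_imp_le)
    then have "norm (a g) / h g \<le> R" unfolding R_def by linarith
    then show ?thesis using h[OF g] by (simp add: field_simps)
  qed
  have "c * (1 / R) ^ (d - 1) * s ^ (d - 1) \<le> W i s" if s: "s \<ge> 0" for s
  proof -
    have "c * (1 / R) ^ (d - 1) * s ^ (d - 1) = c * (s / R) ^ (d - 1)" by (simp add: power_divide)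
    also have "\<dots> \<le> real (card (integer_points \<inter> {v \<in> V. a i \<bullet> v = 0} \<inter> cball 0 (s / R)))"
      using s R by (intro c(2)) auto
    also have "\<dots> \<le> W i s"
      unfolding W_def
    proof (intro of_nat_mono card_mono finite_W assms)
      have *: "a g \<bullet> y \<le> s * h g" if "g \<in> I - {i}" "norm y \<le> s / R" for g y
      proof -
        have "a g \<bullet> y \<le> norm (a g) * norm y" by (rule norm_cauchy_schwarz)
        also have "\<dots> \<le> (R * h g) * (s / R)" using aR that R h by (intro mult_mono) (auto simp: less_imp_le)
        finally show ?thesis using R by (simp add: field_simps)
      qed
      show "integer_points \<inter> {v \<in> V. a i \<bullet> v = 0} \<inter> cball 0 (s / R)
          \<subseteq> {y \<in> integer_points \<inter> {v \<in> V. a i \<bullet> v = 0}.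
          \<forall>g\<in>I - {i}. a g \<bullet> y \<le> s * (b g - a g \<bullet> f i)}"
        by (intro subsetI CollectI conjI ballI *[unfolded h_def]) auto
    qed
    finally show ?thesis .
  qed
  then show ?thesis using c(1) R by (intro exI[of _ "c * (1 / R) ^ (d - 1)"]) auto
qed

section \<open>Effect of changing the right-hand sides\<close>

text \<open>A lattice translation carries the slice at height \<open>j\<close> into the lattice of
  the facet directions. The remaining constraints then differ from those of \<open>W i s\<close> by
  a bounded amount, which a change of \<open>s\<close> by \<open>C'\<close> absorbs uniformly in
  \<open>s\<close>, \<open>x\<close>, \<open>n\<close> and \<open>j\<close>.\<close>

lemma slice_count:
  assumes i: "i \<in> I" and C: "C \<ge> 0"
  shows "\<exists>C'\<ge>0. \<forall>s x n j. adm s x \<longrightarrow> j \<in> \<int> \<longrightarrow> \<bar>j - \<theta> s x i\<bar> \<le> C \<longrightarrow>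
      (\<forall>g\<in>I - {i}. \<bar>n g - \<theta> s x g\<bar> \<le> C) \<longrightarrow>
      W i (s - C') \<le> real (card {y \<in> integer_points \<inter> V. a i \<bullet> y = j \<and> (\<forall>g\<in>I - {i}. a g \<bullet> y \<le> n g)}) \<and>
      real (card {y \<in> integer_points \<inter> V. a i \<bullet> y = j \<and> (\<forall>g\<in>I - {i}. a g \<bullet> y \<le> n g)}) \<le> W i (s + C')"
proof -
  obtain u where u: "u \<in> integer_points" "u \<in> V" "a i \<bullet> u = 1" using unit_vector[OF i] .
  obtain R where R: "R \<ge> 0" "\<And>v. v \<in> {v \<in> V. a i \<bullet> v = 0} \<Longrightarrow>
      \<exists>x \<in> {v \<in> V. a i \<bullet> v = 0} \<inter> integer_points. norm (v - x) \<le> R"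
    by (rule integral_subspace_covering[OF V_facet[OF i]]) blast
  define E where "E = R + C * norm u"
  have E: "E \<ge> 0" using R(1) C by (simp add: E_def)
  define h where "h = (\<lambda>g. b g - a g \<bullet> f i)"
  have h: "h g > 0" if "g \<in> I - {i}" for g using f_less[of i g] i that by (auto simp: h_def)
  \<comment> \<open>Chosen so that \<open>C' * h g\<close> covers the deviation \<open>C\<close> of
    the right-hand side plus the effect of misplacing the centre by \<open>E\<close>.\<close>
  define C' where "C' = (\<Sum>g\<in>I - {i}. (C + norm (a g) * E) / h g)"
  have C'0: "C' \<ge> 0" unfolding C'_def using h C E by (intro sum_nonneg) (auto simp: less_imp_le)
  have C'h: "C + norm (a g) * E \<le> C' * h g" if g: "g \<in> I - {i}" for g
  proof -
    have "(C + norm (a g) * E) / h g \<le> C'"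
      unfolding C'_def using g finI h C E by (intro member_le_sum) (auto simp: less_imp_le)
    then show ?thesis using h[OF g] by (simp add: field_simps)
  qed
  have main: "W i (s - C') \<le> real (card {y \<in> integer_points \<inter> V. a i \<bullet> y = j \<and> (\<forall>g\<in>I - {i}. a g \<bullet> y \<le> n g)}) \<and>
      real (card {y \<in> integer_points \<inter> V. a i \<bullet> y = j \<and> (\<forall>g\<in>I - {i}. a g \<bullet> y \<le> n g)}) \<le> W i (s + C')"
    if adm: "adm s x" and j: "j \<in> \<int>" "\<bar>j - \<theta> s x i\<bar> \<le> C"
      and n: "\<forall>g\<in>I - {i}. \<bar>n g - \<theta> s x g\<bar> \<le> C" for s x n j
  proof -
    let ?S = "{y \<in> integer_points \<inter> V. a i \<bullet> y = j \<and> (\<forall>g\<in>I - {i}. a g \<bullet> y \<le> n g)}"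
    let ?K = "\<lambda>t. {y \<in> integer_points \<inter> {v \<in> V. a i \<bullet> v = 0}. \<forall>g\<in>I - {i}. a g \<bullet> y \<le> t * h g}"
    have finS: "finite ?S"
      by (rule finite_subset[OF _ finite_cnt[of "n(i := j)"]]) auto
    \<comment> \<open>The facet centre \<open>s *\<^sub>R f i\<close> after translation by
      \<open>- x\<close>: its height under \<open>a i\<close> is \<open>\<theta> s x i\<close>, and
      its slack in constraint \<open>g\<close> is \<open>s * h g\<close>.\<close>
    define z where "z = s *\<^sub>R f i - x"
    have "z = (s *\<^sub>R f0 - x) + s *\<^sub>R (f i - f0)" by (simp add: z_def algebra_simps)
    then have zV: "z \<in> V" using adm f_mem[OF i] subV by (simp add: adm_def subspace_add subspace_scale)
    have azi: "a i \<bullet> z = \<theta> s x i" using f_eq[OF i] by (simp add: z_def \<theta>_def inner_diff_right)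
    have azg: "a g \<bullet> z = \<theta> s x g - s * h g" for g
      by (simp add: z_def \<theta>_def h_def algebra_simps)
    have "z - (a i \<bullet> z) *\<^sub>R u \<in> {v \<in> V. a i \<bullet> v = 0}"
      using zV u subV by (auto simp: subspace_diff subspace_scale inner_diff_right)
    then obtain l where l: "l \<in> V" "a i \<bullet> l = 0" "l \<in> integer_points"
      "norm (z - (a i \<bullet> z) *\<^sub>R u - l) \<le> R"
      using R(2) by blast
    \<comment> \<open>A lattice point exactly at height \<open>j\<close> and within \<open>E\<close>
      of \<open>z\<close>; translating by it compares the slice with the facet lattice.\<close>
    define y0 where "y0 = l + j *\<^sub>R u"
    have y0: "y0 \<in> integer_points" "y0 \<in> V" "a i \<bullet> y0 = j"
      using l u j(1) subV
      by (auto simp: y0_def integer_points_add integer_points_scale subspace_add subspace_scale inner_add_right)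
    have "y0 - z = (j - a i \<bullet> z) *\<^sub>R u - (z - (a i \<bullet> z) *\<^sub>R u - l)"
      by (simp add: y0_def algebra_simps)
    then have "norm (y0 - z) \<le> norm ((j - a i \<bullet> z) *\<^sub>R u) + norm (z - (a i \<bullet> z) *\<^sub>R u - l)"
      by (simp only: norm_triangle_ineq4)
    also have "\<dots> \<le> C * norm u + R"
      using l(4) j(2) by (intro add_mono) (auto simp: azi intro: mult_right_mono)
    finally have y0z: "norm (y0 - z) \<le> E" by (simp add: E_def)
    have ay0: "\<bar>a g \<bullet> y0 - a g \<bullet> z\<bar> \<le> norm (a g) * E" for g
    proof -
      have "\<bar>a g \<bullet> (y0 - z)\<bar> \<le> norm (a g) * norm (y0 - z)" by (rule Cauchy_Schwarz_ineq2)
      also have "\<dots> \<le> norm (a g) * E" using y0z by (intro mult_left_mono) auto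
      finally show ?thesis by (simp add: inner_diff_right)
    qed
    have 1: "a g \<bullet> (y - y0) \<le> (s + C') * h g" if "y \<in> ?S" "g \<in> I - {i}" for y g
    proof -
      have "a g \<bullet> y \<le> n g" using that by blast
      moreover have "n g \<le> \<theta> s x g + C" using n that(2) by (smt (verit))
      ultimately have "a g \<bullet> (y - y0) \<le> \<theta> s x g + C - a g \<bullet> z + norm (a g) * E"
        using ay0[of g] unfolding inner_diff_right by linarith
      also have "\<dots> \<le> (s + C') * h g" using C'h[OF that(2)] by (simp add: azg algebra_simps)
      finally show ?thesis .
    qed
    have 2: "a g \<bullet> (y0 + y) \<le> n g" if "y \<in> ?K (s - C')" "g \<in> I - {i}" for y g
    proof -
      have "a g \<bullet> y \<le> (s - C') * h g" using that by blast
      moreover have "\<theta> s x g - C \<le> n g" using n that(2) by (smt (verit))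
      ultimately show ?thesis
        using ay0[of g] C'h[OF that(2)] unfolding inner_add_right azg by (simp add: algebra_simps)
    qed
    have "card ?S \<le> card (?K (s + C'))"
    proof (rule card_inj_on_le[of "\<lambda>y. y - y0"])
      show "(\<lambda>y. y - y0) ` ?S \<subseteq> ?K (s + C')"
      proof
        fix y' assume "y' \<in> (\<lambda>y. y - y0) ` ?S"
        then obtain y where y: "y \<in> ?S" "y' = y - y0" by blast
        show "y' \<in> ?K (s + C')"
          unfolding y(2) using y(1) y0 subV
          by (intro CollectI conjI ballI 1 y(1)) (auto simp: integer_points_diff subspace_diff inner_diff_right)
      qed
      show "finite (?K (s + C'))" using finite_W[OF i] by (simp add: h_def)
    qed auto
    moreover have "card (?K (s - C')) \<le> card ?S"
    proof (rule card_inj_on_le[of "\<lambda>y. y0 + y"])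
      show "(\<lambda>y. y0 + y) ` ?K (s - C') \<subseteq> ?S"
      proof
        fix y' assume "y' \<in> (\<lambda>y. y0 + y) ` ?K (s - C')"
        then obtain y where y: "y \<in> ?K (s - C')" "y' = y0 + y" by blast
        show "y' \<in> ?S"
          unfolding y(2) using y(1) y0 subV
          by (intro CollectI conjI ballI 2 y(1)) (auto simp: integer_points_add subspace_add inner_add_right)
      qed
    qed (use finS in auto)
    ultimately show ?thesis by (auto simp: W_def h_def)
  qed
  then show ?thesis using C'0 by blast
qed

text \<open>Lattice values of \<open>a i\<close> are integers, so nothing lies strictly between the
  heights \<open>j - 1\<close> and \<open>j\<close>.\<close>

lemma cnt_slice:
  assumes "i \<in> I" "j \<in> \<int>"
  shows "cnt (n(i := j)) - cnt (n(i := j - 1))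
    = real (card {y \<in> integer_points \<inter> V. a i \<bullet> y = j \<and> (\<forall>g\<in>I - {i}. a g \<bullet> y \<le> n g)})"
proof -
  let ?X = "\<lambda>j. {y \<in> integer_points \<inter> V. \<forall>g\<in>I. a g \<bullet> y \<le> (n(i := j)) g}"
  let ?S = "{y \<in> integer_points \<inter> V. a i \<bullet> y = j \<and> (\<forall>g\<in>I - {i}. a g \<bullet> y \<le> n g)}"
  have sub: "?X (j - 1) \<subseteq> ?X j"
    by (auto split: if_splits)
  have S: "?S = ?X j - ?X (j - 1)"
  proof -
    have "(a i \<bullet> y = j) \<longleftrightarrow> (a i \<bullet> y \<le> j \<and> \<not> a i \<bullet> y \<le> j - 1)" if y: "y \<in> integer_points" "y \<in> V" for y
    proof -
      obtain p q :: int where "a i \<bullet> y = of_int p" "j = of_int q"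
        using vals_Ints[OF assms(1) y] assms(2) by (auto elim!: Ints_cases)
      then show ?thesis by auto
    qed
    then show ?thesis using assms(1) by (auto split: if_splits)
  qed
  have "card ?S = card (?X j) - card (?X (j - 1))"
    unfolding S using sub finite_cnt by (intro card_Diff_subset) auto
  moreover have "card (?X (j - 1)) \<le> card (?X j)" using sub finite_cnt by (intro card_mono) auto
  ultimately show ?thesis unfolding cnt_def by (simp add: of_nat_diff)
qed

text \<open>Both the slice and \<open>W i s\<close> are squeezed between \<open>W i (s - C1)\<close>
  and \<open>W i (s + C1)\<close>, and \<open>W_shell\<close> bounds the gap.\<close>

lemma cnt_step:
  assumes i: "i \<in> I" and C: "C \<ge> 0"
  shows "\<exists>C'\<ge>0. \<forall>s\<ge>1. \<forall>x n j. adm s x \<longrightarrow> j \<in> \<int> \<longrightarrow> \<bar>j - \<theta> s x i\<bar> \<le> C \<longrightarrow>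
      (\<forall>g\<in>I - {i}. \<bar>n g - \<theta> s x g\<bar> \<le> C) \<longrightarrow>
      s * \<bar>cnt (n(i := j)) - cnt (n(i := j - 1)) - W i s\<bar> \<le> C' * s ^ (d - 1)"
proof -
  obtain C1 where C1: "C1 \<ge> 0" "\<And>s x n j. adm s x \<Longrightarrow> j \<in> \<int> \<Longrightarrow> \<bar>j - \<theta> s x i\<bar> \<le> C \<Longrightarrow>
      (\<forall>g\<in>I - {i}. \<bar>n g - \<theta> s x g\<bar> \<le> C) \<Longrightarrow>
      W i (s - C1) \<le> cnt (n(i := j)) - cnt (n(i := j - 1)) \<and>
      cnt (n(i := j)) - cnt (n(i := j - 1)) \<le> W i (s + C1)"
    using slice_count[OF i C] by (simp add: cnt_slice[OF i]) blast
  obtain C2 where C2: "C2 \<ge> 0" "\<And>s. s \<ge> 1 \<Longrightarrow> s * (W i (s + 2 * C1) - W i s) \<le> C2 * s ^ (d - 1)"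
    using W_shell[OF i, of "2 * C1"] C1(1) by auto
  \<comment> \<open>Bounds the error outright for \<open>s < 2 * C1 + 2\<close>, where the shell
    estimate may not apply at \<open>s - C1\<close>.\<close>
  define C3 where "C3 = (2 * C1 + 2) * W i (3 * C1 + 2)"
  have C3: "C3 \<ge> 0" using C1(1) W_nonneg by (simp add: C3_def)
  have "s * \<bar>cnt (n(i := j)) - cnt (n(i := j - 1)) - W i s\<bar> \<le> (2 * C2 + C3) * s ^ (d - 1)"
    if s: "s \<ge> 1" and *: "adm s x" "j \<in> \<int>" "\<bar>j - \<theta> s x i\<bar> \<le> C"
      "\<forall>g\<in>I - {i}. \<bar>n g - \<theta> s x g\<bar> \<le> C" for s x n j
  proof -
    let ?\<Delta> = "W i (s + C1) - W i (s - C1)"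
    have "W i (s - C1) \<le> W i s" "W i s \<le> W i (s + C1)" using W_mono[OF i] C1(1) by auto
    then have "\<bar>cnt (n(i := j)) - cnt (n(i := j - 1)) - W i s\<bar> \<le> ?\<Delta>" using C1(2)[OF *] by linarith
    then have "s * \<bar>cnt (n(i := j)) - cnt (n(i := j - 1)) - W i s\<bar> \<le> s * ?\<Delta>"
      using s by (intro mult_left_mono) auto
    also have "\<dots> \<le> (2 * C2 + C3) * s ^ (d - 1)"
    proof (cases "s \<ge> 2 * C1 + 2")
      case True
      \<comment> \<open>Starting from the lower end turns the two-sided window into one shell of
        width \<open>2 * C1\<close>; replacing the factor \<open>s\<close> by \<open>t\<close> costs
        only a factor 2.\<close>
      define t where "t = s - C1"
      have t: "t \<ge> 1" "s \<le> 2 * t" "t \<le> s" using True C1(1) by (auto simp: t_def)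
      have "?\<Delta> \<ge> 0" using W_mono[OF i, of "s - C1" "s + C1"] C1(1) by simp
      then have "s * ?\<Delta> \<le> (2 * t) * ?\<Delta>" using t by (intro mult_right_mono) auto
      also have "\<dots> = 2 * (t * (W i (t + 2 * C1) - W i t))"
      proof -
        have e: "t + 2 * C1 = s + C1" by (simp add: t_def)
        show ?thesis unfolding e by (simp only: t_def mult.assoc)
      qed
      also have "\<dots> \<le> 2 * (C2 * t ^ (d - 1))" using C2(2)[OF t(1)] by simp
      also have "\<dots> \<le> 2 * (C2 * s ^ (d - 1))"
        using t C2(1) by (intro mult_left_mono power_mono) auto
      also have "\<dots> \<le> (2 * C2 + C3) * s ^ (d - 1)" using C3 s by (simp add: algebra_simps)
      finally show ?thesis .
    next
      case False
      have "?\<Delta> \<le> W i (s + C1)" using W_nonneg by simp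
      also have "\<dots> \<le> W i (3 * C1 + 2)" using False by (intro W_mono[OF i]) auto
      finally have "s * ?\<Delta> \<le> s * W i (3 * C1 + 2)" using s by (intro mult_left_mono) auto
      also have "\<dots> \<le> C3 * 1" unfolding C3_def using False W_nonneg by (auto intro: mult_right_mono)
      also have "\<dots> \<le> (2 * C2 + C3) * s ^ (d - 1)"
        using C2(1) C3 s by (intro mult_mono) auto
      finally show ?thesis .
    qed
    finally show ?thesis .
  qed
  then show ?thesis using C2(1) C3 by (intro exI[of _ "2 * C2 + C3"]) auto
qed

lemma cnt_change_one:
  assumes i: "i \<in> I" and C: "C \<ge> 0"
  shows "\<exists>C'\<ge>0. \<forall>s\<ge>1. \<forall>x n j j'. adm s x \<longrightarrow> j \<in> \<int> \<longrightarrow> j' \<in> \<int> \<longrightarrow>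
      \<bar>j - \<theta> s x i\<bar> \<le> C \<longrightarrow> \<bar>j' - \<theta> s x i\<bar> \<le> C \<longrightarrow> (\<forall>g\<in>I - {i}. \<bar>n g - \<theta> s x g\<bar> \<le> C) \<longrightarrow>
      s * \<bar>cnt (n(i := j')) - cnt (n(i := j)) - (j' - j) * W i s\<bar> \<le> C' * s ^ (d - 1)"
proof -
  obtain C1 where C1: "C1 \<ge> 0" "\<And>s x n j. s \<ge> 1 \<Longrightarrow> adm s x \<Longrightarrow> j \<in> \<int> \<Longrightarrow> \<bar>j - \<theta> s x i\<bar> \<le> C \<Longrightarrow>
      (\<forall>g\<in>I - {i}. \<bar>n g - \<theta> s x g\<bar> \<le> C) \<Longrightarrow>
      s * \<bar>cnt (n(i := j)) - cnt (n(i := j - 1)) - W i s\<bar> \<le> C1 * s ^ (d - 1)"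
    using cnt_step[OF i C] by blast
  have up: "s * \<bar>cnt (n(i := j + real m)) - cnt (n(i := j)) - real m * W i s\<bar> \<le> real m * C1 * s ^ (d - 1)"
    if s: "s \<ge> 1" and "adm s x" "j \<in> \<int>" "\<bar>j - \<theta> s x i\<bar> \<le> C" "\<bar>j + real m - \<theta> s x i\<bar> \<le> C"
      "\<forall>g\<in>I - {i}. \<bar>n g - \<theta> s x g\<bar> \<le> C" for s x n j m
    using that(5)
  proof (induction m)
    case (Suc m)
    \<comment> \<open>Intermediate right-hand sides lie between the two end values and so obey the
      same bound \<open>C\<close>.\<close>
    have "\<bar>j + real m - \<theta> s x i\<bar> \<le> C" using Suc.prems that(4) by (simp add: abs_le_iff)
    note IH = Suc.IH[OF this]
    let ?x = "cnt (n(i := j + real (Suc m)))" and ?y = "cnt (n(i := j + real m))" and ?z = "cnt (n(i := j))"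
    have "s * \<bar>?x - cnt (n(i := j + real (Suc m) - 1)) - W i s\<bar> \<le> C1 * s ^ (d - 1)"
      using that Suc.prems by (intro C1(2)) auto
    moreover have "j + real (Suc m) - 1 = j + real m" by simp
    ultimately have 1: "s * \<bar>?x - ?y - W i s\<bar> \<le> C1 * s ^ (d - 1)" by metis
    have "\<bar>?x - ?z - real (Suc m) * W i s\<bar> \<le> \<bar>?x - ?y - W i s\<bar> + \<bar>?y - ?z - real m * W i s\<bar>"
      by (simp add: algebra_simps)
    then have "s * \<bar>?x - ?z - real (Suc m) * W i s\<bar> \<le> s * (\<bar>?x - ?y - W i s\<bar> + \<bar>?y - ?z - real m * W i s\<bar>)"
      using s by (intro mult_left_mono) auto
    also have "\<dots> \<le> C1 * s ^ (d - 1) + real m * C1 * s ^ (d - 1)"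
      unfolding distrib_left using 1 IH by linarith
    also have "\<dots> = real (Suc m) * C1 * s ^ (d - 1)" by (simp add: algebra_simps)
    finally show ?case .
  qed simp
  have up': "s * \<bar>cnt (n(i := j')) - cnt (n(i := j)) - (j' - j) * W i s\<bar> \<le> (2 * C * C1) * s ^ (d - 1)"
    if s: "s \<ge> 1" and *: "adm s x" "j \<in> \<int>" "j' \<in> \<int>" "\<bar>j - \<theta> s x i\<bar> \<le> C" "\<bar>j' - \<theta> s x i\<bar> \<le> C"
      "\<forall>g\<in>I - {i}. \<bar>n g - \<theta> s x g\<bar> \<le> C" and le: "j \<le> j'" for s x n j j'
  proof -
    define m where "m = nat \<lfloor>j' - j\<rfloor>"
    have "j' - j \<in> \<int>" using * by auto
    then have m: "j' = j + real m" using le by (auto simp: m_def elim!: Ints_cases)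
    have m2: "real m \<le> 2 * C" using *(4,5) m by (simp add: abs_le_iff)
    have "s * \<bar>cnt (n(i := j')) - cnt (n(i := j)) - (j' - j) * W i s\<bar> \<le> real m * C1 * s ^ (d - 1)"
      using up[OF s *(1,2,4), of m n] * by (simp add: m)
    also have "\<dots> \<le> (2 * C * C1) * s ^ (d - 1)"
      using m2 C1(1) s by (intro mult_right_mono) auto
    finally show ?thesis .
  qed
  have "s * \<bar>cnt (n(i := j')) - cnt (n(i := j)) - (j' - j) * W i s\<bar> \<le> (2 * C * C1) * s ^ (d - 1)"
    if s: "s \<ge> 1" and *: "adm s x" "j \<in> \<int>" "j' \<in> \<int>" "\<bar>j - \<theta> s x i\<bar> \<le> C" "\<bar>j' - \<theta> s x i\<bar> \<le> C"
      "\<forall>g\<in>I - {i}. \<bar>n g - \<theta> s x g\<bar> \<le> C" for s x n j j'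
  proof (cases "j \<le> j'")
    case False
    have "\<bar>cnt (n(i := j')) - cnt (n(i := j)) - (j' - j) * W i s\<bar>
        = \<bar>cnt (n(i := j)) - cnt (n(i := j')) - (j - j') * W i s\<bar>"
      by (simp add: abs_if algebra_simps)
    then show ?thesis using up'[OF s *(1,3,2,5,4,6)] False by simp
  qed (use up'[OF s *] in blast)
  then show ?thesis using C C1(1) by (intro exI[of _ "2 * C * C1"]) auto
qed

text \<open>The facets are switched from \<open>n\<close> to \<open>n'\<close> one at a time. Both
  vectors stay within \<open>C\<close> of \<open>\<theta> s x\<close>, hence so does every mixture,
  and one constant serves all \<open>x\<close>, \<open>n\<close> and \<open>n'\<close>.\<close>

lemma cnt_change:
  assumes C: "C \<ge> 0"
  shows "\<exists>C'\<ge>0. \<forall>s\<ge>1. \<forall>x n n'. adm s x \<longrightarrow> (\<forall>i\<in>I. n i \<in> \<int> \<and> n' i \<in> \<int>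
      \<and> \<bar>n i - \<theta> s x i\<bar> \<le> C \<and> \<bar>n' i - \<theta> s x i\<bar> \<le> C) \<longrightarrow>
      s * \<bar>cnt n' - cnt n - (\<Sum>i\<in>I. (n' i - n i) * W i s)\<bar> \<le> C' * s ^ (d - 1)"
proof -
  have "\<exists>C'\<ge>0. \<forall>s\<ge>1. \<forall>x n n'. adm s x \<longrightarrow> (\<forall>i\<in>I. n i \<in> \<int> \<and> n' i \<in> \<int>
      \<and> \<bar>n i - \<theta> s x i\<bar> \<le> C \<and> \<bar>n' i - \<theta> s x i\<bar> \<le> C) \<longrightarrow>
      s * \<bar>cnt (\<lambda>i. if i \<in> J then n' i else n i) - cnt n - (\<Sum>i\<in>J. (n' i - n i) * W i s)\<bar> \<le> C' * s ^ (d - 1)"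
    if "finite J" "J \<subseteq> I" for J
    using that
  proof (induction J rule: finite_induct)
    case empty
    then show ?case by (intro exI[of _ 0]) simp
  next
    case (insert k J)
    then have k: "k \<in> I" by simp
    obtain C1 where C1: "C1 \<ge> 0" "\<And>s x n n'. s \<ge> 1 \<Longrightarrow> adm s x \<Longrightarrow> (\<forall>i\<in>I. n i \<in> \<int> \<and> n' i \<in> \<int>
      \<and> \<bar>n i - \<theta> s x i\<bar> \<le> C \<and> \<bar>n' i - \<theta> s x i\<bar> \<le> C) \<Longrightarrow>
      s * \<bar>cnt (\<lambda>i. if i \<in> J then n' i else n i) - cnt n - (\<Sum>i\<in>J. (n' i - n i) * W i s)\<bar> \<le> C1 * s ^ (d - 1)"
      using insert by auto
    obtain C2 where C2: "C2 \<ge> 0" "\<And>s x n j j'. s \<ge> 1 \<Longrightarrow> adm s x \<Longrightarrow> j \<in> \<int> \<Longrightarrow> j' \<in> \<int> \<Longrightarrow>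
      \<bar>j - \<theta> s x k\<bar> \<le> C \<Longrightarrow> \<bar>j' - \<theta> s x k\<bar> \<le> C \<Longrightarrow> (\<forall>g\<in>I - {k}. \<bar>n g - \<theta> s x g\<bar> \<le> C) \<Longrightarrow>
      s * \<bar>cnt (n(k := j')) - cnt (n(k := j)) - (j' - j) * W k s\<bar> \<le> C2 * s ^ (d - 1)"
      using cnt_change_one[OF k C] by blast
    have "s * \<bar>cnt (\<lambda>i. if i \<in> insert k J then n' i else n i) - cnt n - (\<Sum>i\<in>insert k J. (n' i - n i) * W i s)\<bar>
        \<le> (C1 + C2) * s ^ (d - 1)"
      if s: "s \<ge> 1" and *: "adm s x" "\<forall>i\<in>I. n i \<in> \<int> \<and> n' i \<in> \<int>
      \<and> \<bar>n i - \<theta> s x i\<bar> \<le> C \<and> \<bar>n' i - \<theta> s x i\<bar> \<le> C" for s x n n'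
    proof -
      let ?m = "\<lambda>i. if i \<in> J then n' i else n i" and ?m' = "\<lambda>i. if i \<in> insert k J then n' i else n i"
      have m': "?m' = ?m(k := n' k)" and m: "?m = ?m(k := n k)" using insert(2) by auto
      have "s * \<bar>cnt (?m(k := n' k)) - cnt (?m(k := n k)) - (n' k - n k) * W k s\<bar> \<le> C2 * s ^ (d - 1)"
        using s * k by (intro C2(2)[of s x]) auto
      then have 1: "s * \<bar>cnt ?m' - cnt ?m - (n' k - n k) * W k s\<bar> \<le> C2 * s ^ (d - 1)"
        using m m' by metis
      have 2: "s * \<bar>cnt ?m - cnt n - (\<Sum>i\<in>J. (n' i - n i) * W i s)\<bar> \<le> C1 * s ^ (d - 1)"
        using C1(2)[OF s *] .
      have "\<bar>cnt ?m' - cnt n - (\<Sum>i\<in>insert k J. (n' i - n i) * W i s)\<bar>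
          \<le> \<bar>cnt ?m' - cnt ?m - (n' k - n k) * W k s\<bar> + \<bar>cnt ?m - cnt n - (\<Sum>i\<in>J. (n' i - n i) * W i s)\<bar>"
        unfolding sum.insert[OF insert(1,2)] by linarith
      then have "s * \<bar>cnt ?m' - cnt n - (\<Sum>i\<in>insert k J. (n' i - n i) * W i s)\<bar>
          \<le> s * (\<bar>cnt ?m' - cnt ?m - (n' k - n k) * W k s\<bar> + \<bar>cnt ?m - cnt n - (\<Sum>i\<in>J. (n' i - n i) * W i s)\<bar>)"
        using s by (intro mult_left_mono) auto
      also have "\<dots> \<le> (C1 + C2) * s ^ (d - 1)" unfolding distrib_left distrib_right using 1 2 by linarith
      finally show ?thesis .
    qed
    then show ?case using C1(1) C2(1) by (intro exI[of _ "C1 + C2"]) auto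
  qed
  from this[OF finI order_refl] obtain C' where C': "C' \<ge> 0" "\<And>s x n n'. s \<ge> 1 \<Longrightarrow> adm s x \<Longrightarrow> (\<forall>i\<in>I. n i \<in> \<int> \<and> n' i \<in> \<int>
      \<and> \<bar>n i - \<theta> s x i\<bar> \<le> C \<and> \<bar>n' i - \<theta> s x i\<bar> \<le> C) \<Longrightarrow>
      s * \<bar>cnt (\<lambda>i. if i \<in> I then n' i else n i) - cnt n - (\<Sum>i\<in>I. (n' i - n i) * W i s)\<bar> \<le> C' * s ^ (d - 1)"
    by blast
  have "cnt (\<lambda>i. if i \<in> I then n' i else n i) = cnt n'" for n n'
    unfolding cnt_def by (intro arg_cong[of _ _ real] arg_cong[of _ _ card]) auto
  then show ?thesis using C' by (intro exI[of _ C']) auto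
qed

lemma cnt_cong: "(\<And>i. i \<in> I \<Longrightarrow> n i = n' i) \<Longrightarrow> cnt n = cnt n'"
  unfolding cnt_def by (intro arg_cong[of _ _ real] arg_cong[of _ _ card]) auto

lemma cnt_floor: "cnt n = cnt (\<lambda>i. of_int \<lfloor>n i\<rfloor>)"
proof -
  have "a i \<bullet> y \<le> n i \<longleftrightarrow> a i \<bullet> y \<le> of_int \<lfloor>n i\<rfloor>" if "i \<in> I" "y \<in> integer_points" "y \<in> V" for i y
    using vals_Ints[OF that] by (auto elim!: Ints_cases simp: le_floor_iff)
  then show ?thesis
    unfolding cnt_def by (intro arg_cong[of _ _ real] arg_cong[of _ _ card]) auto
qed

end

section \<open>Dilations and the doubling argument\<close>

context lattice_facets
begin

lemma mem_dilate_body: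
  assumes k: "k > 0" and x: "adm (real k) x"
  shows "x + y \<in> dilate k body \<longleftrightarrow> y \<in> V \<and> (\<forall>i\<in>I. a i \<bullet> y \<le> \<theta> (real k) x i)"
proof -
  have "x + y \<in> dilate k body \<longleftrightarrow> (1 / real k) *\<^sub>R (x + y) \<in> body"
  proof
    assume "x + y \<in> dilate k body"
    then obtain p where "p \<in> body" "x + y = real k *\<^sub>R p" by (auto simp: dilate_def)
    then show "(1 / real k) *\<^sub>R (x + y) \<in> body" using k by simp
  next
    assume "(1 / real k) *\<^sub>R (x + y) \<in> body"
    then show "x + y \<in> dilate k body" unfolding dilate_def
      using k by (intro image_eqI[of _ _ "(1 / real k) *\<^sub>R (x + y)"]) auto
  qed
  also have "\<dots> \<longleftrightarrow> (1 / real k) *\<^sub>R (x + y) - f0 \<in> V \<and> (\<forall>i\<in>I. a i \<bullet> ((1 / real k) *\<^sub>R (x + y)) \<le> b i)"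
    by (simp add: body_def)
  also have "(1 / real k) *\<^sub>R (x + y) - f0 \<in> V \<longleftrightarrow> y \<in> V"
  proof -
    have e: "y - (real k *\<^sub>R f0 - x) = real k *\<^sub>R ((1 / real k) *\<^sub>R (x + y) - f0)"
      using k by (simp add: algebra_simps)
    have "(1 / real k) *\<^sub>R (x + y) - f0 \<in> V \<longleftrightarrow> real k *\<^sub>R ((1 / real k) *\<^sub>R (x + y) - f0) \<in> V"
    proof
      assume "real k *\<^sub>R ((1 / real k) *\<^sub>R (x + y) - f0) \<in> V"
      then have "(1 / real k) *\<^sub>R (real k *\<^sub>R ((1 / real k) *\<^sub>R (x + y) - f0)) \<in> V"
        by (rule subspace_scale[OF subV])
      then show "(1 / real k) *\<^sub>R (x + y) - f0 \<in> V" using k by simp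
    qed (rule subspace_scale[OF subV])
    also have "\<dots> \<longleftrightarrow> y - (real k *\<^sub>R f0 - x) \<in> V" unfolding e ..
    also have "\<dots> \<longleftrightarrow> y \<in> V"
      using x subV unfolding adm_def by (metis diff_add_cancel subspace_add subspace_diff)
    finally show ?thesis .
  qed
  also have "(\<forall>i\<in>I. a i \<bullet> ((1 / real k) *\<^sub>R (x + y)) \<le> b i) \<longleftrightarrow> (\<forall>i\<in>I. a i \<bullet> y \<le> \<theta> (real k) x i)"
    using k by (intro ball_cong refl) (simp add: \<theta>_def inner_add_right field_simps)
  finally show ?thesis .
qed

text \<open>Translation by the integer point \<open>x\<close> moves the dilate into
  \<open>V\<close>, where only its right-hand sides depend on \<open>k\<close> and
  \<open>x\<close>.\<close>

lemma card_dilate: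
  assumes k: "k > 0" and x: "adm (real k) x" "x \<in> integer_points"
  shows "real (card (dilate k body \<inter> integer_points)) = cnt (\<theta> (real k) x)"
proof -
  have "dilate k body \<inter> integer_points
      = (\<lambda>y. x + y) ` {y \<in> integer_points \<inter> V. \<forall>i\<in>I. a i \<bullet> y \<le> \<theta> (real k) x i}" (is "?L = ?R")
  proof
    show "?L \<subseteq> ?R"
    proof
      fix z assume z: "z \<in> ?L"
      then have "z - x \<in> V \<and> (\<forall>i\<in>I. a i \<bullet> (z - x) \<le> \<theta> (real k) x i)"
        using mem_dilate_body[OF k x(1), of "z - x"] by simp
      then show "z \<in> ?R" using z x(2) by (intro image_eqI[of _ _ "z - x"]) (auto simp: integer_points_diff)
    qed
    show "?R \<subseteq> ?L"
    proof
      fix z assume "z \<in> ?R"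
      then obtain y where y: "y \<in> integer_points" "y \<in> V" "\<forall>i\<in>I. a i \<bullet> y \<le> \<theta> (real k) x i" "z = x + y"
        by blast
      then show "z \<in> ?L" using mem_dilate_body[OF k x(1), of y] x(2) by (simp add: integer_points_add)
    qed
  qed
  then show ?thesis by (simp add: cnt_def card_image)
qed

lemma dilate_integer_point_adm:
  assumes "k > 0" "x \<in> dilate k body"
  shows "adm (real k) x"
proof -
  obtain p where p: "p \<in> body" "x = real k *\<^sub>R p" using assms by (auto simp: dilate_def)
  have "real k *\<^sub>R f0 - x = (- real k) *\<^sub>R (p - f0)" by (simp add: p algebra_simps)
  then show ?thesis using p(1) subspace_scale[OF subV, of "p - f0" "- real k"] by (simp add: adm_def body_def)
qed

text \<open>A ball around a lattice point near the translated centre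
  \<open>s *\<^sub>R f0 - x\<close> fits into the body.\<close>

lemma cnt_lower:
  "\<exists>c>0. \<exists>s0\<ge>1. \<forall>s\<ge>s0. \<forall>x. adm s x \<longrightarrow> c * s ^ d \<le> cnt (\<theta> s x)"
proof -
  obtain R where R: "R \<ge> 0" "\<And>v. v \<in> V \<Longrightarrow> \<exists>x \<in> V \<inter> integer_points. norm (v - x) \<le> R"
    by (rule integral_subspace_covering[OF V]) blast
  obtain c where c: "c > 0"
    "\<And>s. s \<ge> 0 \<Longrightarrow> c * s ^ d \<le> real (card (integer_points \<inter> V \<inter> cball 0 s))"
    by (rule integral_subspace_card_lower[OF V]) blast
  define h where "h = (\<lambda>i. b i - a i \<bullet> f0)"
  have h: "h i > 0" if "i \<in> I" for i using f0[OF that] by (simp add: h_def)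
  define E where "E = 1 + (\<Sum>i\<in>I. norm (a i) / h i)"
  have E: "E \<ge> 1" unfolding E_def using h by (auto intro!: sum_nonneg simp: less_imp_le)
  have aE: "norm (a i) \<le> E * h i" if i: "i \<in> I" for i
  proof -
    have "norm (a i) / h i \<le> (\<Sum>i\<in>I. norm (a i) / h i)"
      using i finI h by (intro member_le_sum) (auto simp: less_imp_le)
    then have "norm (a i) / h i \<le> E" unfolding E_def by linarith
    then show ?thesis using h[OF i] by (simp add: field_simps)
  qed
  \<comment> \<open>Half of the slack \<open>s * h i\<close> pays for rounding the centre, which
    needs \<open>s \<ge> 2 * E * R\<close>; the other half pays for a ball of radius
    \<open>s / (2 * E)\<close>.\<close>
  have "c * (1 / (2 * E)) ^ d * s ^ d \<le> cnt (\<theta> s x)" if s: "s \<ge> 2 * E * R + 1" and x: "adm s x" for s x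
  proof -
    have "2 * E * R \<ge> 0" using E R(1) by simp
    then have s0: "s \<ge> 0" using s by linarith
    obtain y where y: "y \<in> V" "y \<in> integer_points" "norm (s *\<^sub>R f0 - x - y) \<le> R"
      using R(2)[of "s *\<^sub>R f0 - x"] x by (auto simp: adm_def)
    have "c * (1 / (2 * E)) ^ d * s ^ d = c * (s / (2 * E)) ^ d" by (simp add: power_divide)
    also have "\<dots> \<le> real (card (integer_points \<inter> V \<inter> cball 0 (s / (2 * E))))"
      using s0 E by (intro c(2)) auto
    also have "\<dots> \<le> cnt (\<theta> s x)"
      unfolding cnt_def
    proof (intro of_nat_mono card_inj_on_le[of "\<lambda>z. y + z"] finite_cnt)
      show "(\<lambda>z. y + z) ` (integer_points \<inter> V \<inter> cball 0 (s / (2 * E)))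
          \<subseteq> {y \<in> integer_points \<inter> V. \<forall>i\<in>I. a i \<bullet> y \<le> \<theta> s x i}"
      proof
        fix w assume "w \<in> (\<lambda>z. y + z) ` (integer_points \<inter> V \<inter> cball 0 (s / (2 * E)))"
        then obtain z where z: "z \<in> integer_points" "z \<in> V" "norm z \<le> s / (2 * E)" "w = y + z" by auto
        have "a i \<bullet> w \<le> \<theta> s x i" if i: "i \<in> I" for i
        proof -
          define v where "v = s *\<^sub>R f0 - x - y"
          have 1: "\<bar>a i \<bullet> v\<bar> \<le> (E * h i) * R"
            using Cauchy_Schwarz_ineq2[of "a i" v] y(3) aE[OF i] h[OF i] E
            by (intro order_trans[OF Cauchy_Schwarz_ineq2] mult_mono) (auto simp: v_def)
          have "a i \<bullet> z \<le> norm (a i) * norm z" by (rule norm_cauchy_schwarz)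
          also have "\<dots> \<le> (E * h i) * (s / (2 * E))"
            using aE[OF i] z(3) E h[OF i] by (intro mult_mono) auto
          also have "\<dots> = s * h i / 2" using E by simp
          finally have 2: "a i \<bullet> z \<le> s * h i / 2" .
          have "(2 * E * R) * h i \<le> s * h i" using s h[OF i] by (intro mult_right_mono) auto
          then have 3: "(E * h i) * R \<le> s * h i / 2" by (simp add: algebra_simps)
          have "a i \<bullet> w = s * (a i \<bullet> f0) - a i \<bullet> x - a i \<bullet> v + a i \<bullet> z"
            by (simp add: z(4) v_def inner_diff_right inner_add_right)
          also have "\<dots> \<le> s * (a i \<bullet> f0) - a i \<bullet> x + s * h i" using 1 2 3 by linarith
          also have "\<dots> = \<theta> s x i" by (simp add: \<theta>_def h_def algebra_simps)
          finally show ?thesis .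
        qed
        then show "w \<in> {y \<in> integer_points \<inter> V. \<forall>i\<in>I. a i \<bullet> y \<le> \<theta> s x i}"
          using y z subV by (auto simp: integer_points_add subspace_add)
      qed
    qed auto
    finally show ?thesis .
  qed
  moreover have "2 * E * R + 1 \<ge> 1" using E R(1) by simp
  moreover have "c * (1 / (2 * E)) ^ d > 0" using c(1) E by simp
  ultimately show ?thesis by blast
qed

section \<open>Lattice points modulo 2 and the count in the doubled body\<close>

definition parity :: "real ^ 'n \<Rightarrow> 'n set" where
  "parity y = {k. odd \<lfloor>y $ k\<rfloor>}"

lemma parity_add_double:
  assumes "r \<in> integer_points" "y \<in> integer_points"
  shows "parity (r + 2 *\<^sub>R y) = parity r"
proof -
  have "\<lfloor>(r + 2 *\<^sub>R y) $ k\<rfloor> = \<lfloor>r $ k\<rfloor> + 2 * \<lfloor>y $ k\<rfloor>" for k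
  proof -
    obtain p q :: int where "r $ k = of_int p" "y $ k = of_int q"
      using assms unfolding integer_points_def by (metis Ints_cases mem_Collect_eq)
    then have "(r + 2 *\<^sub>R y) $ k = of_int (p + 2 * q)" by simp
    then show ?thesis unfolding floor_eq_iff using \<open>r $ k = of_int p\<close> \<open>y $ k = of_int q\<close> by simp
  qed
  then show ?thesis by (simp add: parity_def)
qed

lemma parity_minus:
  assumes "r \<in> integer_points"
  shows "parity (- r) = parity r"
  using parity_add_double[of r "- r"] assms by (simp add: integer_points_minus scaleR_2)

text \<open>The half difference stays in \<open>V\<close> because \<open>V\<close> is a subspace. So
  \<open>parity\<close> separates the classes of \<open>integer_points \<inter> V\<close> modulo
  twice this very lattice, and there are finitely many of them.\<close>

lemma parity_eq_half_diff:
  assumes r: "r \<in> integer_points" "r \<in> V" and y: "y \<in> integer_points" "y \<in> V"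
    and eq: "parity y = parity r"
  shows "(1 / 2) *\<^sub>R (y - r) \<in> integer_points" "(1 / 2) *\<^sub>R (y - r) \<in> V"
proof -
  show "(1 / 2) *\<^sub>R (y - r) \<in> V" using r y subV by (simp add: subspace_scale subspace_diff)
  have "(1 / 2) * (y $ k - r $ k) \<in> \<int>" for k
  proof -
    obtain p q :: int where pq: "r $ k = of_int p" "y $ k = of_int q"
      using r y unfolding integer_points_def by (metis Ints_cases mem_Collect_eq)
    have "odd q \<longleftrightarrow> odd p" using eq pq by (auto simp: parity_def set_eq_iff dest!: spec[of _ k])
    then have "even (q - p)" by simp
    then obtain m where "q - p = 2 * m" by (rule evenE)
    then have "y $ k - r $ k = 2 * of_int m" unfolding pq by linarith
    then show ?thesis by simp
  qed
  then show "(1 / 2) *\<^sub>R (y - r) \<in> integer_points" by (simp add: integer_points_def)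
qed

text \<open>Substituting \<open>y = r + 2 *\<^sub>R z\<close> halves the right-hand sides and moves
  them by half the value of \<open>a i\<close> at \<open>r\<close>.\<close>

lemma card_parity_class:
  assumes r: "r \<in> integer_points" "r \<in> V"
  shows "real (card {y \<in> integer_points \<inter> V. parity y = parity r \<and> (\<forall>i\<in>I. a i \<bullet> y \<le> 2 * n i)})
    = cnt (\<lambda>i. n i - (a i \<bullet> r) / 2)"
proof -
  let ?X = "{y \<in> integer_points \<inter> V. \<forall>i\<in>I. a i \<bullet> y \<le> n i - (a i \<bullet> r) / 2}"
  have "{y \<in> integer_points \<inter> V. parity y = parity r \<and> (\<forall>i\<in>I. a i \<bullet> y \<le> 2 * n i)}
      = (\<lambda>y. r + 2 *\<^sub>R y) ` ?X" (is "?L = ?R")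
  proof
    show "?R \<subseteq> ?L"
      using r subV parity_add_double[OF r(1)]
      by (auto simp: integer_points_add integer_points_scale subspace_add subspace_scale inner_add_right field_simps)
    show "?L \<subseteq> ?R"
    proof
      fix y assume y: "y \<in> ?L"
      let ?z = "(1 / 2) *\<^sub>R (y - r)"
      have "?z \<in> ?X"
        using parity_eq_half_diff[OF r, of y] y by (auto simp: inner_diff_right field_simps)
      moreover have "y = r + 2 *\<^sub>R ?z" by simp
      ultimately show "y \<in> ?R" by blast
    qed
  qed
  moreover have "inj_on (\<lambda>y. r + 2 *\<^sub>R y) ?X" by (auto simp: inj_on_def)
  ultimately show ?thesis by (simp add: cnt_def card_image)
qed

text \<open>Averaging the parity class of \<open>r\<close>, counted once via \<open>r\<close> and once via \<open>- r\<close>, loses 1 from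
  \<open>\<lfloor>t / 2\<rfloor> + \<lfloor>- t / 2\<rfloor>\<close> for odd \<open>t = a i \<bullet> r\<close>; this makes the second coefficient positive.\<close>

lemma cnt_double:
  "\<exists>C\<ge>0. \<exists>\<kappa>::nat. \<exists>w. (\<forall>i\<in>I. w i \<ge> 1) \<and> (\<forall>s\<ge>1. \<forall>x. adm s x \<longrightarrow> (\<forall>i\<in>I. \<theta> s x i \<in> \<int>) \<longrightarrow>
     s * \<bar>2 * cnt (\<lambda>i. 2 * \<theta> s x i) - 2 * real \<kappa> * cnt (\<theta> s x) + (\<Sum>i\<in>I. w i * W i s)\<bar> \<le> C * s ^ (d - 1))"
proof -
  define Q where "Q = parity ` (integer_points \<inter> V)"
  have finQ: "finite Q" unfolding Q_def by (rule finite_subset[of _ UNIV]) auto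
  have "\<forall>q\<in>Q. \<exists>r. r \<in> integer_points \<and> r \<in> V \<and> parity r = q" by (auto simp: Q_def)
  then obtain r where r: "\<And>q. q \<in> Q \<Longrightarrow> r q \<in> integer_points" "\<And>q. q \<in> Q \<Longrightarrow> r q \<in> V"
    "\<And>q. q \<in> Q \<Longrightarrow> parity (r q) = q" by metis
  \<comment> \<open>For \<open>i \<in> I\<close> and \<open>q \<in> Q\<close> this is 1 or 0
    according to whether \<open>a i \<bullet> r q\<close> is odd or even, so \<open>w i\<close> is
    the number of odd classes.\<close>
  define e where "e = (\<lambda>q i. - of_int (\<lfloor>a i \<bullet> r q / 2\<rfloor> + \<lfloor>- (a i \<bullet> r q) / 2\<rfloor>) :: real)"
  define w where "w = (\<lambda>i. \<Sum>q\<in>Q. e q i)"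
  have e0: "e q i \<ge> 0" for q i
  proof -
    have "\<lfloor>a i \<bullet> r q / 2\<rfloor> + \<lfloor>- (a i \<bullet> r q) / 2\<rfloor> \<le> \<lfloor>a i \<bullet> r q / 2 + - (a i \<bullet> r q) / 2\<rfloor>"
      by (rule le_floor_add)
    then show ?thesis by (simp add: e_def)
  qed
  have w: "w i \<ge> 1" if i: "i \<in> I" for i
  proof -
    obtain u where u: "u \<in> integer_points" "u \<in> V" "a i \<bullet> u = 1" using unit_vector[OF i] .
    let ?q = "parity u"
    have q: "?q \<in> Q" using u by (auto simp: Q_def)
    obtain m :: int where m: "a i \<bullet> ((1 / 2) *\<^sub>R (r ?q - u)) = of_int m"
      using vals_Ints[OF i parity_eq_half_diff[OF u(1,2) r(1,2)[OF q] r(3)[OF q]]] by (auto elim: Ints_cases)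
    \<comment> \<open>The representative \<open>r ?q\<close> need not be \<open>u\<close>, but the
      two differ by twice a lattice point, so its value under \<open>a i\<close> is odd as
      well.\<close>
    then have ar: "a i \<bullet> r ?q = 2 * of_int m + 1" using u(3) by (simp add: inner_diff_right)
    have "\<lfloor>(2 * of_int m + 1) / 2 :: real\<rfloor> = m" "\<lfloor>- (2 * of_int m + 1) / 2 :: real\<rfloor> = - m - 1"
      by (intro floor_unique; simp add: field_simps)+
    then have "e ?q i = 1" unfolding e_def ar by simp
    moreover have "e ?q i \<le> w i" unfolding w_def using q finQ e0 by (intro member_le_sum) auto
    ultimately show ?thesis by simp
  qed
  define C0 where "C0 = 1 + (\<Sum>q\<in>Q. \<Sum>i\<in>I. \<bar>a i \<bullet> r q\<bar>)"
  have C0: "1 + \<bar>a i \<bullet> r q\<bar> \<le> C0" if "i \<in> I" "q \<in> Q" for i q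
  proof -
    have "\<bar>a i \<bullet> r q\<bar> \<le> (\<Sum>i\<in>I. \<bar>a i \<bullet> r q\<bar>)" using that finI by (intro member_le_sum) auto
    also have "\<dots> \<le> (\<Sum>q\<in>Q. \<Sum>i\<in>I. \<bar>a i \<bullet> r q\<bar>)"
      using that finQ by (intro member_le_sum[of q Q "\<lambda>q. \<Sum>i\<in>I. \<bar>a i \<bullet> r q\<bar>"]) (auto intro: sum_nonneg)
    finally show ?thesis by (simp add: C0_def)
  qed
  have C0': "C0 \<ge> 0" unfolding C0_def by (intro add_nonneg_nonneg sum_nonneg) auto
  obtain C where C: "C \<ge> 0 \<and> (\<forall>s\<ge>1. \<forall>x n n'. adm s x \<longrightarrow> (\<forall>i\<in>I. n i \<in> \<int> \<and> n' i \<in> \<int>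
      \<and> \<bar>n i - \<theta> s x i\<bar> \<le> C0 \<and> \<bar>n' i - \<theta> s x i\<bar> \<le> C0) \<longrightarrow>
      s * \<bar>cnt n' - cnt n - (\<Sum>i\<in>I. (n' i - n i) * W i s)\<bar> \<le> C * s ^ (d - 1))"
    using cnt_change[OF C0'] ..
  have "s * \<bar>2 * cnt (\<lambda>i. 2 * \<theta> s x i) - 2 * real (card Q) * cnt (\<theta> s x) + (\<Sum>i\<in>I. w i * W i s)\<bar>
      \<le> (2 * real (card Q) * C) * s ^ (d - 1)"
    if s: "s \<ge> 1" and x: "adm s x" and \<theta>: "\<forall>i\<in>I. \<theta> s x i \<in> \<int>" for s x
  proof -
    let ?t = "\<theta> s x"
    let ?c = "\<lambda>v i. ?t i + of_int \<lfloor>v i / 2\<rfloor>"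
    \<comment> \<open>The value 1 of \<open>\<sigma>\<close> belongs to the representative
      \<open>- r q\<close>, because \<open>card_parity_class\<close> subtracts the half-value;
      \<open>- 1\<close> belongs to \<open>r q\<close>. Integrality of \<open>?t i\<close> lets the
      floor act on the half-value alone.\<close>
    have split: "cnt (\<lambda>i. 2 * ?t i) = (\<Sum>q\<in>Q. cnt (\<lambda>i. ?t i + of_int \<lfloor>\<sigma> * (a i \<bullet> r q) / 2\<rfloor>))"
      if \<sigma>: "\<sigma> = 1 \<or> \<sigma> = - 1" for \<sigma> :: real
    proof -
      let ?Y = "\<lambda>q. {y \<in> integer_points \<inter> V. parity y = q \<and> (\<forall>i\<in>I. a i \<bullet> y \<le> 2 * ?t i)}"
      have "{y \<in> integer_points \<inter> V. \<forall>i\<in>I. a i \<bullet> y \<le> 2 * ?t i} = (\<Union>q\<in>Q. ?Y q)"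
        by (auto simp: Q_def)
      moreover have "finite (?Y q)" for q
        by (rule finite_subset[OF _ finite_cnt[of "\<lambda>i. 2 * ?t i"]]) auto
      ultimately have "card {y \<in> integer_points \<inter> V. \<forall>i\<in>I. a i \<bullet> y \<le> 2 * ?t i} = (\<Sum>q\<in>Q. card (?Y q))"
        using finQ by (simp only:) (intro card_UN_disjoint, auto)
      then have "cnt (\<lambda>i. 2 * ?t i) = (\<Sum>q\<in>Q. real (card (?Y q)))"
        unfolding cnt_def of_nat_sum[symmetric] by (simp only:)
      also have "\<dots> = (\<Sum>q\<in>Q. cnt (\<lambda>i. ?t i + of_int \<lfloor>\<sigma> * (a i \<bullet> r q) / 2\<rfloor>))"
      proof (rule sum.cong[OF refl])
        fix q assume q: "q \<in> Q"
        let ?r = "- \<sigma> *\<^sub>R r q"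
        have "?r = - r q \<or> ?r = r q" using \<sigma> by auto
        then have "?r \<in> integer_points \<and> ?r \<in> V \<and> parity ?r = q"
          using r[OF q] subspace_neg[OF subV r(2)[OF q]] integer_points_minus[OF r(1)[OF q]]
            parity_minus[OF r(1)[OF q]] by (elim disjE) (simp_all only: simp_thms)
        then have "real (card (?Y q)) = cnt (\<lambda>i. ?t i - (a i \<bullet> ?r) / 2)"
          using card_parity_class[of ?r ?t] by (elim conjE) (simp only:)
        also have "\<dots> = cnt (\<lambda>i. of_int \<lfloor>?t i - (a i \<bullet> ?r) / 2\<rfloor>)" by (rule cnt_floor)
        also have "\<dots> = cnt (\<lambda>i. ?t i + of_int \<lfloor>\<sigma> * (a i \<bullet> r q) / 2\<rfloor>)"
        proof (rule cnt_cong)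
          fix i assume i: "i \<in> I"
          obtain p :: int where "?t i = of_int p" using \<theta> i by (auto elim: Ints_cases)
          then show "real_of_int \<lfloor>?t i - (a i \<bullet> ?r) / 2\<rfloor> = ?t i + of_int \<lfloor>\<sigma> * (a i \<bullet> r q) / 2\<rfloor>"
            by simp
        qed
        finally show "real (card (?Y q)) = cnt (\<lambda>i. ?t i + of_int \<lfloor>\<sigma> * (a i \<bullet> r q) / 2\<rfloor>)" .
      qed
      finally show ?thesis .
    qed
    let ?n = "\<lambda>\<sigma> q i. ?t i + of_int \<lfloor>\<sigma> * (a i \<bullet> r q) / 2\<rfloor>"
    let ?err = "\<lambda>\<sigma> q. cnt (?n \<sigma> q) - cnt ?t - (\<Sum>i\<in>I. (?n \<sigma> q i - ?t i) * W i s)"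
    have err: "s * \<bar>?err \<sigma> q\<bar> \<le> C * s ^ (d - 1)" if \<sigma>: "\<sigma> = 1 \<or> \<sigma> = - 1" and q: "q \<in> Q" for \<sigma> :: real and q
    proof -
      have *: "\<bar>real_of_int \<lfloor>\<sigma> * (a i \<bullet> r q) / 2\<rfloor>\<bar> \<le> C0" if i: "i \<in> I" for i
      proof -
        have "\<bar>real_of_int \<lfloor>\<sigma> * (a i \<bullet> r q) / 2\<rfloor>\<bar> \<le> 1 + \<bar>\<sigma> * (a i \<bullet> r q) / 2\<bar>" by linarith
        also have "\<dots> \<le> 1 + \<bar>a i \<bullet> r q\<bar>" using \<sigma> by (auto simp: abs_mult)
        also have "\<dots> \<le> C0" using C0[OF i q] .
        finally show ?thesis .
      qed
      show ?thesis
        by (rule C[THEN conjunct2, rule_format, OF s x]) (use * \<theta> C0' in auto)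
    qed
    \<comment> \<open>The two expansions of the doubled count are added: the main terms give
      \<open>2 * card Q\<close> copies of \<open>cnt ?t\<close>, and the floors combine to
      \<open>- w i\<close>.\<close>
    have "2 * cnt (\<lambda>i. 2 * ?t i) - 2 * real (card Q) * cnt ?t + (\<Sum>i\<in>I. w i * W i s)
        = (\<Sum>q\<in>Q. ?err 1 q) + (\<Sum>q\<in>Q. ?err (- 1) q)"
    proof -
      have "(\<Sum>i\<in>I. w i * W i s) = (\<Sum>q\<in>Q. \<Sum>i\<in>I. e q i * W i s)"
        unfolding w_def sum_distrib_right by (rule sum.swap)
      also have "\<dots> = - (\<Sum>q\<in>Q. \<Sum>i\<in>I. (?n 1 q i - ?t i) * W i s) - (\<Sum>q\<in>Q. \<Sum>i\<in>I. (?n (- 1) q i - ?t i) * W i s)"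
        unfolding sum_negf[symmetric] sum_subtractf[symmetric]
        by (intro sum.cong refl) (simp add: e_def algebra_simps)
      finally have 1: "(\<Sum>i\<in>I. w i * W i s) = \<dots>" .
      have 2: "(\<Sum>q\<in>Q. ?err \<sigma> q) = cnt (\<lambda>i. 2 * ?t i) - real (card Q) * cnt ?t
          - (\<Sum>q\<in>Q. \<Sum>i\<in>I. (?n \<sigma> q i - ?t i) * W i s)" if "\<sigma> = 1 \<or> \<sigma> = - 1" for \<sigma> :: real
        unfolding split[OF that] by (simp only: sum_subtractf) simp
      show ?thesis unfolding 1 2[OF disjI1[OF refl]] 2[OF disjI2[OF refl]] by linarith
    qed
    then have "s * \<bar>2 * cnt (\<lambda>i. 2 * ?t i) - 2 * real (card Q) * cnt ?t + (\<Sum>i\<in>I. w i * W i s)\<bar>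
        \<le> s * ((\<Sum>q\<in>Q. \<bar>?err 1 q\<bar>) + (\<Sum>q\<in>Q. \<bar>?err (- 1) q\<bar>))"
      using s by (simp only:) (intro mult_left_mono order_trans[OF abs_triangle_ineq] add_mono sum_abs, auto)
    also have "\<dots> = (\<Sum>q\<in>Q. s * \<bar>?err 1 q\<bar>) + (\<Sum>q\<in>Q. s * \<bar>?err (- 1) q\<bar>)"
      by (simp only: distrib_left sum_distrib_left)
    also have "\<dots> \<le> (\<Sum>q\<in>Q. C * s ^ (d - 1)) + (\<Sum>q\<in>Q. C * s ^ (d - 1))"
      by (intro add_mono sum_mono err) auto
    also have "\<dots> = (2 * real (card Q) * C) * s ^ (d - 1)" by simp
    finally show ?thesis .
  qed
  moreover have "2 * real (card Q) * C \<ge> 0" using C by simp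
  ultimately show ?thesis using w by blast
qed

end

section \<open>Asymptotics of quasi-polynomials\<close>

lemma tendsto_shift_ratio:
  fixes q :: nat
  shows "(\<lambda>k. of_nat (k + q) / of_nat k :: complex) \<longlonglongrightarrow> 1"
proof -
  have "(\<lambda>k. 1 + of_nat q * (1 / of_nat k) :: complex) \<longlonglongrightarrow> 1 + of_nat q * 0"
    by (intro tendsto_intros lim_1_over_n)
  moreover have "\<forall>\<^sub>F k in sequentially. 1 + of_nat q * (1 / of_nat k) = (of_nat (k + q) / of_nat k :: complex)"
    using eventually_gt_at_top[of 0] by eventually_elim (simp add: field_simps)
  ultimately show ?thesis by (simp add: tendsto_cong)
qed

lemma poly_leading_limit:
  fixes C :: "nat \<Rightarrow> complex"
  shows "(\<lambda>k. (\<Sum>i\<le>e. C i * of_nat k ^ i) / of_nat k ^ e) \<longlonglongrightarrow> C e"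
proof -
  have "(\<lambda>k. \<Sum>i\<le>e. C i * (1 / of_nat k) ^ (e - i)) \<longlonglongrightarrow> (\<Sum>i\<le>e. C i * 0 ^ (e - i))"
    by (intro tendsto_intros lim_1_over_n)
  also have "(\<Sum>i\<le>e. C i * 0 ^ (e - i)) = (\<Sum>i\<le>e. if i = e then C i else 0)"
    by (intro sum.cong) auto
  also have "\<dots> = C e" by simp
  finally have 1: "(\<lambda>k. \<Sum>i\<le>e. C i * (1 / of_nat k) ^ (e - i)) \<longlonglongrightarrow> C e" .
  have "\<forall>\<^sub>F k in sequentially. (\<Sum>i\<le>e. C i * (1 / of_nat k) ^ (e - i))
      = (\<Sum>i\<le>e. C i * of_nat k ^ i) / of_nat k ^ e"
    using eventually_gt_at_top[of 0]
  proof eventually_elim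
    case (elim k)
    have "C i * (1 / of_nat k) ^ (e - i) = C i * of_nat k ^ i / of_nat k ^ e" if "i \<le> e" for i
    proof -
      have "(of_nat k :: complex) ^ e = of_nat k ^ (e - i) * of_nat k ^ i"
        using that by (simp flip: power_add)
      then show ?thesis using elim by (simp add: power_divide)
    qed
    then show ?case by (simp add: sum_divide_distrib)
  qed
  then show ?thesis using 1 by (simp add: tendsto_cong)
qed

lemma poly_second_limit:
  fixes C :: "nat \<Rightarrow> complex"
  shows "(\<lambda>k. ((\<Sum>i\<le>Suc e. C i * of_nat k ^ i) - C (Suc e) * of_nat k ^ Suc e) / of_nat k ^ e) \<longlonglongrightarrow> C e"
  using poly_leading_limit[of C e] by simp

lemma power_shift_limit:
  fixes q :: nat
  shows "(\<lambda>k. (of_nat (k + q) ^ Suc e - of_nat k ^ Suc e) / of_nat k ^ e :: complex)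
    \<longlonglongrightarrow> of_nat (Suc e) * of_nat q"
proof -
  have "(\<lambda>k. of_nat q * (\<Sum>i<Suc e. (of_nat (k + q) / of_nat k) ^ i) :: complex)
      \<longlonglongrightarrow> of_nat q * (\<Sum>i<Suc e. 1 ^ i)"
    by (intro tendsto_intros tendsto_shift_ratio)
  then have 1: "(\<lambda>k. of_nat q * (\<Sum>i<Suc e. (of_nat (k + q) / of_nat k) ^ i) :: complex)
      \<longlonglongrightarrow> of_nat (Suc e) * of_nat q" by (simp add: mult.commute)
  have "\<forall>\<^sub>F k in sequentially. of_nat q * (\<Sum>i<Suc e. (of_nat (k + q) / of_nat k) ^ i)
      = ((of_nat (k + q) ^ Suc e - of_nat k ^ Suc e) / of_nat k ^ e :: complex)"
    using eventually_gt_at_top[of 0]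
  proof eventually_elim
    case (elim k)
    let ?x = "of_nat (k + q) :: complex" and ?y = "of_nat k :: complex"
    have y: "?y \<noteq> 0" using elim by simp
    have "?x ^ Suc e - ?y ^ Suc e = (?x - ?y) * (\<Sum>i<Suc e. ?y ^ (Suc e - Suc i) * ?x ^ i)"
      by (rule power_diff_sumr2)
    then have "(?x ^ Suc e - ?y ^ Suc e) / ?y ^ e = of_nat q * (\<Sum>i<Suc e. ?y ^ (e - i) * ?x ^ i / ?y ^ e)"
      by (simp only: sum_divide_distrib[symmetric]) simp
    also have "(\<Sum>i<Suc e. ?y ^ (e - i) * ?x ^ i / ?y ^ e) = (\<Sum>i<Suc e. (?x / ?y) ^ i)"
    proof (intro sum.cong refl)
      fix i assume "i \<in> {..<Suc e}"
      then have "?y ^ e = ?y ^ (e - i) * ?y ^ i" by (simp flip: power_add)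
      then show "?y ^ (e - i) * ?x ^ i / ?y ^ e = (?x / ?y) ^ i" using y by (simp add: power_divide)
    qed
    finally show ?case by (rule sym)
  qed
  then show ?thesis using 1 by (rule Lim_transform_eventually[rotated])
qed

text \<open>\<open>C\<close> and \<open>C'\<close> stand for the coefficients on two residue
  classes. Equal top coefficients cancel the order \<open>k ^ Suc e\<close>; what the shift of the
  top power leaves behind is the term with the factor \<open>q\<close>.\<close>

lemma poly_shift_limit:
  fixes C C' :: "nat \<Rightarrow> complex"
  assumes "C' (Suc e) = C (Suc e)"
  shows "(\<lambda>k. ((\<Sum>i\<le>Suc e. C' i * of_nat (k + q) ^ i) - (\<Sum>i\<le>Suc e. C i * of_nat k ^ i)) / of_nat k ^ e)
    \<longlonglongrightarrow> of_nat (Suc e) * of_nat q * C (Suc e) + C' e - C e"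
proof -
  let ?v = "C (Suc e)"
  let ?F' = "\<lambda>k. (\<Sum>i\<le>Suc e. C' i * of_nat k ^ i) - ?v * of_nat k ^ Suc e"
  let ?F = "\<lambda>k. (\<Sum>i\<le>Suc e. C i * of_nat k ^ i) - ?v * of_nat k ^ Suc e"
  have 1: "(\<lambda>k. ?F k / of_nat k ^ e) \<longlonglongrightarrow> C e" by (rule poly_second_limit)
  have "(\<lambda>k. ?F' k / of_nat k ^ e) \<longlonglongrightarrow> C' e"
    using poly_second_limit[of C' e] assms by simp
  then have "(\<lambda>k. ?F' (k + q) / of_nat (k + q) ^ e) \<longlonglongrightarrow> C' e"
    by (rule LIMSEQ_ignore_initial_segment)
  then have 2: "(\<lambda>k. (?F' (k + q) / of_nat (k + q) ^ e) * (of_nat (k + q) / of_nat k) ^ e) \<longlonglongrightarrow> C' e * 1 ^ e"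
    by (intro tendsto_intros tendsto_shift_ratio)
  have 3: "(\<lambda>k. ?v * ((of_nat (k + q) ^ Suc e - of_nat k ^ Suc e) / of_nat k ^ e))
    \<longlonglongrightarrow> ?v * (of_nat (Suc e) * of_nat q)"
    by (intro tendsto_intros power_shift_limit)
  have "(\<lambda>k. (?F' (k + q) / of_nat (k + q) ^ e) * (of_nat (k + q) / of_nat k) ^ e - ?F k / of_nat k ^ e
      + ?v * ((of_nat (k + q) ^ Suc e - of_nat k ^ Suc e) / of_nat k ^ e))
      \<longlonglongrightarrow> C' e * 1 ^ e - C e + ?v * (of_nat (Suc e) * of_nat q)"
    by (intro tendsto_add tendsto_diff 1 2 3)
  moreover have "\<forall>\<^sub>F k in sequentially.
      (?F' (k + q) / of_nat (k + q) ^ e) * (of_nat (k + q) / of_nat k) ^ e - ?F k / of_nat k ^ e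
      + ?v * ((of_nat (k + q) ^ Suc e - of_nat k ^ Suc e) / of_nat k ^ e)
      = ((\<Sum>i\<le>Suc e. C' i * of_nat (k + q) ^ i) - (\<Sum>i\<le>Suc e. C i * of_nat k ^ i)) / of_nat k ^ e"
    using eventually_gt_at_top[of 0]
  proof eventually_elim
    case (elim k)
    have *: "A / x ^ e * (x / y) ^ e - B / y ^ e + v * ((x ^ Suc e - y ^ Suc e) / y ^ e)
        = (A + v * x ^ Suc e - (B + v * y ^ Suc e)) / y ^ e"
      if "x \<noteq> 0" "y \<noteq> 0" for A B v x y :: complex
      using that by (simp add: power_divide field_simps)
    show ?case by (subst *) (use elim in \<open>auto simp del: of_nat_add\<close>)
  qed
  ultimately have "(\<lambda>k. ((\<Sum>i\<le>Suc e. C' i * of_nat (k + q) ^ i) - (\<Sum>i\<le>Suc e. C i * of_nat k ^ i)) / of_nat k ^ e)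
      \<longlonglongrightarrow> C' e * 1 ^ e - C e + ?v * (of_nat (Suc e) * of_nat q)"
    by (rule Lim_transform_eventually)
  then show ?thesis by (simp add: algebra_simps)
qed

text \<open>The predicate \<open>Q\<close> restricts the bound to those dilations at which a
  suitable base point exists, such as multiples of \<open>T\<close>; the sequence \<open>g\<close>
  stays among them.\<close>

lemma tendsto_zero_of_bound:
  fixes X :: "nat \<Rightarrow> real"
  assumes "\<And>k. k > 0 \<Longrightarrow> Q k \<Longrightarrow> real k * \<bar>X k\<bar> \<le> C * real k ^ e"
    and g: "filterlim g at_top sequentially" and "\<And>j. Q (g j)"
  shows "(\<lambda>j. X (g j) / real (g j) ^ e) \<longlonglongrightarrow> 0"
proof (rule Lim_null_comparison)
  show "(\<lambda>j. C * (1 / real (g j))) \<longlonglongrightarrow> 0"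
    using tendsto_mult_left[OF filterlim_compose[OF lim_1_over_n g], of C] by simp
  have "\<forall>\<^sub>F j in sequentially. g j > 0"
    using g unfolding filterlim_at_top by (auto dest!: spec[of _ 1] elim: eventually_mono)
  then show "\<forall>\<^sub>F j in sequentially. norm (X (g j) / real (g j) ^ e) \<le> C * (1 / real (g j))"
  proof eventually_elim
    case (elim j)
    have "real (g j) * \<bar>X (g j)\<bar> \<le> C * real (g j) ^ e" using assms(1,3) elim by blast
    then show ?case using elim by (simp add: field_simps)
  qed
qed

section \<open>Normalised facet counts and dilates that meet the lattice\<close>

context lattice_facets
begin

definition w :: "'i \<Rightarrow> nat \<Rightarrow> real" where
  "w i k = W i (real k) / real k ^ (d - 1)"

lemma w_bounded: "i \<in> I \<Longrightarrow> \<exists>C\<ge>0. \<forall>k>0. w i k \<le> C"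
proof -
  assume "i \<in> I"
  then obtain C where C: "C \<ge> 0 \<and> (\<forall>s\<ge>1. W i s \<le> C * s ^ (d - 1))" using W_upper by blast
  have "w i k \<le> C" if "k > 0" for k
  proof -
    have "W i (real k) \<le> C * real k ^ (d - 1)" using C that by simp
    then show ?thesis using that by (simp add: w_def pos_divide_le_eq)
  qed
  then show ?thesis using C by blast
qed

lemma w_lower: "i \<in> I \<Longrightarrow> \<exists>c>0. \<forall>k>0. c \<le> w i k"
proof -
  assume "i \<in> I"
  then obtain c where c: "c > 0 \<and> (\<forall>s\<ge>0. c * s ^ (d - 1) \<le> W i s)" using W_lower by blast
  have "c \<le> w i k" if "k > 0" for k
  proof -
    have "c * real k ^ (d - 1) \<le> W i (real k)" using c by simp
    then show ?thesis using that by (simp add: w_def pos_le_divide_eq)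
  qed
  then show ?thesis using c by blast
qed

text \<open>The substitute for convergence of \<open>w i\<close>: the limits found on different
  residue classes become comparable. The difference splits into the growth of \<open>W\<close> and
  the change of the normalising power.\<close>

lemma w_shift:
  assumes i: "i \<in> I"
  shows "(\<lambda>k. w i (k + m) - w i k) \<longlonglongrightarrow> 0"
proof -
  let ?e = "d - 1"
  obtain C where C: "C \<ge> 0 \<and> (\<forall>s\<ge>1. s * (W i (s + real m) - W i s) \<le> C * s ^ ?e)"
    using W_shell[OF i, of "real m"] by auto
  have "(\<lambda>j. (W i (real (id j) + real m) - W i (real (id j))) / real (id j) ^ ?e) \<longlonglongrightarrow> 0"
  proof (rule tendsto_zero_of_bound[where Q = "\<lambda>_. True" and C = C])
    fix k :: nat assume "k > 0"
    moreover have "W i (real k) \<le> W i (real k + real m)" by (rule W_mono[OF i]) simp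
    ultimately show "real k * \<bar>W i (real k + real m) - W i (real k)\<bar> \<le> C * real k ^ ?e" using C by simp
  qed (auto simp: id_def filterlim_ident)
  then have 1: "(\<lambda>k. (W i (real k + real m) - W i (real k)) / real k ^ ?e) \<longlonglongrightarrow> 0" by simp
  obtain C1 where C1: "C1 \<ge> 0 \<and> (\<forall>k>0. w i k \<le> C1)" using w_bounded[OF i] ..
  have r: "(\<lambda>k. (real k / real (k + m)) ^ ?e) \<longlonglongrightarrow> 1 ^ ?e"
  proof (intro tendsto_power)
    have "(\<lambda>k. 1 / (1 + real m * (1 / real k))) \<longlonglongrightarrow> 1 / (1 + real m * 0)"
      by (intro tendsto_intros lim_1_over_n) auto
    moreover have "\<forall>\<^sub>F k in sequentially. 1 / (1 + real m * (1 / real k)) = real k / real (k + m)"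
      using eventually_gt_at_top[of 0] by eventually_elim (simp add: field_simps)
    ultimately have "(\<lambda>k. real k / real (k + m)) \<longlonglongrightarrow> 1 / (1 + real m * 0)"
      by (rule Lim_transform_eventually)
    then show "(\<lambda>k. real k / real (k + m)) \<longlonglongrightarrow> 1" by simp
  qed
  have 2: "(\<lambda>k. ((W i (real k + real m) - W i (real k)) / real k ^ ?e) * (real k / real (k + m)) ^ ?e) \<longlonglongrightarrow> 0 * 1 ^ ?e"
    by (intro tendsto_mult 1 r)
  \<comment> \<open>The change of the normalising power, which tends to 0 because \<open>w\<close>
    is bounded.\<close>
  have 3: "(\<lambda>k. w i k * ((real k / real (k + m)) ^ ?e - 1)) \<longlonglongrightarrow> 0"
  proof (rule Lim_null_comparison)
    have "(\<lambda>k. C1 * \<bar>(real k / real (k + m)) ^ ?e - 1\<bar>) \<longlonglongrightarrow> C1 * \<bar>1 ^ ?e - 1\<bar>"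
      by (intro tendsto_intros r)
    then show "(\<lambda>k. C1 * \<bar>(real k / real (k + m)) ^ ?e - 1\<bar>) \<longlonglongrightarrow> 0" by simp
    show "\<forall>\<^sub>F k in sequentially. norm (w i k * ((real k / real (k + m)) ^ ?e - 1))
        \<le> C1 * \<bar>(real k / real (k + m)) ^ ?e - 1\<bar>"
      using eventually_gt_at_top[of 0]
    proof eventually_elim
      case (elim k)
      have "\<bar>w i k\<bar> \<le> C1" using C1 elim W_nonneg[of i] by (simp add: w_def)
      then show ?case unfolding real_norm_def abs_mult by (intro mult_right_mono) auto
    qed
  qed
  have "(\<lambda>k. ((W i (real k + real m) - W i (real k)) / real k ^ ?e) * (real k / real (k + m)) ^ ?e
      + w i k * ((real k / real (k + m)) ^ ?e - 1)) \<longlonglongrightarrow> 0 * 1 ^ ?e + 0"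
    by (intro tendsto_add 2 3)
  moreover have "\<forall>\<^sub>F k in sequentially. ((W i (real k + real m) - W i (real k)) / real k ^ ?e) * (real k / real (k + m)) ^ ?e
      + w i k * ((real k / real (k + m)) ^ ?e - 1) = w i (k + m) - w i k"
    using eventually_gt_at_top[of 0]
    by eventually_elim (simp add: w_def power_divide field_simps)
  ultimately show ?thesis by (simp add: tendsto_cong)
qed

definition has_point :: "nat \<Rightarrow> bool" where
  "has_point k \<longleftrightarrow> (\<exists>x\<in>integer_points. adm (real k) x)"

text \<open>The condition minimised by \<open>face_index (d - 1)\<close>, phrased by the data of the
  locale; \<open>dilate_facets_iff\<close> provides the link.\<close>

definition hits_facets :: "nat \<Rightarrow> bool" where
  "hits_facets k \<longleftrightarrow> (\<forall>i\<in>I. \<exists>y\<in>integer_points. adm (real k) y \<and> a i \<bullet> y = real k * b i)"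

definition count :: "nat \<Rightarrow> real" where
  "count k = real (card (dilate k body \<inter> integer_points))"

lemma adm_add: "adm s x \<Longrightarrow> adm t y \<Longrightarrow> adm (s + t) (x + y)"
  using subspace_add[OF subV, of "s *\<^sub>R f0 - x" "t *\<^sub>R f0 - y"] by (simp add: adm_def algebra_simps)

lemma adm_diff: "adm s x \<Longrightarrow> adm t y \<Longrightarrow> adm (s - t) (x - y)"
  using subspace_diff[OF subV, of "s *\<^sub>R f0 - x" "t *\<^sub>R f0 - y"] by (simp add: adm_def algebra_simps)

lemma adm_scale: "adm s x \<Longrightarrow> adm (r * s) (r *\<^sub>R x)"
  using subspace_scale[OF subV, of "s *\<^sub>R f0 - x" r] by (simp add: adm_def algebra_simps)

lemma adm_same_diff: "adm s x \<Longrightarrow> adm s y \<Longrightarrow> x - y \<in> V"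
  using subspace_diff[OF subV, of "s *\<^sub>R f0 - y" "s *\<^sub>R f0 - x"] by (simp add: adm_def)

lemma has_point_add: "has_point k \<Longrightarrow> has_point l \<Longrightarrow> has_point (k + l)"
  unfolding has_point_def using adm_add integer_points_add by fastforce

text \<open>With \<open>has_point_add\<close> this makes \<open>has_point\<close> depend only on the
  residue modulo any \<open>l\<close> that satisfies it.\<close>

lemma has_point_cancel: "has_point (k + l) \<Longrightarrow> has_point l \<Longrightarrow> has_point k"
proof -
  assume "has_point (k + l)" "has_point l"
  then obtain x y where "x \<in> integer_points" "adm (real (k + l)) x" "y \<in> integer_points" "adm (real l) y"
    by (auto simp: has_point_def)
  then show ?thesis
    using adm_diff[of "real (k + l)" x "real l" y] by (auto simp: has_point_def integer_points_diff)
qed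

lemma has_point_mult: "has_point k \<Longrightarrow> has_point (m * k)"
proof -
  assume "has_point k"
  then obtain x where "x \<in> integer_points" "adm (real k) x" by (auto simp: has_point_def)
  then show ?thesis
    using adm_scale[of "real k" x "real m"] unfolding has_point_def
    by (intro bexI[of _ "real m *\<^sub>R x"]) (auto simp: integer_points_scale)
qed

lemma hits_facets_mult: "hits_facets k \<Longrightarrow> hits_facets (m * k)"
  unfolding hits_facets_def
proof
  fix i assume "i \<in> I" "\<forall>i\<in>I. \<exists>y\<in>integer_points. adm (real k) y \<and> a i \<bullet> y = real k * b i"
  then obtain y where "y \<in> integer_points" "adm (real k) y" "a i \<bullet> y = real k * b i" by blast
  then show "\<exists>y\<in>integer_points. adm (real (m * k)) y \<and> a i \<bullet> y = real (m * k) * b i"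
    using adm_scale[of "real k" y "real m"] by (intro bexI[of _ "real m *\<^sub>R y"]) (auto simp: integer_points_scale)
qed

lemma hits_facets_has_point: "I \<noteq> {} \<Longrightarrow> hits_facets k \<Longrightarrow> has_point k"
  by (auto simp: hits_facets_def has_point_def)

text \<open>Another base point changes \<open>\<theta>\<close> by integers, so any \<open>x\<close>
  will do. Conversely, an integral \<open>\<theta>\<close> is the multiple of a lattice vector of
  height 1 that carries \<open>x\<close> onto the hull of the facet.\<close>

lemma hits_facets_iff_Ints:
  assumes "x \<in> integer_points" "adm (real k) x"
  shows "hits_facets k \<longleftrightarrow> (\<forall>i\<in>I. \<theta> (real k) x i \<in> \<int>)"
proof
  assume h: "hits_facets k"
  show "\<forall>i\<in>I. \<theta> (real k) x i \<in> \<int>"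
  proof
    fix i assume i: "i \<in> I"
    then obtain y where y: "y \<in> integer_points" "adm (real k) y" "a i \<bullet> y = real k * b i"
      using h by (auto simp: hits_facets_def)
    have "a i \<bullet> (y - x) \<in> \<int>"
      using i y assms by (intro vals_Ints integer_points_diff adm_same_diff[of "real k"])
    then show "\<theta> (real k) x i \<in> \<int>" by (simp add: \<theta>_def inner_diff_right y(3))
  qed
next
  assume h: "\<forall>i\<in>I. \<theta> (real k) x i \<in> \<int>"
  show "hits_facets k" unfolding hits_facets_def
  proof
    fix i assume i: "i \<in> I"
    obtain u where u: "u \<in> integer_points" "u \<in> V" "a i \<bullet> u = 1" using unit_vector[OF i] .
    let ?t = "\<theta> (real k) x i"
    have "x + ?t *\<^sub>R u \<in> integer_points"
      using assms u h i by (intro integer_points_add integer_points_scale) auto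
    moreover have "adm (real k) (x + ?t *\<^sub>R u)"
      using subspace_diff[OF subV _ subspace_scale[OF subV u(2), of ?t], of "real k *\<^sub>R f0 - x"] assms(2)
      by (simp add: adm_def algebra_simps)
    moreover have "a i \<bullet> (x + ?t *\<^sub>R u) = real k * b i"
      using u(3) by (simp add: inner_add_right \<theta>_def)
    ultimately show "\<exists>y\<in>integer_points. adm (real k) y \<and> a i \<bullet> y = real k * b i" by blast
  qed
qed

lemma count_eq_0: "k > 0 \<Longrightarrow> \<not> has_point k \<Longrightarrow> count k = 0"
proof -
  assume "k > 0" "\<not> has_point k"
  then have "dilate k body \<inter> integer_points = {}"
    using dilate_integer_point_adm[of k] by (auto simp: has_point_def)
  then show ?thesis by (simp add: count_def)
qed

lemma count_shift:
  assumes "k > 0" "x \<in> integer_points" "adm (real k) x" "y \<in> integer_points" "adm (real q) y"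
  shows "count (k + q) = cnt (\<lambda>i. of_int \<lfloor>\<theta> (real k) x i + \<theta> (real q) y i\<rfloor>)"
proof -
  have "count (k + q) = cnt (\<theta> (real (k + q)) (x + y))"
    unfolding count_def using assms adm_add[of "real k" x "real q" y]
    by (intro card_dilate) (auto simp: integer_points_add)
  also have "\<theta> (real (k + q)) (x + y) = (\<lambda>i. \<theta> (real k) x i + \<theta> (real q) y i)"
    by (simp add: \<theta>_def inner_add_right algebra_simps fun_eq_iff)
  finally show ?thesis by (subst (asm) cnt_floor)
qed

text \<open>With \<open>x + y\<close> as base point for \<open>k + q\<close>, the right-hand sides
  change by \<open>\<theta> (real q) y\<close>, which does not involve \<open>k\<close>. The dilate
  by \<open>k + q\<close> is thus a bounded perturbation at scale \<open>k\<close>, and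
  \<open>cnt_change\<close> applies.\<close>

lemma count_increment:
  assumes y: "y \<in> integer_points" "adm (real q) y"
  shows "\<exists>C\<ge>0. \<forall>k>0. \<forall>x\<in>integer_points. adm (real k) x \<longrightarrow>
    real k * \<bar>count (k + q) - count k
      - (\<Sum>i\<in>I. of_int (\<lfloor>\<theta> (real k) x i + \<theta> (real q) y i\<rfloor> - \<lfloor>\<theta> (real k) x i\<rfloor>) * W i (real k))\<bar>
    \<le> C * real k ^ (d - 1)"
proof -
  define C0 where "C0 = 1 + (\<Sum>i\<in>I. \<bar>\<theta> (real q) y i\<bar>)"
  have C0: "1 + \<bar>\<theta> (real q) y i\<bar> \<le> C0" if "i \<in> I" for i
  proof -
    have "\<bar>\<theta> (real q) y i\<bar> \<le> (\<Sum>i\<in>I. \<bar>\<theta> (real q) y i\<bar>)" using that finI by (intro member_le_sum) auto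
    then show ?thesis by (simp add: C0_def)
  qed
  have C0': "C0 \<ge> 0" unfolding C0_def by (intro add_nonneg_nonneg sum_nonneg) auto
  obtain C where C: "C \<ge> 0 \<and> (\<forall>s\<ge>1. \<forall>x n n'. adm s x \<longrightarrow> (\<forall>i\<in>I. n i \<in> \<int> \<and> n' i \<in> \<int>
      \<and> \<bar>n i - \<theta> s x i\<bar> \<le> C0 \<and> \<bar>n' i - \<theta> s x i\<bar> \<le> C0) \<longrightarrow>
      s * \<bar>cnt n' - cnt n - (\<Sum>i\<in>I. (n' i - n i) * W i s)\<bar> \<le> C * s ^ (d - 1))"
    using cnt_change[OF C0'] ..
  have "real k * \<bar>count (k + q) - count k
      - (\<Sum>i\<in>I. of_int (\<lfloor>\<theta> (real k) x i + \<theta> (real q) y i\<rfloor> - \<lfloor>\<theta> (real k) x i\<rfloor>) * W i (real k))\<bar>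
    \<le> C * real k ^ (d - 1)" if k: "k > 0" and x: "x \<in> integer_points" "adm (real k) x" for k x
  proof -
    let ?n = "\<lambda>i. real_of_int \<lfloor>\<theta> (real k) x i\<rfloor>"
    let ?n' = "\<lambda>i. real_of_int \<lfloor>\<theta> (real k) x i + \<theta> (real q) y i\<rfloor>"
    have "\<bar>?n i - \<theta> (real k) x i\<bar> \<le> C0 \<and> \<bar>?n' i - \<theta> (real k) x i\<bar> \<le> C0" if "i \<in> I" for i
      using C0[OF that] by linarith
    then have "real k * \<bar>cnt ?n' - cnt ?n - (\<Sum>i\<in>I. (?n' i - ?n i) * W i (real k))\<bar> \<le> C * real k ^ (d - 1)"
      using k by (intro C[THEN conjunct2, rule_format, of "real k", OF _ x(2)]) auto
    moreover have "count k = cnt ?n"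
      unfolding count_def card_dilate[OF k x(2,1)] by (rule cnt_floor)
    ultimately show ?thesis using count_shift[OF k x y] by simp
  qed
  then show ?thesis using C by blast
qed

end

section \<open>Periods of the second coefficient\<close>

text \<open>The number \<open>T\<close> has two roles: it is a common period of all coefficients, so
  they are constant along \<open>r + T * j\<close>, and its multiples have integral right-hand sides
  at all facets.\<close>

locale ehrhart_facets = lattice_facets V I a b f0 f d
  for V :: "(real ^ 'n) set" and I :: "'i set" and a b f0 f d +
  fixes c :: "nat \<Rightarrow> int \<Rightarrow> complex" and T :: nat
  assumes I_ne: "I \<noteq> {}"
    and T_pos: "T > 0"
    and T_hits: "hits_facets T"
    and c_period: "\<And>i k. i \<le> d \<Longrightarrow> c i (k + int T) = c i k"
    and count_eq: "\<And>k. k > 0 \<Longrightarrow> of_real (count k) = (\<Sum>i\<le>d. c i (int k) * of_nat k ^ i)"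
begin

lemma d_Suc: "d = Suc (d - 1)"
  using d_pos by simp

lemma c_period_mult: "i \<le> d \<Longrightarrow> c i (k + int (T * m)) = c i k"
proof (induction m)
  case (Suc m)
  have "c i (k + int (T * Suc m)) = c i ((k + int (T * m)) + int T)" by (simp add: algebra_simps)
  then show ?case using c_period[OF Suc.prems, of "k + int (T * m)"] Suc by simp
qed simp

lemma T_has_point: "has_point T"
  using hits_facets_has_point[OF I_ne T_hits] .

abbreviation prog :: "nat \<Rightarrow> nat \<Rightarrow> nat" where
  "prog r j \<equiv> r + T * j"

lemma prog_add: "prog r j + q = prog (r + q) j"
  by simp

lemma filterlim_prog: "filterlim (prog r) at_top sequentially"
  by (rule filterlim_subseq) (use T_pos in \<open>auto simp: strict_mono_def\<close>)

lemma has_point_prog: "has_point (prog r j) \<longleftrightarrow> has_point r"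
  using has_point_add[of r "T * j"] has_point_cancel[of r "T * j"] has_point_mult[OF T_has_point, of j]
  by (auto simp: mult.commute)

lemma count_prog:
  assumes "r > 0"
  shows "of_real (count (prog r j)) = (\<Sum>i\<le>d. c i (int r) * of_nat (prog r j) ^ i)"
proof -
  have "of_real (count (prog r j)) = (\<Sum>i\<le>d. c i (int (prog r j)) * of_nat (prog r j) ^ i)"
    using assms by (intro count_eq) simp
  also have "\<dots> = (\<Sum>i\<le>d. c i (int r) * of_nat (prog r j) ^ i)"
  proof (rule sum.cong[OF refl])
    fix i assume "i \<in> {..d}"
    then show "c i (int (prog r j)) * of_nat (prog r j) ^ i = c i (int r) * of_nat (prog r j) ^ i"
      using c_period_mult[of i "int r" j] by simp
  qed
  finally show ?thesis .
qed

text \<open>The count vanishes along the whole progression of \<open>r\<close>, and the two limits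
  extract the top coefficients of a zero polynomial.\<close>

lemma coefficients_eq_0:
  assumes "r > 0" "\<not> has_point r"
  shows "c d (int r) = 0" "c (d - 1) (int r) = 0"
proof -
  let ?C = "\<lambda>i. c i (int r)"
  have 0: "(\<Sum>i\<le>d. ?C i * of_nat (prog r j) ^ i) = 0" for j
    using count_prog[OF assms(1), of j] count_eq_0[of "prog r j"] assms has_point_prog by simp
  have "(\<lambda>j. (\<Sum>i\<le>d. ?C i * of_nat (prog r j) ^ i) / of_nat (prog r j) ^ d) \<longlonglongrightarrow> c d (int r)"
    by (rule filterlim_compose[OF poly_leading_limit[of ?C d] filterlim_prog])
  then have "(\<lambda>j. 0) \<longlonglongrightarrow> c d (int r)" unfolding 0 by simp
  then show d: "c d (int r) = 0" by (simp add: LIMSEQ_const_iff)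
  have "(\<lambda>j. ((\<Sum>i\<le>d. ?C i * of_nat (prog r j) ^ i) - ?C d * of_nat (prog r j) ^ d) / of_nat (prog r j) ^ (d - 1))
      \<longlonglongrightarrow> c (d - 1) (int r)"
    using filterlim_compose[OF poly_second_limit[of ?C "d - 1"] filterlim_prog] d_Suc by simp
  then have "(\<lambda>j. 0) \<longlonglongrightarrow> c (d - 1) (int r)" unfolding 0 d by simp
  then show "c (d - 1) (int r) = 0" by (simp add: LIMSEQ_const_iff)
qed

lemma w_nonneg: "w i k \<ge> 0"
  using W_nonneg by (simp add: w_def)

definition base :: "nat \<Rightarrow> real ^ 'n" where
  "base k = (SOME x. x \<in> integer_points \<and> adm (real k) x)"

lemma base: "has_point k \<Longrightarrow> base k \<in> integer_points" "has_point k \<Longrightarrow> adm (real k) (base k)"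
  using someI_ex[of "\<lambda>x. x \<in> integer_points \<and> adm (real k) x"] by (auto simp: base_def has_point_def)

text \<open>The change in the integer right-hand side of facet \<open>i\<close> from
  \<open>k\<close> to \<open>k + q\<close>, with \<open>base k + y\<close> as base point of the
  latter.\<close>

definition inc :: "nat \<Rightarrow> real ^ 'n \<Rightarrow> nat \<Rightarrow> 'i \<Rightarrow> int" where
  "inc q y k i = \<lfloor>\<theta> (real k) (base k) i + \<theta> (real q) y i\<rfloor> - \<lfloor>\<theta> (real k) (base k) i\<rfloor>"

lemma increment_limit:
  assumes y: "y \<in> integer_points" "adm (real q) y" and r: "r > 0" "has_point r"
  shows "(\<lambda>j. (count (prog r j + q) - count (prog r j)) / real (prog r j) ^ (d - 1)
    - (\<Sum>i\<in>I. of_int (inc q y (prog r j) i) * w i (prog r j))) \<longlonglongrightarrow> 0"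
proof -
  obtain C where C: "C \<ge> 0 \<and> (\<forall>k>0. \<forall>x\<in>integer_points. adm (real k) x \<longrightarrow>
    real k * \<bar>count (k + q) - count k
      - (\<Sum>i\<in>I. of_int (\<lfloor>\<theta> (real k) x i + \<theta> (real q) y i\<rfloor> - \<lfloor>\<theta> (real k) x i\<rfloor>) * W i (real k))\<bar>
    \<le> C * real k ^ (d - 1))"
    using count_increment[OF y] ..
  have "(\<lambda>j. (count (prog r j + q) - count (prog r j)
      - (\<Sum>i\<in>I. of_int (inc q y (prog r j) i) * W i (real (prog r j)))) / real (prog r j) ^ (d - 1)) \<longlonglongrightarrow> 0"
  proof (rule tendsto_zero_of_bound[where Q = has_point and C = C and g = "prog r", OF _ filterlim_prog])
    fix k :: nat assume k: "k > 0" "has_point k"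
    show "real k * \<bar>count (k + q) - count k - (\<Sum>i\<in>I. of_int (inc q y k i) * W i (real k))\<bar> \<le> C * real k ^ (d - 1)"
      unfolding inc_def using k base[OF k(2)] by (intro C[THEN conjunct2, rule_format])
  qed (use r has_point_prog in auto)
  then show ?thesis by (simp only: diff_divide_distrib sum_divide_distrib w_def times_divide_eq_right)
qed

text \<open>Passing from \<open>k\<close> to \<open>k + q\<close> changes the count by boundedly
  many slices of \<open>O(k^(d-1))\<close> points each, which is invisible at order
  \<open>k^d\<close>.\<close>

lemma leading_coefficient_shift:
  assumes r: "r > 0" "has_point r" and q: "has_point q"
  shows "c d (int (r + q)) = c d (int r)"
proof -
  obtain y where y: "y \<in> integer_points" "adm (real q) y" using q by (auto simp: has_point_def)
  have bnd: "\<exists>B. \<forall>j. \<bar>of_int (inc q y (prog r j) i) * w i (prog r j)\<bar> \<le> B" if i: "i \<in> I" for i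
  proof -
    obtain C where C: "C \<ge> 0 \<and> (\<forall>k>0. w i k \<le> C)" using w_bounded[OF i] ..
    have "\<bar>of_int (inc q y (prog r j) i) * w i (prog r j)\<bar> \<le> (\<bar>\<theta> (real q) y i\<bar> + 1) * C" for j
      unfolding abs_mult
    proof (rule mult_mono)
      show "\<bar>real_of_int (inc q y (prog r j) i)\<bar> \<le> \<bar>\<theta> (real q) y i\<bar> + 1"
        unfolding inc_def by linarith
      show "\<bar>w i (prog r j)\<bar> \<le> C" using C r(1) w_nonneg[of i "prog r j"] by simp
    qed auto
    then show ?thesis by blast
  qed
  have n0: "(\<lambda>j. 1 / real (prog r j)) \<longlonglongrightarrow> 0"
    by (rule filterlim_compose[OF lim_1_over_n filterlim_prog])
  have "(\<lambda>j. of_int (inc q y (prog r j) i) * w i (prog r j) * (1 / real (prog r j))) \<longlonglongrightarrow> 0" if i: "i \<in> I" for i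
  proof -
    obtain B where B: "\<And>j. \<bar>of_int (inc q y (prog r j) i) * w i (prog r j)\<bar> \<le> B" using bnd[OF i] by blast
    show ?thesis
    proof (rule Lim_null_comparison)
      show "(\<lambda>j. B * (1 / real (prog r j))) \<longlonglongrightarrow> 0" using tendsto_mult_left[OF n0, of B] by simp
      show "\<forall>\<^sub>F j in sequentially. norm (of_int (inc q y (prog r j) i) * w i (prog r j) * (1 / real (prog r j)))
          \<le> B * (1 / real (prog r j))"
        using B by (intro always_eventually allI) (simp only: real_norm_def abs_mult, auto intro!: mult_right_mono divide_right_mono)
    qed
  qed
  then have 1: "(\<lambda>j. (\<Sum>i\<in>I. of_int (inc q y (prog r j) i) * w i (prog r j) * (1 / real (prog r j)))) \<longlonglongrightarrow> (\<Sum>i\<in>I. 0)"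
    by (intro tendsto_sum)
  have "(\<lambda>j. ((count (prog r j + q) - count (prog r j)) / real (prog r j) ^ (d - 1)
    - (\<Sum>i\<in>I. of_int (inc q y (prog r j) i) * w i (prog r j))) * (1 / real (prog r j))
    + (\<Sum>i\<in>I. of_int (inc q y (prog r j) i) * w i (prog r j) * (1 / real (prog r j)))) \<longlonglongrightarrow> 0 * 0 + (\<Sum>i\<in>I. 0)"
    by (intro tendsto_add tendsto_mult increment_limit y r n0 1)
  moreover have "((count (prog r j + q) - count (prog r j)) / real (prog r j) ^ (d - 1)
    - (\<Sum>i\<in>I. of_int (inc q y (prog r j) i) * w i (prog r j))) * (1 / real (prog r j))
    + (\<Sum>i\<in>I. of_int (inc q y (prog r j) i) * w i (prog r j) * (1 / real (prog r j)))
    = (count (prog r j + q) - count (prog r j)) / real (prog r j) ^ d" for j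
  proof -
    have "(A / x ^ (d - 1) - S) * (1 / x) + S * (1 / x) = A / x ^ d" for A S x :: real
      by (subst (2) d_Suc) (simp add: algebra_simps)
    then show ?thesis by (simp only: sum_distrib_right[symmetric])
  qed
  ultimately have "(\<lambda>j. (count (prog r j + q) - count (prog r j)) / real (prog r j) ^ d) \<longlonglongrightarrow> 0"
    by simp
  then have "(\<lambda>j. complex_of_real ((count (prog r j + q) - count (prog r j)) / real (prog r j) ^ d)) \<longlonglongrightarrow> of_real 0"
    by (rule tendsto_of_real)
  then have lim0: "(\<lambda>j. (of_real (count (prog (r + q) j)) - of_real (count (prog r j))) / of_nat (prog r j) ^ d :: complex) \<longlonglongrightarrow> 0"
    by (simp only: prog_add of_real_divide of_real_diff of_real_power of_real_of_nat_eq of_real_0)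
  let ?C = "\<lambda>i. c i (int r)" and ?C' = "\<lambda>i. c i (int (r + q))"
  let ?F = "\<lambda>C k. (\<Sum>i\<le>d. C i * of_nat k ^ i) :: complex"
  have a: "(\<lambda>k. ?F ?C k / of_nat k ^ d) \<longlonglongrightarrow> c d (int r)"
    by (rule poly_leading_limit)
  have "(\<lambda>k. ?F ?C' (k + q) / of_nat (k + q) ^ d) \<longlonglongrightarrow> c d (int (r + q))"
    using poly_leading_limit[of ?C' d] by (rule LIMSEQ_ignore_initial_segment)
  then have "(\<lambda>k. (?F ?C' (k + q) / of_nat (k + q) ^ d) * (of_nat (k + q) / of_nat k) ^ d - ?F ?C k / of_nat k ^ d)
      \<longlonglongrightarrow> c d (int (r + q)) * 1 ^ d - c d (int r)"
    by (intro tendsto_diff tendsto_mult tendsto_power tendsto_shift_ratio a)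
  from filterlim_compose[OF this filterlim_prog[of r]]
  have "(\<lambda>j. (?F ?C' (prog r j + q) / of_nat (prog r j + q) ^ d) * (of_nat (prog r j + q) / of_nat (prog r j)) ^ d
      - ?F ?C (prog r j) / of_nat (prog r j) ^ d) \<longlonglongrightarrow> c d (int (r + q)) * 1 ^ d - c d (int r)" .
  moreover have "(?F ?C' (prog r j + q) / of_nat (prog r j + q) ^ d) * (of_nat (prog r j + q) / of_nat (prog r j)) ^ d
      - ?F ?C (prog r j) / of_nat (prog r j) ^ d
      = (of_real (count (prog (r + q) j)) - of_real (count (prog r j))) / of_nat (prog r j) ^ d" for j
  proof -
    have 1: "A / x ^ d * (x / z) ^ d - B / z ^ d = (A - B) / z ^ d" if "x \<noteq> 0" for A B x z :: complex
      using that by (simp add: power_divide diff_divide_distrib)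
    have 2: "prog r j + q = prog (r + q) j" by simp
    have 3: "(of_nat (prog (r + q) j) :: complex) \<noteq> 0" using r(1) by (simp del: of_nat_add)
    show ?thesis
      unfolding 2 1[OF 3] using count_prog[of r j] count_prog[of "r + q" j] r(1) by simp
  qed
  ultimately have "(\<lambda>j. (of_real (count (prog (r + q) j)) - of_real (count (prog r j))) / of_nat (prog r j) ^ d :: complex)
      \<longlonglongrightarrow> c d (int (r + q)) * 1 ^ d - c d (int r)"
    by (simp only:)
  from LIMSEQ_unique[OF this lim0] show ?thesis by simp
qed

text \<open>The increment of the count is computed twice, from the facets and from the coefficients;
  the term with \<open>c d\<close> comes from expanding \<open>(k + q) ^ d\<close>. Constant
  \<open>inc\<close> along the progression gives the facet sum fixed coefficients.\<close>

lemma coefficient_shift_limit: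
  assumes y: "y \<in> integer_points" "adm (real q) y" and r: "r > 0" "has_point r"
    and const: "\<And>j i. i \<in> I \<Longrightarrow> inc q y (prog r j) i = \<beta> i"
  shows "(\<lambda>j. complex_of_real (\<Sum>i\<in>I. of_int (\<beta> i) * w i (prog r j)))
    \<longlonglongrightarrow> of_nat d * of_nat q * c d (int r) + c (d - 1) (int (r + q)) - c (d - 1) (int r)"
proof -
  have q: "has_point q" using y by (auto simp: has_point_def)
  let ?C = "\<lambda>i. c i (int r)" and ?C' = "\<lambda>i. c i (int (r + q))"
  let ?F = "\<lambda>C k. (\<Sum>i\<le>d. C i * of_nat k ^ i) :: complex"
  have "(\<lambda>k. (?F ?C' (k + q) - ?F ?C k) / of_nat k ^ (d - 1))
      \<longlonglongrightarrow> of_nat d * of_nat q * c d (int r) + c (d - 1) (int (r + q)) - c (d - 1) (int r)"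
    using poly_shift_limit[of ?C' "d - 1" ?C q] leading_coefficient_shift[OF r q] d_Suc by simp
  from filterlim_compose[OF this filterlim_prog[of r]]
  have 1: "(\<lambda>j. (?F ?C' (prog r j + q) - ?F ?C (prog r j)) / of_nat (prog r j) ^ (d - 1))
      \<longlonglongrightarrow> of_nat d * of_nat q * c d (int r) + c (d - 1) (int (r + q)) - c (d - 1) (int r)" .
  have 2: "?F ?C' (prog r j + q) = of_real (count (prog r j + q))" for j
    unfolding prog_add by (rule count_prog[symmetric]) (use r(1) in simp)
  have 3: "?F ?C (prog r j) = of_real (count (prog r j))" for j
    using count_prog[OF r(1), of j] by simp
  have "(\<Sum>i\<in>I. of_int (inc q y (prog r j) i) * w i (prog r j)) = (\<Sum>i\<in>I. of_int (\<beta> i) * w i (prog r j))" for j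
    using const by (intro sum.cong) auto
  then have "(\<lambda>j. complex_of_real ((count (prog r j + q) - count (prog r j)) / real (prog r j) ^ (d - 1)
    - (\<Sum>i\<in>I. of_int (\<beta> i) * w i (prog r j)))) \<longlonglongrightarrow> of_real 0"
    using increment_limit[OF y r] by (intro tendsto_of_real) simp
  from tendsto_diff[OF 1 this] show ?thesis
    unfolding 2 3 by (simp only: of_real_diff of_real_divide of_real_power of_real_of_nat_eq) simp
qed

text \<open>Covers both uses: a shift \<open>q\<close> that hits all facets, and starting points
  \<open>k\<close> that are multiples of \<open>T\<close>.\<close>

lemma inc_of_Ints:
  assumes "\<theta> (real q) y i \<in> \<int> \<or> \<theta> (real k) (base k) i \<in> \<int>"
  shows "inc q y k i = \<lfloor>\<theta> (real q) y i\<rfloor>"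
  using assms by (auto simp: inc_def elim!: Ints_cases)

text \<open>The facet sums \<open>S\<close> have coefficients depending on \<open>p\<close> alone,
  so \<open>w_shift\<close> equates the limits for \<open>r\<close> and \<open>r + p\<close>, and
  the leading terms cancel. Residue classes without integer points are separate: there both values
  are 0.\<close>

lemma hits_facets_imp_period:
  assumes p: "hits_facets p"
  shows "c (d - 1) (k + int p) = c (d - 1) k"
proof -
  let ?c = "c (d - 1)"
  have pp: "has_point p" using hits_facets_has_point[OF I_ne p] .
  note y = base[OF pp]
  have y_int: "\<theta> (real p) (base p) i \<in> \<int>" if "i \<in> I" for i
    using hits_facets_iff_Ints[OF y] p that by blast
  define S where "S = (\<lambda>k. \<Sum>i\<in>I. of_int \<lfloor>\<theta> (real p) (base p) i\<rfloor> * w i k)"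
  have lim: "(\<lambda>j. complex_of_real (S (prog r j)))
      \<longlonglongrightarrow> of_nat d * of_nat p * c d (int r) + ?c (int (r + p)) - ?c (int r)"
    if "r > 0" "has_point r" for r
    unfolding S_def by (rule coefficient_shift_limit[OF y that]) (rule inc_of_Ints, use y_int in blast)
  have S_shift: "(\<lambda>k. S (k + p) - S k) \<longlonglongrightarrow> 0"
  proof -
    have "(\<lambda>k. \<Sum>i\<in>I. of_int \<lfloor>\<theta> (real p) (base p) i\<rfloor> * (w i (k + p) - w i k)) \<longlonglongrightarrow> (\<Sum>i\<in>I. of_int \<lfloor>\<theta> (real p) (base p) i\<rfloor> * 0)"
      by (intro tendsto_intros w_shift)
    then show ?thesis by (simp add: S_def right_diff_distrib sum_subtractf)
  qed
  have step: "?c (int (r + p + p)) - ?c (int (r + p)) = ?c (int (r + p)) - ?c (int r)"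
    if r: "r > 0" "has_point r" for r
  proof -
    have rp: "r + p > 0" "has_point (r + p)" using r has_point_add[OF r(2) pp] by auto
    have "(\<lambda>j. complex_of_real (S (prog r j + p) - S (prog r j))) \<longlonglongrightarrow> of_real 0"
      by (rule tendsto_of_real[OF filterlim_compose[OF S_shift filterlim_prog]])
    moreover have "(\<lambda>j. complex_of_real (S (prog (r + p) j)) - complex_of_real (S (prog r j)))
        \<longlonglongrightarrow> (of_nat d * of_nat p * c d (int (r + p)) + ?c (int (r + p + p)) - ?c (int (r + p)))
          - (of_nat d * of_nat p * c d (int r) + ?c (int (r + p)) - ?c (int r))"
      by (rule tendsto_diff[OF lim[OF rp] lim[OF r]])
    moreover have "prog r j + p = prog (r + p) j" for j by simp
    ultimately have "(of_nat d * of_nat p * c d (int (r + p)) + ?c (int (r + p + p)) - ?c (int (r + p)))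
          - (of_nat d * of_nat p * c d (int r) + ?c (int (r + p)) - ?c (int r)) = 0"
      by (simp only: of_real_diff of_real_0 LIMSEQ_unique)
    then show ?thesis unfolding leading_coefficient_shift[OF r pp] by algebra
  qed
  \<comment> \<open>The values at \<open>r + m * p\<close> form an arithmetic progression, since
    consecutive differences agree by \<open>step\<close>.\<close>
  have arith: "?c (int (r + m * p)) = ?c (int r) + of_nat m * (?c (int (r + p)) - ?c (int r))
      \<and> ?c (int (r + m * p + p)) - ?c (int (r + m * p)) = ?c (int (r + p)) - ?c (int r)"
    if r: "r > 0" "has_point r" for r m
  proof (induction m)
    case (Suc m)
    have "has_point (r + m * p)" using has_point_add[OF r(2) has_point_mult[OF pp]] .
    then have "?c (int (r + m * p + p + p)) - ?c (int (r + m * p + p)) = ?c (int (r + m * p + p)) - ?c (int (r + m * p))"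
      using r(1) by (intro step) auto
    moreover have e: "r + Suc m * p = r + m * p + p" by simp
    ultimately show ?case unfolding e of_nat_Suc using Suc by (intro conjI) algebra+
  qed simp
  have pos: "?c (int (r + p)) = ?c (int r)" if r: "r > 0" for r
  proof (cases "has_point r")
    case True
    \<comment> \<open>After \<open>T\<close> steps of length \<open>p\<close> the progression is
      back at its first value, so its common difference is 0.\<close>
    have "?c (int (r + T * p)) = ?c (int r)" using c_period_mult[of "d - 1" "int r" p] by simp
    then have "of_nat T * (?c (int (r + p)) - ?c (int r)) = 0"
      using arith[OF r True, of T] by simp
    then show ?thesis using T_pos by simp
  next
    case False
    then have "\<not> has_point (r + p)" using has_point_cancel[OF _ pp] by blast
    then show ?thesis using coefficients_eq_0(2)[OF r False] coefficients_eq_0(2)[of "r + p"] r by simp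
  qed
  \<comment> \<open>The count formula concerns positive arguments, so \<open>k\<close> is moved to a
    positive \<open>r\<close> by a multiple of \<open>T\<close>.\<close>
  let ?m = "nat \<bar>k\<bar> + 1"
  have "1 * ?m \<le> T * ?m" using T_pos by (intro mult_right_mono) auto
  then have "int ?m \<le> int (T * ?m)" unfolding of_nat_le_iff by simp
  moreover have "\<bar>k\<bar> < int ?m" by simp
  ultimately have "k + int (T * ?m) > 0" by linarith
  then obtain r where r: "r > 0" "k + int (T * ?m) = int r"
    using pos_int_cases by metis
  have "k + int p + int (T * ?m) = int (r + p)" unfolding of_nat_add[of r] using r(2) by linarith
  then have "?c (k + int p) = ?c (int (r + p))"
    using c_period_mult[of "d - 1" "k + int p" ?m, OF diff_le_self] by (simp only:)
  also have "\<dots> = ?c (int r)" using pos r(1) by blast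
  also have "\<dots> = ?c k" using c_period_mult[of "d - 1" k ?m, unfolded r(2)] by simp
  finally show ?thesis .
qed

lemma T_theta_Ints: "i \<in> I \<Longrightarrow> \<theta> (real (T * j)) (base (T * j)) i \<in> \<int>"
  using hits_facets_mult[OF T_hits, of j] has_point_mult[OF T_has_point, of j]
    hits_facets_iff_Ints[of "base (T * j)" "T * j"] base[of "T * j"]
  by (simp add: mult.commute)

text \<open>By \<open>cnt_double\<close>, \<open>2 * L(2 * k) - 2 * \<kappa> * L(k)\<close> equals
  minus a facet sum up to \<open>o(k^(d-1))\<close>. If the coefficient were 0, the left side would
  be \<open>o(k^(d-1))\<close>, whereas the facet sum is at least a positive multiple of
  \<open>k^(d-1)\<close>.\<close>

lemma second_coefficient_nonzero: "c (d - 1) (int T) \<noteq> 0"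
proof -
  let ?C = "\<lambda>i. c i (int T)"
  let ?F = "\<lambda>k. (\<Sum>i\<le>d. ?C i * of_nat k ^ i) :: complex"
  obtain C \<kappa> u where Cu: "C \<ge> 0" "\<forall>i\<in>I. u i \<ge> 1" "\<forall>s\<ge>1. \<forall>x. adm s x \<longrightarrow> (\<forall>i\<in>I. \<theta> s x i \<in> \<int>) \<longrightarrow>
     s * \<bar>2 * cnt (\<lambda>i. 2 * \<theta> s x i) - 2 * real \<kappa> * cnt (\<theta> s x) + (\<Sum>i\<in>I. u i * W i s)\<bar> \<le> C * s ^ (d - 1)"
    using cnt_double by blast
  have fl: "filterlim (\<lambda>j. prog T j) at_top sequentially" by (rule filterlim_prog)
  have Fc: "?F (prog T j) = of_real (count (prog T j))" for j using count_prog[OF T_pos, of j] by simp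
  \<comment> \<open>Since \<open>2 * prog T j = prog T (2 * j + 1)\<close>, doubling stays in the
    residue class and one polynomial describes both counts.\<close>
  have Fc2: "?F (2 * prog T j) = of_real (count (2 * prog T j))" for j
    using count_prog[OF T_pos, of "2 * j + 1"] by (simp add: algebra_simps)
  have "(\<lambda>j. (2 * count (2 * prog T j) - 2 * real \<kappa> * count (prog T j) + (\<Sum>i\<in>I. u i * W i (real (prog T j))))
      / real (prog T j) ^ (d - 1)) \<longlonglongrightarrow> 0"
  proof (rule tendsto_zero_of_bound[where Q = "\<lambda>k. T dvd k" and C = C and g = "prog T", OF _ filterlim_prog])
    fix k :: nat assume k: "k > 0" "T dvd k"
    then obtain j where j: "k = T * j" by blast
    have kp: "has_point k" using has_point_mult[OF T_has_point, of j] by (simp add: j mult.commute)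
    note b = base[OF kp]
    have "count k = cnt (\<theta> (real k) (base k))" unfolding count_def using k b by (intro card_dilate)
    moreover have "count (2 * k) = cnt (\<lambda>i. 2 * \<theta> (real k) (base k) i)"
    proof -
      have "adm (real (2 * k)) (2 *\<^sub>R base k)" using adm_scale[OF b(2), of 2] by simp
      then have "count (2 * k) = cnt (\<theta> (real (2 * k)) (2 *\<^sub>R base k))"
        unfolding count_def using k b by (intro card_dilate integer_points_scale) auto
      also have "\<theta> (real (2 * k)) (2 *\<^sub>R base k) = (\<lambda>i. 2 * \<theta> (real k) (base k) i)"
        by (simp add: \<theta>_def fun_eq_iff algebra_simps)
      finally show ?thesis .
    qed
    moreover have "\<forall>i\<in>I. \<theta> (real k) (base k) i \<in> \<int>" using T_theta_Ints[of _ j] by (simp add: j)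
    ultimately show "real k * \<bar>2 * count (2 * k) - 2 * real \<kappa> * count k + (\<Sum>i\<in>I. u i * W i (real k))\<bar> \<le> C * real k ^ (d - 1)"
      using Cu(3) k b by simp
  qed simp
  then have lim: "(\<lambda>j. (2 * count (2 * prog T j) - 2 * real \<kappa> * count (prog T j)) / real (prog T j) ^ (d - 1)
      + (\<Sum>i\<in>I. u i * w i (prog T j))) \<longlonglongrightarrow> 0"
    by (simp only: add_divide_distrib sum_divide_distrib w_def times_divide_eq_right)
  let ?A = "\<lambda>j. (2 * count (2 * prog T j) - 2 * real \<kappa> * count (prog T j)) / real (prog T j) ^ (d - 1)"
  let ?U = "\<lambda>j. \<Sum>i\<in>I. u i * w i (prog T j)"
  \<comment> \<open>The coefficients of \<open>2 * L(2 * k) - 2 * \<kappa> * L(k)\<close> on the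
    residue class of \<open>T\<close>.\<close>
  define D where "D = (\<lambda>i. (2 * 2 ^ i - 2 * of_nat \<kappa>) * ?C i)"
  have D: "complex_of_real (2 * count (2 * prog T j) - 2 * real \<kappa> * count (prog T j))
      = (\<Sum>i\<le>d. D i * of_nat (prog T j) ^ i)" for j
  proof -
    have "complex_of_real (2 * count (2 * prog T j) - 2 * real \<kappa> * count (prog T j))
        = 2 * ?F (2 * prog T j) - 2 * of_nat \<kappa> * ?F (prog T j)"
      unfolding Fc Fc2 by simp
    also have "\<dots> = (\<Sum>i\<le>d. D i * of_nat (prog T j) ^ i)"
      unfolding sum_distrib_left sum_subtractf[symmetric] of_nat_mult[of 2]
      by (intro sum.cong refl) (simp only: D_def power_mult_distrib of_nat_numeral, simp add: algebra_simps)
    finally show ?thesis .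
  qed
  have n0: "(\<lambda>j. 1 / real (prog T j)) \<longlonglongrightarrow> 0"
    by (rule filterlim_compose[OF lim_1_over_n filterlim_prog])
  have "(\<lambda>j. u i * (w i (prog T j) * (1 / real (prog T j)))) \<longlonglongrightarrow> u i * 0" if i: "i \<in> I" for i
  proof (intro tendsto_mult tendsto_const)
    obtain B where B: "B \<ge> 0 \<and> (\<forall>k>0. w i k \<le> B)" using w_bounded[OF i] ..
    show "(\<lambda>j. w i (prog T j) * (1 / real (prog T j))) \<longlonglongrightarrow> 0"
    proof (rule Lim_null_comparison)
      show "(\<lambda>j. B * (1 / real (prog T j))) \<longlonglongrightarrow> 0" using tendsto_mult_left[OF n0, of B] by simp
      have "norm (w i (prog T j) * (1 / real (prog T j))) \<le> B * (1 / real (prog T j))" for j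
      proof -
        have "\<bar>w i (prog T j)\<bar> \<le> B" using B T_pos w_nonneg[of i "prog T j"] by simp
        then show ?thesis unfolding real_norm_def abs_mult by (intro mult_mono) auto
      qed
      then show "\<forall>\<^sub>F j in sequentially. norm (w i (prog T j) * (1 / real (prog T j))) \<le> B * (1 / real (prog T j))"
        by (intro always_eventually allI)
    qed
  qed
  then have "(\<lambda>j. \<Sum>i\<in>I. u i * (w i (prog T j) * (1 / real (prog T j)))) \<longlonglongrightarrow> (\<Sum>i\<in>I. u i * 0)"
    by (intro tendsto_sum)
  then have U0: "(\<lambda>j. ?U j * (1 / real (prog T j))) \<longlonglongrightarrow> 0"
    by (simp only: sum_distrib_right mult.assoc) simp
  have "(\<lambda>j. (?A j + ?U j) * (1 / real (prog T j)) - ?U j * (1 / real (prog T j))) \<longlonglongrightarrow> 0 * 0 - 0"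
    by (intro tendsto_diff tendsto_mult lim n0 U0)
  moreover have "(?A j + ?U j) * (1 / real (prog T j)) - ?U j * (1 / real (prog T j))
      = (2 * count (2 * prog T j) - 2 * real \<kappa> * count (prog T j)) / real (prog T j) ^ d" for j
  proof -
    have "(X / x ^ (d - 1) + S) * (1 / x) - S * (1 / x) = X / x ^ d" for X S x :: real
      by (subst (2) d_Suc) (simp add: algebra_simps)
    then show ?thesis .
  qed
  ultimately have "(\<lambda>j. (2 * count (2 * prog T j) - 2 * real \<kappa> * count (prog T j)) / real (prog T j) ^ d) \<longlonglongrightarrow> 0"
    by (simp only: mult_zero_left diff_0_right)
  then have "(\<lambda>j. complex_of_real ((2 * count (2 * prog T j) - 2 * real \<kappa> * count (prog T j)) / real (prog T j) ^ d)) \<longlonglongrightarrow> of_real 0"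
    by (rule tendsto_of_real)
  then have "(\<lambda>j. (\<Sum>i\<le>d. D i * of_nat (prog T j) ^ i) / of_nat (prog T j) ^ d) \<longlonglongrightarrow> 0"
    by (simp only: of_real_divide D of_real_power of_real_of_nat_eq of_real_0)
  moreover have "(\<lambda>j. (\<Sum>i\<le>d. D i * of_nat (prog T j) ^ i) / of_nat (prog T j) ^ d) \<longlonglongrightarrow> D d"
    by (rule filterlim_compose[OF poly_leading_limit filterlim_prog])
  ultimately have Dd: "D d = 0" by (rule LIMSEQ_unique[symmetric])
  \<comment> \<open>By \<open>cnt_lower\<close> the count grows at least like a positive multiple of
    \<open>k^d\<close>.\<close>
  have lead: "?C d \<noteq> 0"
  proof
    assume "?C d = 0"
    then have "(\<lambda>j. ?F (prog T j) / of_nat (prog T j) ^ d) \<longlonglongrightarrow> 0"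
      using filterlim_compose[OF poly_leading_limit[of ?C d] filterlim_prog[of T]] by simp
    then have "(\<lambda>j. complex_of_real (count (prog T j) / real (prog T j) ^ d)) \<longlonglongrightarrow> of_real 0"
      unfolding Fc by (simp only: of_real_divide of_real_power of_real_of_nat_eq of_real_0)
    then have 0: "(\<lambda>j. count (prog T j) / real (prog T j) ^ d) \<longlonglongrightarrow> 0"
      unfolding tendsto_of_real_iff .
    obtain c0 s0 where c0: "c0 > 0" "s0 \<ge> 1" "\<forall>s\<ge>s0. \<forall>x. adm s x \<longrightarrow> c0 * s ^ d \<le> cnt (\<theta> s x)"
      using cnt_lower by blast
    have "c0 \<le> count (prog T j) / real (prog T j) ^ d" if j: "j \<ge> nat \<lceil>s0\<rceil>" for j
    proof -
      have "1 * j \<le> T * j" using T_pos by (intro mult_right_mono) auto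
      then have "real j \<le> real (prog T j)" unfolding of_nat_le_iff by linarith
      moreover have "s0 \<le> real j" using j by linarith
      ultimately have s: "s0 \<le> real (prog T j)" by linarith
      have k: "prog T j > 0" "has_point (prog T j)" using T_pos T_has_point has_point_prog by auto
      have "count (prog T j) = cnt (\<theta> (real (prog T j)) (base (prog T j)))"
        unfolding count_def using k(1) base[OF k(2)] by (intro card_dilate)
      then have "c0 * real (prog T j) ^ d \<le> count (prog T j)" using c0(3) s base(2)[OF k(2)] by simp
      then show ?thesis using k(1) by (simp add: pos_le_divide_eq del: of_nat_add of_nat_mult)
    qed
    then have "c0 \<le> 0" using LIMSEQ_le_const[OF 0] by blast
    then show False using c0(1) by simp
  qed
  \<comment> \<open>So \<open>\<kappa> = 2 ^ d\<close>, read off from the growth rate. At order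
    \<open>d - 1\<close> this leaves the factor
    \<open>2 ^ d - 2 * 2 ^ d = - (2 ^ d)\<close>.\<close>
  have "2 * 2 ^ d - 2 * of_nat \<kappa> = (0 :: complex)" using Dd lead by (simp add: D_def)
  then have De: "D (d - 1) = - (2 ^ d * ?C (d - 1))"
    unfolding D_def by (subst (asm) (1) d_Suc, subst (3) d_Suc) (simp add: algebra_simps)
  show ?thesis
  proof
    assume "?C (d - 1) = 0"
    then have "D (d - 1) = 0" using De by simp
    then have "(\<lambda>j. (\<Sum>i\<le>d. D i * of_nat (prog T j) ^ i) / of_nat (prog T j) ^ (d - 1)) \<longlonglongrightarrow> 0"
      using filterlim_compose[OF poly_second_limit[of D "d - 1"] filterlim_prog[of T]] d_Suc Dd by simp
    then have "(\<lambda>j. complex_of_real (?A j)) \<longlonglongrightarrow> of_real 0"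
      by (simp only: of_real_divide D of_real_power of_real_of_nat_eq of_real_0)
    then have "?A \<longlonglongrightarrow> 0" unfolding tendsto_of_real_iff .
    from tendsto_diff[OF lim this] have U: "?U \<longlonglongrightarrow> 0" by simp
    obtain i where i: "i \<in> I" using I_ne by blast
    obtain c0 where c0: "c0 > 0 \<and> (\<forall>k>0. c0 \<le> w i k)" using w_lower[OF i] ..
    have "c0 \<le> ?U j" for j
    proof -
      have "c0 \<le> 1 * w i (prog T j)" using c0 T_pos by simp
      also have "\<dots> \<le> u i * w i (prog T j)" using Cu(2) i w_nonneg by (intro mult_right_mono) auto
      also have "\<dots> \<le> ?U j"
      proof (rule member_le_sum[of i I "\<lambda>i. u i * w i (prog T j)", OF i _ finI])
        fix i' assume "i' \<in> I - {i}"
        then have "u i' \<ge> 1" using Cu(2) by blast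
        then show "0 \<le> u i' * w i' (prog T j)" using w_nonneg by (intro mult_nonneg_nonneg) auto
      qed
      finally show ?thesis .
    qed
    then have "c0 \<le> 0" using LIMSEQ_le_const[OF U] by blast
    then show False using c0 by simp
  qed
qed

text \<open>The shifts by \<open>q\<close> and by \<open>q * T\<close> both leave the coefficient
  unchanged, so their limits are in the ratio \<open>T\<close>. Their facet sums have the
  coefficients \<open>\<lfloor>\<beta> i\<rfloor>\<close> and \<open>real T * \<beta> i\<close>.
  Subtraction leaves a nonnegative combination of the \<open>w i\<close> that tends to 0, and the
  lower bound for \<open>w i\<close> makes every fractional part vanish.\<close>

lemma period_imp_hits_facets:
  assumes q: "\<And>k. c (d - 1) (k + int q) = c (d - 1) k"
  shows "hits_facets q"
proof -
  let ?c = "c (d - 1)"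
  \<comment> \<open>On a residue class without integer points this value would be 0 by
    \<open>coefficients_eq_0\<close>.\<close>
  have "?c (int (T + q)) \<noteq> 0" using q[of "int T"] second_coefficient_nonzero by simp
  then have "has_point (T + q)" using coefficients_eq_0(2)[of "T + q"] T_pos by auto
  then have qp: "has_point q" using has_point_cancel[of q T] T_has_point by (simp add: add.commute)
  note y = base[OF qp]
  define \<beta> where "\<beta> = (\<lambda>i. \<theta> (real q) (base q) i)"
  have Tj: "prog T j = T * (j + 1)" for j by simp
  have "(\<lambda>j. complex_of_real (\<Sum>i\<in>I. of_int \<lfloor>\<beta> i\<rfloor> * w i (prog T j)))
      \<longlonglongrightarrow> of_nat d * of_nat q * c d (int T) + ?c (int (T + q)) - ?c (int T)"
    unfolding \<beta>_def
  proof (rule coefficient_shift_limit[OF y T_pos T_has_point])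
    fix i j assume "i \<in> I"
    then show "inc q (base q) (prog T j) i = \<lfloor>\<theta> (real q) (base q) i\<rfloor>"
      using T_theta_Ints[of i "j + 1"] unfolding Tj by (intro inc_of_Ints) auto
  qed
  then have 1: "(\<lambda>j. complex_of_real (\<Sum>i\<in>I. of_int \<lfloor>\<beta> i\<rfloor> * w i (prog T j)))
      \<longlonglongrightarrow> of_nat d * of_nat q * c d (int T)"
    using q[of "int T"] by simp
  \<comment> \<open>\<open>T\<close> copies of the shift by \<open>q\<close>; the resulting
    right-hand sides \<open>real T * \<beta> i\<close> are integers because \<open>q * T\<close>
    hits all facets.\<close>
  let ?y = "real T *\<^sub>R base q"
  have y': "?y \<in> integer_points" "adm (real (q * T)) ?y"
    using y adm_scale[OF y(2), of "real T"] by (auto simp: integer_points_scale mult.commute)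
  have \<theta>': "\<theta> (real (q * T)) ?y i = real T * \<beta> i" for i by (simp add: \<beta>_def \<theta>_def algebra_simps)
  have int: "real T * \<beta> i \<in> \<int>" if "i \<in> I" for i
    using hits_facets_iff_Ints[OF y'] hits_facets_mult[OF T_hits, of q] that unfolding \<theta>' by blast
  have "(\<lambda>j. complex_of_real (\<Sum>i\<in>I. of_int \<lfloor>real T * \<beta> i\<rfloor> * w i (prog T j)))
      \<longlonglongrightarrow> of_nat d * of_nat (q * T) * c d (int T) + ?c (int (T + q * T)) - ?c (int T)"
  proof (rule coefficient_shift_limit[OF y' T_pos T_has_point])
    fix i j assume "i \<in> I"
    then show "inc (q * T) ?y (prog T j) i = \<lfloor>real T * \<beta> i\<rfloor>"
      unfolding \<theta>'[symmetric] by (intro inc_of_Ints) (simp only: \<theta>' int simp_thms)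
  qed
  moreover have "?c (int (T + q * T)) = ?c (int T)"
    using c_period_mult[of "d - 1" "int T" q] by (simp add: mult.commute)
  ultimately have 2: "(\<lambda>j. complex_of_real (\<Sum>i\<in>I. of_int \<lfloor>real T * \<beta> i\<rfloor> * w i (prog T j)))
      \<longlonglongrightarrow> of_nat T * (of_nat d * of_nat q * c d (int T))"
    by (simp add: mult_ac)
  \<comment> \<open>\<open>T\<close> times the fractional part of \<open>\<beta> i\<close>: the loss
    caused by rounding before the multiplication instead of after it.\<close>
  define \<delta> where "\<delta> = (\<lambda>i. real T * (\<beta> i - of_int \<lfloor>\<beta> i\<rfloor>))"
  have \<delta>0: "\<delta> i \<ge> 0" for i by (simp add: \<delta>_def)
  have "(\<lambda>j. complex_of_real (\<Sum>i\<in>I. of_int \<lfloor>real T * \<beta> i\<rfloor> * w i (prog T j))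
      - of_nat T * complex_of_real (\<Sum>i\<in>I. of_int \<lfloor>\<beta> i\<rfloor> * w i (prog T j)))
      \<longlonglongrightarrow> of_nat T * (of_nat d * of_nat q * c d (int T)) - of_nat T * (of_nat d * of_nat q * c d (int T))"
    by (intro tendsto_diff tendsto_mult tendsto_const 1 2)
  moreover have "complex_of_real (\<Sum>i\<in>I. of_int \<lfloor>real T * \<beta> i\<rfloor> * w i (prog T j))
      - of_nat T * complex_of_real (\<Sum>i\<in>I. of_int \<lfloor>\<beta> i\<rfloor> * w i (prog T j))
      = complex_of_real (\<Sum>i\<in>I. \<delta> i * w i (prog T j))" for j
  proof -
    have "(\<Sum>i\<in>I. of_int \<lfloor>real T * \<beta> i\<rfloor> * w i (prog T j)) - real T * (\<Sum>i\<in>I. of_int \<lfloor>\<beta> i\<rfloor> * w i (prog T j))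
        = (\<Sum>i\<in>I. \<delta> i * w i (prog T j))"
      unfolding sum_distrib_left sum_subtractf[symmetric]
    proof (rule sum.cong[OF refl])
      fix i assume "i \<in> I"
      then have "real_of_int \<lfloor>real T * \<beta> i\<rfloor> = real T * \<beta> i" using int[of i] by (auto elim!: Ints_cases)
      then show "of_int \<lfloor>real T * \<beta> i\<rfloor> * w i (prog T j) - real T * (of_int \<lfloor>\<beta> i\<rfloor> * w i (prog T j))
          = \<delta> i * w i (prog T j)" by (simp add: \<delta>_def algebra_simps)
    qed
    from arg_cong[OF this, of complex_of_real] show ?thesis
      by (simp only: of_real_diff of_real_mult of_real_of_nat_eq)
  qed
  ultimately have "(\<lambda>j. complex_of_real (\<Sum>i\<in>I. \<delta> i * w i (prog T j))) \<longlonglongrightarrow> of_real 0" by simp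
  then have lim: "(\<lambda>j. \<Sum>i\<in>I. \<delta> i * w i (prog T j)) \<longlonglongrightarrow> 0" unfolding tendsto_of_real_iff .
  have "\<beta> i \<in> \<int>" if i: "i \<in> I" for i
  proof -
    obtain c0 where c0: "c0 > 0 \<and> (\<forall>k>0. c0 \<le> w i k)" using w_lower[OF i] ..
    have "\<delta> i * c0 \<le> (\<Sum>i\<in>I. \<delta> i * w i (prog T j))" for j
    proof -
      have "\<delta> i * c0 \<le> \<delta> i * w i (prog T j)" using c0 T_pos \<delta>0 by (intro mult_left_mono) auto
      also have "\<dots> \<le> (\<Sum>i\<in>I. \<delta> i * w i (prog T j))"
        using i finI \<delta>0 w_nonneg by (intro member_le_sum) auto
      finally show ?thesis .
    qed
    then have "\<delta> i * c0 \<le> 0" using LIMSEQ_le_const[OF lim] by blast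
    then have "\<delta> i \<le> 0" using c0 by (simp add: mult_le_0_iff)
    then have "\<beta> i \<le> of_int \<lfloor>\<beta> i\<rfloor>" using T_pos by (simp add: \<delta>_def mult_le_0_iff)
    then have "\<beta> i = of_int \<lfloor>\<beta> i\<rfloor>" using of_int_floor_le[of "\<beta> i"] by (rule order_antisym)
    then show ?thesis by (metis Ints_of_int)
  qed
  then show ?thesis using hits_facets_iff_Ints[OF y] unfolding \<beta>_def by blast
qed

end

section \<open>Facet systems of rational polytopes\<close>

text \<open>The point \<open>p\<close> is relatively interior to the facet, so a short step from
  \<open>p\<close> in any direction of the hyperplane section stays in the facet, and the line
  through both points reaches every \<open>x\<close> of the section.\<close>

lemma affine_hull_facet:
  fixes V :: "(real ^ 'n) set" and a :: "'i \<Rightarrow> real ^ 'n"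
  assumes I: "finite I" "h \<in> I" and V: "subspace V"
    and P: "P = {x. x - f0 \<in> V \<and> (\<forall>i\<in>I. a i \<bullet> x \<le> b i)}"
    and p: "p - f0 \<in> V" "a h \<bullet> p = b h" "\<And>g. g \<in> I \<Longrightarrow> g \<noteq> h \<Longrightarrow> a g \<bullet> p < b g"
  shows "affine hull (P \<inter> {x. a h \<bullet> x = b h}) = {x. x - f0 \<in> V \<and> a h \<bullet> x = b h}"
proof
  have "affine {x. x - f0 \<in> V \<and> a h \<bullet> x = b h}"
    unfolding affine_def
  proof (intro ballI allI impI)
    fix x y :: "real ^ 'n" and u v :: real
    assume xy: "x \<in> {x. x - f0 \<in> V \<and> a h \<bullet> x = b h}" "y \<in> {x. x - f0 \<in> V \<and> a h \<bullet> x = b h}"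
      and uv: "u + v = 1"
    have "u *\<^sub>R f0 + v *\<^sub>R f0 = f0" using uv by (metis scaleR_left_distrib scaleR_one)
    then have "u *\<^sub>R x + v *\<^sub>R y - f0 = u *\<^sub>R (x - f0) + v *\<^sub>R (y - f0)" by (simp add: algebra_simps)
    moreover have "u *\<^sub>R (x - f0) + v *\<^sub>R (y - f0) \<in> V"
      using xy V by (intro subspace_add subspace_scale) auto
    moreover have "u * b h + v * b h = b h" using uv by (metis distrib_right mult_1)
    ultimately show "u *\<^sub>R x + v *\<^sub>R y \<in> {x. x - f0 \<in> V \<and> a h \<bullet> x = b h}"
      using xy by (simp add: inner_add_right)
  qed
  then show "affine hull (P \<inter> {x. a h \<bullet> x = b h}) \<subseteq> {x. x - f0 \<in> V \<and> a h \<bullet> x = b h}"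
    by (intro hull_minimal) (auto simp: P)
  show "{x. x - f0 \<in> V \<and> a h \<bullet> x = b h} \<subseteq> affine hull (P \<inter> {x. a h \<bullet> x = b h})"
  proof
    fix x assume x: "x \<in> {x. x - f0 \<in> V \<and> a h \<bullet> x = b h}"
    define v where "v = x - p"
    have v: "v \<in> V" "a h \<bullet> v = 0"
      using x p subspace_diff[OF V, of "x - f0" "p - f0"] by (auto simp: v_def inner_diff_right)
    \<comment> \<open>Large enough that a step of \<open>1 / e\<close> along \<open>v\<close> does
      not use up the slack of \<open>p\<close> in any other constraint.\<close>
    define e where "e = 1 + (\<Sum>g\<in>I - {h}. \<bar>a g \<bullet> v\<bar> / (b g - a g \<bullet> p))"
    have e: "e > 0" unfolding e_def
      using p(3) by (intro add_pos_nonneg sum_nonneg) (auto simp: less_imp_le)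
    have "a g \<bullet> (p + (1 / e) *\<^sub>R v) \<le> b g" if g: "g \<in> I" for g
    proof (cases "g = h")
      case False
      have "\<bar>a g \<bullet> v\<bar> / (b g - a g \<bullet> p) \<le> (\<Sum>g\<in>I - {h}. \<bar>a g \<bullet> v\<bar> / (b g - a g \<bullet> p))"
        using g False I p(3) by (intro member_le_sum) (auto simp: less_imp_le)
      then have "\<bar>a g \<bullet> v\<bar> / (b g - a g \<bullet> p) \<le> e" unfolding e_def by linarith
      then have "a g \<bullet> v \<le> e * (b g - a g \<bullet> p)" using p(3)[OF g False] by (simp add: field_simps)
      then show ?thesis using e by (simp add: inner_add_right field_simps)
    qed (use v p in \<open>simp add: inner_add_right\<close>)
    moreover have "p + (1 / e) *\<^sub>R v - f0 \<in> V"
      using subspace_add[OF V p(1) subspace_scale[OF V v(1), of "1 / e"]] by (simp add: algebra_simps)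
    ultimately have "p + (1 / e) *\<^sub>R v \<in> P \<inter> {x. a h \<bullet> x = b h}"
      using p v by (auto simp: P inner_add_right)
    moreover have "p \<in> P \<inter> {x. a h \<bullet> x = b h}" using p by (auto simp: P) (metis less_imp_le order_refl)
    ultimately have "(1 - e) *\<^sub>R p + e *\<^sub>R (p + (1 / e) *\<^sub>R v) \<in> affine hull (P \<inter> {x. a h \<bullet> x = b h})"
      by (intro mem_affine affine_affine_hull hull_inc) auto
    also have "(1 - e) *\<^sub>R p + e *\<^sub>R (p + (1 / e) *\<^sub>R v) = x"
      using e by (simp add: v_def algebra_simps)
    finally show "x \<in> affine hull (P \<inter> {x. a h \<bullet> x = b h})" .
  qed
qed

lemma affine_hull_direction:
  fixes S :: "(real ^ 'n) set"
  assumes "w \<in> S"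
  shows "x \<in> affine hull S \<longleftrightarrow> x - w \<in> span ((\<lambda>x. x - w) ` S)"
proof -
  have "affine hull S = (\<lambda>x. w + x) ` span ((\<lambda>x. - w + x) ` S)"
    by (rule affine_hull_span_gen) (rule hull_inc[OF assms])
  also have "(\<lambda>x. - w + x) = (\<lambda>x. x - w)" by auto
  finally show ?thesis by (auto intro: image_eqI[of _ _ "x - w"])
qed

lemma integral_direction_space:
  fixes S :: "(real ^ 'n) set"
  assumes "w \<in> S" "\<And>v i. v \<in> S \<Longrightarrow> v $ i \<in> \<rat>" "aff_dim S = int m"
  shows "integral_subspace (span ((\<lambda>x. x - w) ` S)) m"
proof -
  have "int (dim ((\<lambda>x. x - w) ` S)) = int m"
    using aff_dim_eq_dim_subtract[of w S] hull_inc[OF assms(1)] assms(3) by simp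
  moreover have "integral_subspace (span ((\<lambda>x. x - w) ` S)) (dim ((\<lambda>x. x - w) ` S))"
    by (rule integral_subspace_span) (use assms(1,2) in \<open>auto intro: Rats_diff\<close>)
  ultimately show ?thesis by simp
qed

text \<open>The half-space description supplies real normals that may be irrational. Rationality is
  recovered from the generators: their differences span \<open>V\<close>, those lying on a facet
  span its directions, and then the normals are rescaled.\<close>

lemma rational_polytope_facet_system:
  fixes P :: "(real ^ 'n) set"
  assumes d: "d \<ge> 1" and rat: "rational_polytope P" and dim: "aff_dim P = int d"
  obtains I :: "(real ^ 'n) set set" and V a b f0 f M
  where "lattice_facets V I a b f0 f d" "I \<noteq> {}"
    "P = {x. x - f0 \<in> V \<and> (\<forall>i\<in>I. a i \<bullet> x \<le> b i)}"
    "\<forall>C. C facet_of P \<longleftrightarrow> (\<exists>h\<in>I. C = P \<inter> {x. a h \<bullet> x = b h})"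
    "M > (0::nat)" "\<forall>i\<in>I. \<exists>y\<in>integer_points. real M *\<^sub>R f0 - y \<in> V \<and> a i \<bullet> y = real M * b i"
proof -
  obtain W where W: "finite W" "\<And>v i. v \<in> W \<Longrightarrow> v $ i \<in> \<rat>" "P = convex hull W"
    using rat by (auto simp: rational_polytope_def)
  have poly: "polytope P" using W by (auto simp: polytope_def)
  have neP: "P \<noteq> {}" using dim by auto
  then have "W \<noteq> {}" using W(3) by auto
  then obtain v0 where v0: "v0 \<in> W" by blast
  define V where "V = span ((\<lambda>x. x - v0) ` W)"
  have subV: "subspace V" by (simp add: V_def)
  have intV: "integral_subspace V d"
    unfolding V_def using v0 W(2) dim unfolding W(3) aff_dim_convex_hull by (rule integral_direction_space)
  obtain I where I: "finite I" "P = affine hull P \<inter> \<Inter>I"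
      "\<forall>h\<in>I. \<exists>a b. a \<noteq> 0 \<and> h = {x. a \<bullet> x \<le> b}"
      "\<forall>F'. F' \<subset> I \<longrightarrow> P \<subset> affine hull P \<inter> \<Inter>F'"
    using polytope_imp_polyhedron[OF poly] unfolding polyhedron_Int_affine_minimal by blast
  obtain a b where ab: "\<And>h. h \<in> I \<Longrightarrow> a h \<noteq> 0 \<and> h = {x. a h \<bullet> x \<le> b h}"
    using I(3) by metis
  have rel: "rel_interior P = {x \<in> P. \<forall>h \<in> I. a h \<bullet> x < b h}"
    using I ab by (intro rel_interior_polyhedron_explicit) auto
  have facet: "C facet_of P \<longleftrightarrow> (\<exists>h. h \<in> I \<and> C = P \<inter> {x. a h \<bullet> x = b h})" for C
    using I ab by (intro facet_of_polyhedron_explicit) auto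
  have "rel_interior P \<noteq> {}"
    using neP poly rel_interior_eq_empty polytope_imp_convex by blast
  then obtain f0 where f0: "f0 \<in> P" "\<And>h. h \<in> I \<Longrightarrow> a h \<bullet> f0 < b h" unfolding rel by blast
  have A: "x \<in> affine hull P \<longleftrightarrow> x - f0 \<in> V" for x
  proof -
    have "y \<in> affine hull P \<longleftrightarrow> y - v0 \<in> V" for y
      unfolding W(3) affine_hull_convex_hull V_def by (rule affine_hull_direction[OF v0])
    moreover have "f0 - v0 \<in> V" using calculation[of f0] hull_inc[OF f0(1)] by blast
    moreover have "x - v0 \<in> V \<longleftrightarrow> x - f0 \<in> V"
      using subspace_add[OF subV, of "x - f0" "f0 - v0"] subspace_diff[OF subV, of "x - v0" "f0 - v0"]
        \<open>f0 - v0 \<in> V\<close> by auto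
    ultimately show ?thesis by blast
  qed
  have P: "P = {x. x - f0 \<in> V \<and> (\<forall>i\<in>I. a i \<bullet> x \<le> b i)}"
  proof -
    have "x \<in> \<Inter>I \<longleftrightarrow> (\<forall>i\<in>I. a i \<bullet> x \<le> b i)" for x using ab by blast
    then show ?thesis using I(2) A by blast
  qed
  \<comment> \<open>By minimality of \<open>I\<close>, dropping \<open>h\<close> admits a point
    \<open>x\<close> that violates only \<open>h\<close>; the segment from \<open>f0\<close> to
    \<open>x\<close> crosses the facet at a point strict in all other constraints.\<close>
  have "\<exists>p. p - f0 \<in> V \<and> a h \<bullet> p = b h \<and> (\<forall>g\<in>I. g \<noteq> h \<longrightarrow> a g \<bullet> p < b g)" if h: "h \<in> I" for h
  proof -
    have "I - {h} \<subset> I" using h by auto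
    then have "P \<subset> affine hull P \<inter> \<Inter>(I - {h})" using I(4) by (elim allE impE)
    from psubset_imp_ex_mem[OF this]
    obtain x where x: "x \<in> affine hull P" "x \<in> \<Inter>(I - {h})" "x \<notin> P" by blast
    have xg: "a g \<bullet> x \<le> b g" if "g \<in> I" "g \<noteq> h" for g
    proof -
      have "x \<in> g" using x(2) that by simp
      then show ?thesis using ab[OF that(1)] by blast
    qed
    have xV: "x - f0 \<in> V" using x(1) A by simp
    have xh: "a h \<bullet> x > b h"
    proof (rule ccontr)
      assume "\<not> a h \<bullet> x > b h"
      then have "a g \<bullet> x \<le> b g" if "g \<in> I" for g using xg that by (cases "g = h") auto
      then have "x \<in> {x. x - f0 \<in> V \<and> (\<forall>i\<in>I. a i \<bullet> x \<le> b i)}" using xV by simp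
      then show False using x(3) unfolding P[symmetric] by contradiction
    qed
    define t where "t = (b h - a h \<bullet> f0) / (a h \<bullet> x - a h \<bullet> f0)"
    have t: "0 < t" "t < 1" using xh f0(2)[OF h] by (auto simp: t_def)
    let ?p = "f0 + t *\<^sub>R (x - f0)"
    have "?p - f0 \<in> V" using xV subV by (simp add: subspace_scale)
    moreover have "a h \<bullet> ?p = b h"
      using xh f0(2)[OF h] by (simp add: inner_add_right inner_diff_right t_def)
    moreover have "a g \<bullet> ?p < b g" if g: "g \<in> I" "g \<noteq> h" for g
    proof -
      have "a g \<bullet> ?p = (1 - t) * (a g \<bullet> f0) + t * (a g \<bullet> x)"
        by (simp add: inner_add_right inner_diff_right algebra_simps)
      also have "\<dots> < (1 - t) * b g + t * b g"
        using t f0(2)[OF g(1)] xg[OF g] by (intro add_less_le_mono mult_strict_left_mono mult_left_mono) auto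
      finally show ?thesis by (simp add: algebra_simps)
    qed
    ultimately show ?thesis by blast
  qed
  then obtain f where f: "\<And>h. h \<in> I \<Longrightarrow> f h - f0 \<in> V" "\<And>h. h \<in> I \<Longrightarrow> a h \<bullet> f h = b h"
    "\<And>h g. h \<in> I \<Longrightarrow> g \<in> I \<Longrightarrow> g \<noteq> h \<Longrightarrow> a g \<bullet> f h < b g" by metis
  \<comment> \<open>A face of the hull of \<open>W\<close> is the hull of a subset of
    \<open>W\<close>, which gives every facet rational generators.\<close>
  have vert: "\<exists>W'. W' \<subseteq> W \<and> W' \<noteq> {} \<and> P \<inter> {x. a h \<bullet> x = b h} = convex hull W' \<and> aff_dim W' = int (d - 1)"
    if h: "h \<in> I" for h
  proof -
    have F: "(P \<inter> {x. a h \<bullet> x = b h}) facet_of P" using facet h by blast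
    then have "(P \<inter> {x. a h \<bullet> x = b h}) face_of convex hull W" by (simp add: facet_of_def W(3))
    then obtain W' where W': "W' \<subseteq> W" "P \<inter> {x. a h \<bullet> x = b h} = convex hull W'"
      using face_of_convex_hull_subset[of W] finite_imp_compact[OF W(1)] by blast
    have "aff_dim W' = int (d - 1)"
      using F dim d unfolding facet_of_def W'(2) aff_dim_convex_hull by linarith
    moreover have "W' \<noteq> {}" using F unfolding facet_of_def W'(2) by auto
    ultimately show ?thesis using W' by blast
  qed
  have Vh: "integral_subspace {v \<in> V. a h \<bullet> v = 0} (d - 1)" if h: "h \<in> I" for h
  proof -
    obtain W' where W': "W' \<subseteq> W" "W' \<noteq> {}" "P \<inter> {x. a h \<bullet> x = b h} = convex hull W'" "aff_dim W' = int (d - 1)"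
      using vert[OF h] by blast
    obtain w where w: "w \<in> W'" using W'(2) by blast
    have hull: "affine hull W' = {x. x - f0 \<in> V \<and> a h \<bullet> x = b h}"
      using affine_hull_facet[OF I(1) h subV P f(1)[OF h] f(2)[OF h] f(3)[OF h]]
      unfolding W'(3) affine_hull_convex_hull by blast
    have w': "w - f0 \<in> V" "a h \<bullet> w = b h" using hull_inc[OF w, of affine] unfolding hull by auto
    have "v \<in> {v \<in> V. a h \<bullet> v = 0} \<longleftrightarrow> v \<in> span ((\<lambda>x. x - w) ` W')" for v
    proof -
      have "v \<in> span ((\<lambda>x. x - w) ` W') \<longleftrightarrow> w + v \<in> affine hull W'"
        using affine_hull_direction[OF w, of "w + v"] by simp
      also have "\<dots> \<longleftrightarrow> (w + v) - f0 \<in> V \<and> a h \<bullet> v = 0" unfolding hull using w' by (simp add: inner_add_right)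
      also have "(w + v) - f0 \<in> V \<longleftrightarrow> v \<in> V"
        using w' subspace_add[OF subV w'(1), of v] subspace_diff[OF subV _ w'(1), of "(w + v) - f0"]
        by (auto simp: algebra_simps)
      finally show ?thesis by blast
    qed
    then have "{v \<in> V. a h \<bullet> v = 0} = span ((\<lambda>x. x - w) ` W')" by blast
    then show ?thesis using integral_direction_space[OF w _ W'(4)] W(2) W'(1) by auto
  qed
  have "\<exists>g>0. (\<lambda>x. a h \<bullet> x) ` (integer_points \<inter> V) = (\<lambda>z. g * z) ` \<int>" if h: "h \<in> I" for h
  proof -
    obtain B where B: "B \<subseteq> integer_points" "span B = V" using intV by (auto simp: integral_subspace_def)
    \<comment> \<open>Otherwise \<open>a h\<close> would vanish on \<open>V\<close>, yet its values
      at \<open>f h\<close> and \<open>f0\<close> differ.\<close>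
    have "\<exists>w\<in>B. a h \<bullet> w \<noteq> 0"
    proof (rule ccontr)
      assume "\<not> (\<exists>w\<in>B. a h \<bullet> w \<noteq> 0)"
      then have "B \<subseteq> {x. a h \<bullet> x = 0}" by blast
      then have "span B \<subseteq> {x. a h \<bullet> x = 0}" by (rule span_minimal) (rule subspace_hyperplane)
      then have "a h \<bullet> (f h - f0) = 0" using B(2) f(1)[OF h] by blast
      then show False using f(2)[OF h] f0(2)[OF h] by (simp add: inner_diff_right)
    qed
    then obtain w where "w \<in> integer_points \<inter> V" "a h \<bullet> w \<noteq> 0"
      using B span_superset[of B] by blast
    then show ?thesis using functional_values_cyclic[OF intV Vh[OF h]] by blast
  qed
  then obtain g where g: "\<And>h. h \<in> I \<Longrightarrow> g h > 0"
    "\<And>h. h \<in> I \<Longrightarrow> (\<lambda>x. a h \<bullet> x) ` (integer_points \<inter> V) = (\<lambda>z. g h * z) ` \<int>" by metis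
  \<comment> \<open>Dividing by the generator \<open>g h\<close> makes the values on the lattice
    exactly the integers and keeps every half-space.\<close>
  define a' where "a' = (\<lambda>h. (1 / g h) *\<^sub>R a h)"
  define b' where "b' = (\<lambda>h. b h / g h)"
  have le: "a' h \<bullet> x \<le> b' h \<longleftrightarrow> a h \<bullet> x \<le> b h" "a' h \<bullet> x < b' h \<longleftrightarrow> a h \<bullet> x < b h"
    "a' h \<bullet> x = b' h \<longleftrightarrow> a h \<bullet> x = b h" "a' h \<bullet> x = 0 \<longleftrightarrow> a h \<bullet> x = 0" if "h \<in> I" for h x
    using g(1)[OF that] by (auto simp: a'_def b'_def divide_le_cancel divide_less_cancel)
  have P': "P = {x. x - f0 \<in> V \<and> (\<forall>i\<in>I. a' i \<bullet> x \<le> b' i)}"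
    by (rule trans[OF P]) (use le(1) in auto)
  have lf: "lattice_facets V I a' b' f0 f d"
  proof
    show "bounded {x. x - f0 \<in> V \<and> (\<forall>i\<in>I. a' i \<bullet> x \<le> b' i)}"
      using polytope_imp_bounded[OF poly] P' by simp
    show "integral_subspace {v \<in> V. a' i \<bullet> v = 0} (d - 1)" if "i \<in> I" for i
      using Vh[OF that] le(4)[OF that] by simp
    show "(\<lambda>x. a' i \<bullet> x) ` (integer_points \<inter> V) = \<int>" if i: "i \<in> I" for i
    proof -
      have "(\<lambda>x. a' i \<bullet> x) ` (integer_points \<inter> V) = (\<lambda>z. z / g i) ` (\<lambda>x. a i \<bullet> x) ` (integer_points \<inter> V)"
        by (simp add: image_image a'_def)
      also have "\<dots> = \<int>" unfolding g(2)[OF i] using g(1)[OF i] by (simp add: image_image)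
      finally show ?thesis .
    qed
  qed (use I(1) d intV f f0 le in auto)
  have ne: "I \<noteq> {}"
  proof -
    have "0 < aff_dim P" using dim d by simp
    then obtain F where "F facet_of P" using polytope_facet_exists[OF poly] by blast
    then show ?thesis using facet by blast
  qed
  have facet': "C facet_of P \<longleftrightarrow> (\<exists>h\<in>I. C = P \<inter> {x. a' h \<bullet> x = b' h})" for C
    unfolding facet Bex_def by (intro ex_cong1 conj_cong refl) (simp add: le(3))
  obtain N :: "real ^ 'n \<Rightarrow> nat" where N: "\<And>v. v \<in> W \<Longrightarrow> N v > 0 \<and> real (N v) *\<^sub>R v \<in> integer_points"
    using rational_vector_integer_multiple W(2) by metis
  \<comment> \<open>Clears the denominators of all generators, so \<open>M\<close> times a generator
    on a facet is an integer point in the hull of the dilated facet.\<close>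
  define M where "M = (\<Prod>v\<in>W. N v)"
  have M0: "M > 0" unfolding M_def using N by (simp add: prod_pos)
  have MW: "real M *\<^sub>R v \<in> integer_points" if "v \<in> W" for v
  proof -
    have "M = (\<Prod>v\<in>W - {v}. N v) * N v" unfolding M_def using that W(1) by (simp add: prod.remove mult.commute)
    then have "real M *\<^sub>R v = real (\<Prod>v\<in>W - {v}. N v) *\<^sub>R (real (N v) *\<^sub>R v)" by simp
    then show ?thesis using N[OF that] integer_points_scale[OF Ints_of_nat] by metis
  qed
  have hits: "\<exists>y\<in>integer_points. real M *\<^sub>R f0 - y \<in> V \<and> a' i \<bullet> y = real M * b' i" if i: "i \<in> I" for i
  proof -
    obtain W' where W': "W' \<subseteq> W" "W' \<noteq> {}" "P \<inter> {x. a i \<bullet> x = b i} = convex hull W'"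
      using vert[OF i] by blast
    obtain w where w: "w \<in> W'" using W'(2) by blast
    then have "w \<in> P \<inter> {x. a i \<bullet> x = b i}" unfolding W'(3) by (rule hull_inc)
    then have "w - f0 \<in> V" "a' i \<bullet> w = b' i" using P le(3)[OF i] by auto
    moreover have "real M *\<^sub>R f0 - real M *\<^sub>R w = (- real M) *\<^sub>R (w - f0)" by (simp add: algebra_simps)
    ultimately show ?thesis
      using MW[of w] w W'(1) subspace_scale[OF subV, of "w - f0" "- real M"]
      by (intro bexI[of _ "real M *\<^sub>R w"]) auto
  qed
  show thesis
    by (rule that[OF lf ne P']) (use facet' M0 hits in blast)+
qed

text \<open>Scaling by \<open>q > 0\<close> is injective and linear, so it carries facets and their
  affine hulls to those of the dilate; \<open>affine_hull_facet\<close> turns the hulls into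
  equations.\<close>

lemma dilate_facets_iff:
  fixes P :: "(real ^ 'n) set" and I :: "'i set"
  assumes lf: "lattice_facets V I a b f0 f d" and P: "P = {x. x - f0 \<in> V \<and> (\<forall>i\<in>I. a i \<bullet> x \<le> b i)}"
    and dim: "aff_dim P = int d" and facet: "\<And>C. C facet_of P \<longleftrightarrow> (\<exists>h\<in>I. C = P \<inter> {x. a h \<bullet> x = b h})"
    and q: "q > 0"
  shows "(\<forall>F. F face_of dilate q P \<and> aff_dim F = int (d - 1) \<longrightarrow> affine hull F \<inter> integer_points \<noteq> {})
    \<longleftrightarrow> lattice_facets.hits_facets V I a b f0 q"
proof -
  interpret lattice_facets V I a b f0 f d by (rule lf)
  let ?s = "\<lambda>x :: real ^ 'n. real q *\<^sub>R x"
  have s: "linear ?s" "inj ?s" "bounded_linear ?s"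
    using q by (auto simp: inj_on_def linear_iff algebra_simps bounded_linear_scaleR_right)
  have faces: "(F face_of dilate q P \<and> aff_dim F = int (d - 1)) \<longleftrightarrow> (\<exists>C. F = ?s ` C \<and> C facet_of P)" for F
  proof -
    have "F face_of dilate q P \<longleftrightarrow> (\<exists>C. F = ?s ` C \<and> C face_of P)"
      using faces_of_linear_image[OF s(1,2), of P] unfolding dilate_def by blast
    \<comment> \<open>As \<open>d \<ge> 1\<close>, dimension \<open>d - 1\<close> rules out the
      empty face, just as \<open>facet_of\<close> does.\<close>
    moreover have "(C face_of P \<and> aff_dim C = int (d - 1)) \<longleftrightarrow> C facet_of P" for C
      using dim d_pos by (auto simp: facet_of_def)
    ultimately show ?thesis using aff_dim_injective_linear_image[OF s(1,2)] by metis
  qed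
  have "affine hull (?s ` (P \<inter> {x. a h \<bullet> x = b h})) \<inter> integer_points \<noteq> {}
      \<longleftrightarrow> (\<exists>y\<in>integer_points. adm (real q) y \<and> a h \<bullet> y = real q * b h)" if h: "h \<in> I" for h
  proof -
    have "affine hull (P \<inter> {x. a h \<bullet> x = b h}) = {x. x - f0 \<in> V \<and> a h \<bullet> x = b h}"
      by (rule affine_hull_facet[OF finI h subV P f_mem[OF h] f_eq[OF h] f_less[OF h]])
    then have "affine hull (?s ` (P \<inter> {x. a h \<bullet> x = b h})) = ?s ` {x. x - f0 \<in> V \<and> a h \<bullet> x = b h}"
      by (simp only: affine_hull_linear_image[OF s(3), symmetric])
    moreover have "y \<in> ?s ` {x. x - f0 \<in> V \<and> a h \<bullet> x = b h} \<longleftrightarrow> adm (real q) y \<and> a h \<bullet> y = real q * b h" for y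
    proof
      assume "y \<in> ?s ` {x. x - f0 \<in> V \<and> a h \<bullet> x = b h}"
      then obtain x where x: "x - f0 \<in> V" "a h \<bullet> x = b h" "y = real q *\<^sub>R x" by blast
      have "real q *\<^sub>R f0 - y = (- real q) *\<^sub>R (x - f0)" by (simp add: x(3) algebra_simps)
      then show "adm (real q) y \<and> a h \<bullet> y = real q * b h"
        using subspace_scale[OF subV x(1), of "- real q"] x by (simp add: adm_def)
    next
      assume y: "adm (real q) y \<and> a h \<bullet> y = real q * b h"
      let ?x = "(1 / real q) *\<^sub>R y"
      have "?x - f0 = (- (1 / real q)) *\<^sub>R (real q *\<^sub>R f0 - y)" using q by (simp add: algebra_simps)
      then have "?x - f0 \<in> V"
        using subspace_scale[OF subV, of "real q *\<^sub>R f0 - y" "- (1 / real q)"] y by (simp add: adm_def)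
      then show "y \<in> ?s ` {x. x - f0 \<in> V \<and> a h \<bullet> x = b h}"
        using y q by (intro image_eqI[of _ _ ?x]) auto
    qed
    ultimately show ?thesis by blast
  qed
  then have "(\<forall>h\<in>I. affine hull (?s ` (P \<inter> {x. a h \<bullet> x = b h})) \<inter> integer_points \<noteq> {}) \<longleftrightarrow> hits_facets q"
    by (simp add: hits_facets_def)
  moreover have "(\<forall>F. F face_of dilate q P \<and> aff_dim F = int (d - 1) \<longrightarrow> affine hull F \<inter> integer_points \<noteq> {})
      \<longleftrightarrow> (\<forall>h\<in>I. affine hull (?s ` (P \<inter> {x. a h \<bullet> x = b h})) \<inter> integer_points \<noteq> {})"
    unfolding faces facet by blast
  ultimately show ?thesis by blast
qed

lemma periodic_multiple:
  assumes "\<forall>k. c (k + p) = c k"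
  shows "c (k + int m * p) = (c k :: complex)"
proof (induction m)
  case (Suc m)
  have "k + int (Suc m) * p = (k + int m * p) + p" by (simp add: algebra_simps)
  then have "c (k + int (Suc m) * p) = c (k + int m * p)" using assms by (simp only:)
  then show ?case by (simp only: Suc)
qed simp

theorem theorem3:
  fixes P :: "(real ^ 'n) set" and d :: nat
    and L :: "int \<Rightarrow> complex" and c :: "nat \<Rightarrow> int \<Rightarrow> complex"
  assumes "d \<ge> 1"
    and "rational_polytope P"
    and "aff_dim P = int d"
    and "is_Ehrhart_quasi_polynomial P L"
    and "has_quasi_polynomial_form L d c"
  shows "has_minimum_period (c (d - 1)) (face_index (d - 1) P)"
proof -
  obtain I :: "(real ^ 'n) set set" and V a b f0 f M where lf: "lattice_facets V I a b f0 f d" and ne: "I \<noteq> {}"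
    and P: "P = {x. x - f0 \<in> V \<and> (\<forall>i\<in>I. a i \<bullet> x \<le> b i)}"
    and facet: "\<forall>C. C facet_of P \<longleftrightarrow> (\<exists>h\<in>I. C = P \<inter> {x. a h \<bullet> x = b h})"
    and M: "M > (0::nat)" "\<forall>i\<in>I. \<exists>y\<in>integer_points. real M *\<^sub>R f0 - y \<in> V \<and> a i \<bullet> y = real M * b i"
    by (rule rational_polytope_facet_system[OF assms(1-3)]) (rule that)
  interpret lattice_facets V I a b f0 f d by (rule lf)
  have body: "body = P" unfolding body_def P ..
  have hits_iff: "(\<forall>F. F face_of dilate q P \<and> aff_dim F = int (d - 1) \<longrightarrow> affine hull F \<inter> integer_points \<noteq> {})
      \<longleftrightarrow> hits_facets q" if "q > 0" for q
    using dilate_facets_iff[OF lf P assms(3) facet[rule_format] that] .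
  have M_hits: "hits_facets M" using M(2) by (simp add: hits_facets_def adm_def)
  have "\<forall>i\<in>{..d}. \<exists>p>0. \<forall>k. c i (k + p) = c i k"
    using assms(5) by (auto simp: has_quasi_polynomial_form_def periodic_def)
  from bchoice[OF this] obtain p where "\<forall>i\<in>{..d}. p i > 0 \<and> (\<forall>k. c i (k + p i) = c i k)" ..
  then have p: "p i > 0" "\<forall>k. c i (k + p i) = c i k" if "i \<le> d" for i
    using that by auto
  \<comment> \<open>A common period of all coefficients; the further factor \<open>M\<close> in
    \<open>T\<close> makes it hit the facets.\<close>
  define Q where "Q = (\<Prod>i\<le>d. nat (p i))"
  define T where "T = Q * M"
  have Q0: "Q > 0" unfolding Q_def using p(1) by (intro prod_pos) auto
  have c_T: "c i (k + int T) = c i k" if i: "i \<le> d" for i k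
  proof -
    have "Q = (\<Prod>j\<in>{..d} - {i}. nat (p j)) * nat (p i)"
      unfolding Q_def using i by (simp add: prod.remove[of "{..d}" i] mult.commute)
    then have "int T = int ((\<Prod>j\<in>{..d} - {i}. nat (p j)) * M) * p i"
      unfolding T_def using p(1)[OF i] by simp
    then show ?thesis using periodic_multiple[of "c i", OF p(2)[OF i]] by (simp only:)
  qed
  interpret ehrhart_facets V I a b f0 f d c T
  proof
    show "I \<noteq> {}" by (rule ne)
    show "T > 0" using Q0 M(1) by (simp add: T_def)
    show "hits_facets T" unfolding T_def by (rule hits_facets_mult[OF M_hits])
    show "c i (k + int T) = c i k" if "i \<le> d" for i k using c_T[OF that] .
    show "complex_of_real (count k) = (\<Sum>i\<le>d. c i (int k) * of_nat k ^ i)" if "k > 0" for k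
    proof -
      have "complex_of_real (count k) = L (int k)"
        using assms(4) that unfolding is_Ehrhart_quasi_polynomial_def count_def body by simp
      also have "\<dots> = (\<Sum>i\<le>d. c i (int k) * of_nat k ^ i)"
        using assms(5) unfolding has_quasi_polynomial_form_def by simp
      finally show ?thesis .
    qed
  qed
  have index: "face_index (d - 1) P = (LEAST p. p > 0 \<and> hits_facets p)"
    unfolding face_index_def using hits_iff by (intro arg_cong[of _ _ Least]) (auto simp: fun_eq_iff)
  have "face_index (d - 1) P > 0 \<and> hits_facets (face_index (d - 1) P)"
    unfolding index using M(1) M_hits by (intro LeastI[of "\<lambda>p. p > 0 \<and> hits_facets p" M]) auto
  moreover have "face_index (d - 1) P \<le> q" if "q > 0" "\<forall>k. c (d - 1) (k + int q) = c (d - 1) k" for q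
    unfolding index using period_imp_hits_facets[of q] that by (intro Least_le) auto
  ultimately show ?thesis
    unfolding has_minimum_period_def using hits_facets_imp_period by blast
qed

end
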